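(* Let $\lambda>0$ and let $L$ be a two-sided real-valued Lévy process possessing a finite second moment, with $V=\operatorname{Var}(L_1)>0$. Let $$X_t=\int_{-\infty}^\infty e^{-\lambda|t-u|}\,dL_u,\qquad t\ge0 .$$ Then for every integer $k\ge1$ $$\operatorname{Corr}(X_{k+1}-X_k,X_1-X_0)=e^{-\lambda k}\left(\frac12+\frac12\,\frac{1-e^{\lambda}+\lambda e^{\lambda}}{1-e^{-\lambda}-\lambda e^{-\lambda}}\right)+\lambda k e^{-\lambda k}\left(\frac12+\frac12\,\frac{1-e^{\lambda}+\lambda e^{-\lambda}}{1-e^{-\lambda}-\lambda e^{-\lambda}}\right),$$ and as a special case the first-order autocorrelation is $$\operatorname{Corr}(X_2-X_1,X_1-X_0)=e^{-\lambda}\left(\frac{1+\lambda}{2}+\frac12\,\frac{1+\lambda-e^{\lambda}+\lambda^2e^{-\lambda}}{1-e^{-\lambda}-\lambda e^{-\lambda}}\right).$$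
   Context: The two-sided Lévy process is obtained from two independent copies $L^{(1)},L^{(2)}$ of a Lévy process on $[0,\infty)$ by $L_t=L^{(1)}_t$ for $t\ge0$ and $L_t=-L^{(2)}_{(-t)-}$ for $t<0$. Integrals of deterministic functions over $\mathbb{R}$ with respect to $L$ are meant in the sense of Rajput and Rosinski: with $\Lambda$ the independently scattered random measure on bounded Borel sets associated with $L$ (so $\Lambda((a,b])=L_b-L_a$), a measurable $f$ is integrable if there are step functions $g_n\to f$ Lebesgue-a.e. such that $\lim_n\int_Ag_n\,d\Lambda$ exists in probability for every Borel set $A$, and then $\int_{\mathbb{R}} f\,dL_s=\lim_n\int_{\mathbb{R}} g_n\,d\Lambda$. Under the stated assumptions the integrals defining $X_t$ exist. *)

theory Defs
  imports "HOL-Probability.Probability"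
begin

definition conv_in_prob ::
  "'a measure \<Rightarrow> 'i filter \<Rightarrow> ('i \<Rightarrow> 'a \<Rightarrow> real) \<Rightarrow> ('a \<Rightarrow> real) \<Rightarrow> bool" where
  "conv_in_prob M F Y Z \<longleftrightarrow>
     (\<forall>\<epsilon>>0. ((\<lambda>i. measure M {\<omega> \<in> space M. \<bar>Y i \<omega> - Z \<omega>\<bar> > \<epsilon>}) \<longlongrightarrow> 0) F)"

section \<open>Levy processes\<close>

text \<open>One-sided processes are indexed by all of \<open>real\<close>, but only times \<open>t \<ge> 0\<close> matter.\<close>

definition cadlag :: "(real \<Rightarrow> real) \<Rightarrow> bool" where
  "cadlag p \<longleftrightarrow>
     (\<forall>t\<ge>0. continuous (at_right t) p) \<and> (\<forall>t>0. \<exists>l. (p \<longlongrightarrow> l) (at_left t))"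

definition levy_process :: "'a measure \<Rightarrow> (real \<Rightarrow> 'a \<Rightarrow> real) \<Rightarrow> bool" where
  "levy_process M L \<longleftrightarrow>
     (\<forall>t\<ge>0. L t \<in> borel_measurable M) \<and>
     (AE \<omega> in M. L 0 \<omega> = 0) \<and>
     (\<forall>(n::nat) (t :: nat \<Rightarrow> real). 0 \<le> t 0 \<and> mono t \<longrightarrow>
        prob_space.indep_vars M (\<lambda>_. borel) (\<lambda>i \<omega>. L (t (Suc i)) \<omega> - L (t i) \<omega>) {..<n}) \<and>
     (\<forall>s\<ge>0. \<forall>h\<ge>0. distr M borel (\<lambda>\<omega>. L (s + h) \<omega> - L s \<omega>) = distr M borel (L h)) \<and>
     (\<forall>s\<ge>0. conv_in_prob M (at s within {0..}) L (L s)) \<and>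
     (AE \<omega> in M. cadlag (\<lambda>t. L t \<omega>))"

definition sample_path :: "(real \<Rightarrow> 'a \<Rightarrow> real) \<Rightarrow> 'a \<Rightarrow> real \<Rightarrow> real" where
  "sample_path L \<omega> = (\<lambda>t\<in>{0..}. L t \<omega>)"

definition independent_copies ::
  "'a measure \<Rightarrow> (real \<Rightarrow> 'a \<Rightarrow> real) \<Rightarrow> (real \<Rightarrow> 'a \<Rightarrow> real) \<Rightarrow> bool" where
  "independent_copies M L1 L2 \<longleftrightarrow>
     (let P = (\<Pi>\<^sub>M t\<in>{0..}. borel) in
        prob_space.indep_var M P (sample_path L1) P (sample_path L2) \<and>
        distr M P (sample_path L1) = distr M P (sample_path L2))"

text \<open>The left limit exists for almost every \<open>\<omega>\<close>, since the paths are almost surely cadlag;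
  on the exceptional null set \<^const>\<open>Lim\<close> is an unspecified value.\<close>

definition two_sided_levy_process :: "'a measure \<Rightarrow> (real \<Rightarrow> 'a \<Rightarrow> real) \<Rightarrow> bool" where
  "two_sided_levy_process M L \<longleftrightarrow>
     (\<exists>L1 L2. levy_process M L1 \<and> levy_process M L2 \<and> independent_copies M L1 L2 \<and>
        (\<forall>\<omega>\<in>space M. \<forall>t. L t \<omega> =
           (if t \<ge> 0 then L1 t \<omega> else - Lim (at_left (- t)) (\<lambda>s. L2 s \<omega>))))"

section \<open>The Rajput--Rosinski integral of deterministic functions\<close>

definition bounded_borel :: "real set set" where
  "bounded_borel = {A \<in> sets borel. bounded A}"

definition levy_random_measure ::
  "'a measure \<Rightarrow> (real \<Rightarrow> 'a \<Rightarrow> real) \<Rightarrow> (real set \<Rightarrow> 'a \<Rightarrow> real) \<Rightarrow> bool" where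
  "levy_random_measure M L \<Lambda> \<longleftrightarrow>
     (\<forall>A\<in>bounded_borel. \<Lambda> A \<in> borel_measurable M) \<and>
     (\<forall>A :: nat \<Rightarrow> real set. range A \<subseteq> bounded_borel \<and> disjoint_family A \<longrightarrow>
        prob_space.indep_vars M (\<lambda>_. borel) (\<lambda>n. \<Lambda> (A n)) UNIV) \<and>
     (\<forall>A :: nat \<Rightarrow> real set.
        range A \<subseteq> bounded_borel \<and> disjoint_family A \<and> bounded (\<Union>n. A n) \<longrightarrow>
        (AE \<omega> in M. (\<lambda>n. \<Lambda> (A n) \<omega>) sums \<Lambda> (\<Union>n. A n) \<omega>)) \<and>
     (\<forall>a b. a \<le> b \<longrightarrow> (AE \<omega> in M. \<Lambda> {a<..b} \<omega> = L b \<omega> - L a \<omega>))"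

definition step_fun :: "(real \<Rightarrow> real) \<Rightarrow> bool" where
  "step_fun g \<longleftrightarrow> simple_function borel g \<and> bounded {x. g x \<noteq> 0}"

text \<open>A step function is taken in its canonical form \<open>\<Sum>y. y * indicator (g -` {y})\<close>; the value
  \<open>0\<close> is omitted because its level set is unbounded.\<close>

definition step_integral ::
  "(real set \<Rightarrow> 'a \<Rightarrow> real) \<Rightarrow> real set \<Rightarrow> (real \<Rightarrow> real) \<Rightarrow> 'a \<Rightarrow> real" where
  "step_integral \<Lambda> A g \<omega> = (\<Sum>y\<in>range g - {0}. y * \<Lambda> (A \<inter> g -` {y}) \<omega>)"

text \<open>\<open>has_levy_integral M L f Y\<close>: the function \<open>f\<close> is integrable with respect to \<open>L\<close> over the
  whole line, and the random variable \<open>Y\<close> is a version of its integral. (The integral, like the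
  random measure, is only determined up to null sets.)\<close>

definition has_levy_integral ::
  "'a measure \<Rightarrow> (real \<Rightarrow> 'a \<Rightarrow> real) \<Rightarrow> (real \<Rightarrow> real) \<Rightarrow> ('a \<Rightarrow> real) \<Rightarrow> bool" where
  "has_levy_integral M L f Y \<longleftrightarrow>
     f \<in> borel_measurable borel \<and> Y \<in> borel_measurable M \<and>
     (\<exists>\<Lambda> (g :: nat \<Rightarrow> real \<Rightarrow> real).
        levy_random_measure M L \<Lambda> \<and>
        (\<forall>n. step_fun (g n)) \<and>
        (AE x in lborel. (\<lambda>n. g n x) \<longlonglongrightarrow> f x) \<and>
        (\<forall>A\<in>sets borel. \<exists>Z\<in>borel_measurable M.
           conv_in_prob M sequentially (\<lambda>n. step_integral \<Lambda> A (g n)) Z) \<and>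
        conv_in_prob M sequentially (\<lambda>n. step_integral \<Lambda> UNIV (g n)) Y)"

section \<open>Correlation\<close>

definition square_integrable :: "'a measure \<Rightarrow> ('a \<Rightarrow> real) \<Rightarrow> bool" where
  "square_integrable M X \<longleftrightarrow> X \<in> borel_measurable M \<and> integrable M (\<lambda>\<omega>. (X \<omega>)\<^sup>2)"

definition cov :: "'a measure \<Rightarrow> ('a \<Rightarrow> real) \<Rightarrow> ('a \<Rightarrow> real) \<Rightarrow> real" where
  "cov M X Y = integral\<^sup>L M (\<lambda>\<omega>. (X \<omega> - integral\<^sup>L M X) * (Y \<omega> - integral\<^sup>L M Y))"

text \<open>A relation rather than a function, so that \<open>has_corr M X Y r\<close> means that the correlation is
  well defined and equal to \<open>r\<close>, excluding the default values of \<^const>\<open>lebesgue_integral\<close> and of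
  division by zero.\<close>

definition has_corr :: "'a measure \<Rightarrow> ('a \<Rightarrow> real) \<Rightarrow> ('a \<Rightarrow> real) \<Rightarrow> real \<Rightarrow> bool" where
  "has_corr M X Y r \<longleftrightarrow>
     square_integrable M X \<and> square_integrable M Y \<and>
     prob_space.variance M X > 0 \<and> prob_space.variance M Y > 0 \<and>
     r = cov M X Y / (sqrt (prob_space.variance M X) * sqrt (prob_space.variance M Y))"

end

(*
  An integrable f with respect to the Levy process L is approximated in probability, over every
  Borel set, by step functions g n. Since L 1 has finite variance V, the random measure of a bounded
  Borel set has mean proportional to its Lebesgue measure and is uncorrelated over disjoint sets, so that
  step integrals obey an Ito isometry. Truncating the g n where they exceed 2 |f| gives step functions
  that converge to f in L1 and L2, whence their integrals converge in L2; a gliding hump argument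
  shows that the discarded parts contribute nothing to the limit. Hence X t is the L2 integral of
  exp (- l |t - u|), and the covariance of integrals of f and f' is V times the integral of f f'.
  It remains to integrate products of two-sided exponentials.
*)

theory Submission
  imports Defs
begin

section \<open>Square-integrable random variables and convergence in probability\<close>

text \<open>The notion of integral controls the approximating step functions only almost everywhere
  and their integrals only in probability, so moments of the limit cannot be read off directly.
  Convergence over every Borel set, and not just over the line, is what rescues them: for
  \<open>L\<close> a Poisson process plus a drift c, the functions n times the indicator of (0, 1/n]
  tend to 0 almost everywhere, while their integrals over the line tend in probability to c. The
  gliding hump excludes this behaviour by testing on two complementary sets.

  \<open>\<Lambda>\<close> is not centred, so the second moment of an integral is V times a squared
  L2 norm plus the squared mean of \<open>L 1\<close> times a squared integral. Hence approximation
  is needed in L1 and in L2 at once.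

  Each integral comes with its own random measure, which is bound existentially. Almost sure
  uniqueness of the random measure on bounded Borel sets makes differences of integrals integrals
  again, and covariances then follow by polarization from second moments alone.\<close>

lemma square_integrable_mult:
  assumes "square_integrable M X" "square_integrable M Y"
  shows "integrable M (\<lambda>\<omega>. X \<omega> * Y \<omega>)"
proof (rule Bochner_Integration.integrable_bound)
  show "integrable M (\<lambda>\<omega>. (X \<omega>)\<^sup>2 + (Y \<omega>)\<^sup>2)"
    using assms by (auto simp: square_integrable_def)
  show "(\<lambda>\<omega>. X \<omega> * Y \<omega>) \<in> borel_measurable M"
    using assms by (auto simp: square_integrable_def)
  have "\<bar>x * y\<bar> \<le> x\<^sup>2 + y\<^sup>2" for x y :: real
  proof -
    have "2 * (\<bar>x\<bar> * \<bar>y\<bar>) \<le> x\<^sup>2 + y\<^sup>2"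
      using sum_squares_bound[of "\<bar>x\<bar>" "\<bar>y\<bar>"] by (simp add: mult.assoc)
    moreover have "0 \<le> \<bar>x\<bar> * \<bar>y\<bar>" by simp
    ultimately show ?thesis unfolding abs_mult by linarith
  qed
  then show "AE \<omega> in M. norm (X \<omega> * Y \<omega>) \<le> norm ((X \<omega>)\<^sup>2 + (Y \<omega>)\<^sup>2)"
    by (auto simp: abs_of_nonneg)
qed

lemma square_integrable_cmult:
  "square_integrable M X \<Longrightarrow> square_integrable M (\<lambda>\<omega>. c * X \<omega>)"
  by (auto simp: square_integrable_def power_mult_distrib)

lemma square_integrable_add:
  assumes "square_integrable M X" "square_integrable M Y"
  shows "square_integrable M (\<lambda>\<omega>. X \<omega> + Y \<omega>)"
  using square_integrable_mult[OF assms] assms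
  by (auto simp: square_integrable_def power2_sum mult.assoc)

lemma square_integrable_diff:
  assumes "square_integrable M X" "square_integrable M Y"
  shows "square_integrable M (\<lambda>\<omega>. X \<omega> - Y \<omega>)"
  using square_integrable_add[OF assms(1) square_integrable_cmult[OF assms(2), of "-1"]] by simp

lemma square_integrable_cong_AE:
  assumes "square_integrable M X" "Y \<in> borel_measurable M" "AE \<omega> in M. X \<omega> = Y \<omega>"
  shows "square_integrable M Y"
proof -
  have "integrable M (\<lambda>\<omega>. (X \<omega>)\<^sup>2) \<longleftrightarrow> integrable M (\<lambda>\<omega>. (Y \<omega>)\<^sup>2)"
    using assms by (intro integrable_cong_AE) (auto simp: square_integrable_def)
  with assms show ?thesis by (simp add: square_integrable_def)
qed

section \<open>The geometry of square-integrable random variables\<close>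

context prob_space
begin

lemma square_integrable_const: "square_integrable M (\<lambda>_. c)"
  by (simp add: square_integrable_def)

lemma square_integrable_integrable:
  "square_integrable M X \<Longrightarrow> integrable M X"
  using square_integrable_mult[OF _ square_integrable_const[of 1]] by simp

lemma square_integrable_sum:
  "(\<And>i. i \<in> I \<Longrightarrow> square_integrable M (X i)) \<Longrightarrow> square_integrable M (\<lambda>\<omega>. \<Sum>i\<in>I. X i \<omega>)"
  by (induction I rule: infinite_finite_induct)
     (auto intro: square_integrable_add simp: square_integrable_const)

lemma expectation_square_sum:
  assumes "square_integrable M X" "square_integrable M Y"
  shows "expectation (\<lambda>\<omega>. (X \<omega> + Y \<omega>)\<^sup>2) =
    expectation (\<lambda>\<omega>. (X \<omega>)\<^sup>2) + expectation (\<lambda>\<omega>. (Y \<omega>)\<^sup>2) + 2 * expectation (\<lambda>\<omega>. X \<omega> * Y \<omega>)"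
  using square_integrable_mult[OF assms] assms
  by (auto simp: square_integrable_def power2_sum mult.assoc)

lemma expectation_square_diff:
  assumes "square_integrable M X" "square_integrable M Y"
  shows "expectation (\<lambda>\<omega>. (X \<omega> - Y \<omega>)\<^sup>2) =
    expectation (\<lambda>\<omega>. (X \<omega>)\<^sup>2) + expectation (\<lambda>\<omega>. (Y \<omega>)\<^sup>2) - 2 * expectation (\<lambda>\<omega>. X \<omega> * Y \<omega>)"
  using square_integrable_mult[OF assms] assms
  by (auto simp: square_integrable_def power2_diff mult.assoc)

text \<open>The second moment of \<open>s * X \<omega> - t * Y \<omega>\<close> is a nonnegative
  quadratic form in s and t; suitable values of s and t give the bound.\<close>

lemma expectation_Cauchy_Schwarz:
  assumes X: "square_integrable M X" and Y: "square_integrable M Y"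
  shows "(expectation (\<lambda>\<omega>. X \<omega> * Y \<omega>))\<^sup>2
    \<le> expectation (\<lambda>\<omega>. (X \<omega>)\<^sup>2) * expectation (\<lambda>\<omega>. (Y \<omega>)\<^sup>2)"
proof -
  define a b c where "a = expectation (\<lambda>\<omega>. (X \<omega>)\<^sup>2)" and "b = expectation (\<lambda>\<omega>. X \<omega> * Y \<omega>)"
    and "c = expectation (\<lambda>\<omega>. (Y \<omega>)\<^sup>2)"
  have quad: "0 \<le> s\<^sup>2 * a + t\<^sup>2 * c - 2 * (s * t * b)" for s t
  proof -
    have "0 \<le> expectation (\<lambda>\<omega>. (s * X \<omega> - t * Y \<omega>)\<^sup>2)" by simp
    also have "\<dots> = expectation (\<lambda>\<omega>. (s * X \<omega>)\<^sup>2) + expectation (\<lambda>\<omega>. (t * Y \<omega>)\<^sup>2)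
        - 2 * expectation (\<lambda>\<omega>. (s * X \<omega>) * (t * Y \<omega>))"
      by (intro expectation_square_diff square_integrable_cmult X Y)
    also have "(\<lambda>\<omega>. (s * X \<omega>) * (t * Y \<omega>)) = (\<lambda>\<omega>. (s * t) * (X \<omega> * Y \<omega>))"
      by (auto simp: algebra_simps)
    finally show ?thesis by (simp add: power_mult_distrib a_def b_def c_def)
  qed
  have "a \<ge> 0" "c \<ge> 0" by (auto simp: a_def c_def)
  show ?thesis
    unfolding a_def[symmetric] b_def[symmetric] c_def[symmetric]
  proof (cases "c = 0")
    case True
    have "b = 0"
    proof (rule ccontr)
      assume "b \<noteq> 0"
      \<comment> \<open>For c = 0 the form is affine in t, and this t gives it the value -1.\<close>
      with quad[of 1 "(a + 1) / (2 * b)"] True show False by (simp add: field_simps)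
    qed
    with True show "b\<^sup>2 \<le> a * c" by simp
  next
    case False
    with \<open>c \<ge> 0\<close> have "c > 0" by simp
    \<comment> \<open>At s = c and t = b the form factors in this way.\<close>
    have "0 \<le> c * (a * c - b\<^sup>2)"
      using quad[of c b] by (simp add: power2_eq_square algebra_simps)
    with \<open>c > 0\<close> show "b\<^sup>2 \<le> a * c" by (simp add: zero_le_mult_iff)
  qed
qed

lemma expectation_square_le:
  assumes "square_integrable M X"
  shows "(expectation X)\<^sup>2 \<le> expectation (\<lambda>\<omega>. (X \<omega>)\<^sup>2)"
  using expectation_Cauchy_Schwarz[OF assms square_integrable_const[of 1]] by (simp add: prob_space)

text \<open>Write \<open>Y n\<close> as Z plus an error that tends to 0 in L2. By Cauchy-Schwarz the
  pairing of the error with any fixed W vanishes in the limit; W = 1 gives the means and W = Z the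
  cross term of the second moments.\<close>

lemma L2_tendsto_moments:
  assumes Y: "\<And>n. square_integrable M (Y n)" and Z: "square_integrable M Z"
    and lim: "(\<lambda>n. expectation (\<lambda>\<omega>. (Y n \<omega> - Z \<omega>)\<^sup>2)) \<longlonglongrightarrow> 0"
  shows "(\<lambda>n. expectation (Y n)) \<longlonglongrightarrow> expectation Z"
    and "(\<lambda>n. expectation (\<lambda>\<omega>. (Y n \<omega>)\<^sup>2)) \<longlonglongrightarrow> expectation (\<lambda>\<omega>. (Z \<omega>)\<^sup>2)"
proof -
  let ?e = "\<lambda>n. expectation (\<lambda>\<omega>. (Y n \<omega> - Z \<omega>)\<^sup>2)"
  have D: "square_integrable M (\<lambda>\<omega>. Y n \<omega> - Z \<omega>)" for n
    by (intro square_integrable_diff Y Z)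
  have cross: "(\<lambda>n. expectation (\<lambda>\<omega>. W \<omega> * (Y n \<omega> - Z \<omega>))) \<longlonglongrightarrow> 0"
    if W: "square_integrable M W" for W
  proof (rule Lim_null_comparison)
    show "\<forall>\<^sub>F n in sequentially. norm (expectation (\<lambda>\<omega>. W \<omega> * (Y n \<omega> - Z \<omega>)))
        \<le> sqrt (expectation (\<lambda>\<omega>. (W \<omega>)\<^sup>2) * ?e n)"
      using expectation_Cauchy_Schwarz[OF W D] real_le_rsqrt
      by (intro always_eventually allI) (auto intro!: real_le_rsqrt)
    show "(\<lambda>n. sqrt (expectation (\<lambda>\<omega>. (W \<omega>)\<^sup>2) * ?e n)) \<longlonglongrightarrow> 0"
      using tendsto_real_sqrt[OF tendsto_mult_right_zero[OF lim]] by simp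
  qed
  have "(\<lambda>n. expectation (\<lambda>\<omega>. 1 * (Y n \<omega> - Z \<omega>)) + expectation Z) \<longlonglongrightarrow> 0 + expectation Z"
    by (intro tendsto_add tendsto_const cross square_integrable_const)
  moreover have "expectation (\<lambda>\<omega>. 1 * (Y n \<omega> - Z \<omega>)) + expectation Z = expectation (Y n)" for n
    using Y Z square_integrable_integrable by (subst mult_1, subst Bochner_Integration.integral_diff) auto
  ultimately show "(\<lambda>n. expectation (Y n)) \<longlonglongrightarrow> expectation Z" by simp
  have "(\<lambda>n. expectation (\<lambda>\<omega>. (Z \<omega>)\<^sup>2) + ?e n + 2 * expectation (\<lambda>\<omega>. Z \<omega> * (Y n \<omega> - Z \<omega>)))
      \<longlonglongrightarrow> expectation (\<lambda>\<omega>. (Z \<omega>)\<^sup>2) + 0 + 2 * 0"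
    by (intro tendsto_add tendsto_const lim tendsto_mult cross Z)
  moreover have "expectation (\<lambda>\<omega>. (Z \<omega>)\<^sup>2) + ?e n + 2 * expectation (\<lambda>\<omega>. Z \<omega> * (Y n \<omega> - Z \<omega>))
      = expectation (\<lambda>\<omega>. (Y n \<omega>)\<^sup>2)" for n
    using expectation_square_sum[OF Z D[of n]] by simp
  ultimately show "(\<lambda>n. expectation (\<lambda>\<omega>. (Y n \<omega>)\<^sup>2)) \<longlonglongrightarrow> expectation (\<lambda>\<omega>. (Z \<omega>)\<^sup>2)"
    by simp
qed

text \<open>Fatou's lemma along an almost surely convergent subsequence.\<close>

lemma L2_Cauchy_AE_subseq_limit:
  assumes Y: "\<And>n. square_integrable M (Y n)" and Z[measurable]: "Z \<in> borel_measurable M"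
    and r: "strict_mono r" and lim: "AE \<omega> in M. (\<lambda>k. Y (r k) \<omega>) \<longlonglongrightarrow> Z \<omega>"
    and Cauchy: "\<And>e. e > 0 \<Longrightarrow> \<exists>N. \<forall>n\<ge>N. \<forall>m\<ge>N. expectation (\<lambda>\<omega>. (Y n \<omega> - Y m \<omega>)\<^sup>2) \<le> e"
  shows "square_integrable M Z" and "(\<lambda>n. expectation (\<lambda>\<omega>. (Y n \<omega> - Z \<omega>)\<^sup>2)) \<longlonglongrightarrow> 0"
proof -
  have [measurable]: "Y n \<in> borel_measurable M" for n using Y by (simp add: square_integrable_def)
  \<comment> \<open>The distance is measured by a nonnegative integral, because \<open>Z\<close> is
    not yet known to be square integrable and the Bochner integral of a non-integrable function is 0
    by default.\<close>
  have bound: "\<exists>N. \<forall>n\<ge>N. (\<integral>\<^sup>+\<omega>. ennreal ((Y n \<omega> - Z \<omega>)\<^sup>2) \<partial>M) \<le> ennreal e" if "e > 0" for e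
  proof -
    obtain N where N: "\<And>n m. n \<ge> N \<Longrightarrow> m \<ge> N \<Longrightarrow> expectation (\<lambda>\<omega>. (Y n \<omega> - Y m \<omega>)\<^sup>2) \<le> e"
      using Cauchy[OF \<open>e > 0\<close>] by blast
    have "(\<integral>\<^sup>+\<omega>. ennreal ((Y n \<omega> - Z \<omega>)\<^sup>2) \<partial>M) \<le> ennreal e" if "n \<ge> N" for n
    proof -
      have "(\<integral>\<^sup>+\<omega>. ennreal ((Y n \<omega> - Z \<omega>)\<^sup>2) \<partial>M)
          = (\<integral>\<^sup>+\<omega>. liminf (\<lambda>k. ennreal ((Y n \<omega> - Y (r k) \<omega>)\<^sup>2)) \<partial>M)"
      proof (rule nn_integral_cong_AE, use lim in eventually_elim)
        case (elim \<omega>)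
        have "(\<lambda>k. ennreal ((Y n \<omega> - Y (r k) \<omega>)\<^sup>2)) \<longlonglongrightarrow> ennreal ((Y n \<omega> - Z \<omega>)\<^sup>2)"
          using elim by (intro tendsto_intros) auto
        then show ?case by (metis lim_imp_Liminf sequentially_bot)
      qed
      also have "\<dots> \<le> liminf (\<lambda>k. \<integral>\<^sup>+\<omega>. ennreal ((Y n \<omega> - Y (r k) \<omega>)\<^sup>2) \<partial>M)"
        by (intro nn_integral_liminf) simp
      also have "\<dots> = liminf (\<lambda>k. ennreal (expectation (\<lambda>\<omega>. (Y n \<omega> - Y (r k) \<omega>)\<^sup>2)))"
        using square_integrable_diff[OF Y Y]
        by (subst nn_integral_eq_integral) (auto simp: square_integrable_def)
      also have "\<dots> \<le> ennreal e"
      proof (rule Liminf_le)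
        show "\<forall>\<^sub>F k in sequentially. ennreal (expectation (\<lambda>\<omega>. (Y n \<omega> - Y (r k) \<omega>)\<^sup>2)) \<le> ennreal e"
          using eventually_ge_at_top[of N]
        proof eventually_elim
          case (elim k)
          have "r k \<ge> N" using seq_suble[OF r, of k] elim by simp
          then show ?case using N[OF \<open>n \<ge> N\<close>] \<open>e > 0\<close> by (intro ennreal_leI) auto
        qed
      qed simp
      finally show ?thesis .
    qed
    then show ?thesis by blast
  qed
  \<comment> \<open>A single finite distance puts \<open>Z\<close> into L2, since \<open>Y N\<close>
    is there.\<close>
  obtain N where "(\<integral>\<^sup>+\<omega>. ennreal ((Y N \<omega> - Z \<omega>)\<^sup>2) \<partial>M) \<le> ennreal 1"
    using bound[of 1] by auto
  then have "(\<integral>\<^sup>+\<omega>. ennreal ((Y N \<omega> - Z \<omega>)\<^sup>2) \<partial>M) < \<infinity>"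
    by (metis ennreal_1 ennreal_one_less_top infinity_ennreal_def le_less_trans)
  then have "square_integrable M (\<lambda>\<omega>. Y N \<omega> - Z \<omega>)"
    by (auto simp: square_integrable_def intro!: integrableI_nonneg)
  from square_integrable_diff[OF Y[of N] this] show sZ: "square_integrable M Z" by simp
  show "(\<lambda>n. expectation (\<lambda>\<omega>. (Y n \<omega> - Z \<omega>)\<^sup>2)) \<longlonglongrightarrow> 0"
  proof (rule LIMSEQ_I)
    fix e :: real assume "e > 0"
    then obtain N where N: "\<And>n. n \<ge> N \<Longrightarrow> (\<integral>\<^sup>+\<omega>. ennreal ((Y n \<omega> - Z \<omega>)\<^sup>2) \<partial>M) \<le> ennreal (e/2)"
      using bound[of "e/2"] by auto
    have "expectation (\<lambda>\<omega>. (Y n \<omega> - Z \<omega>)\<^sup>2) \<le> e/2" if "n \<ge> N" for n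
    proof -
      have "ennreal (expectation (\<lambda>\<omega>. (Y n \<omega> - Z \<omega>)\<^sup>2)) = (\<integral>\<^sup>+\<omega>. ennreal ((Y n \<omega> - Z \<omega>)\<^sup>2) \<partial>M)"
        using square_integrable_diff[OF Y[of n] sZ]
        by (subst nn_integral_eq_integral) (auto simp: square_integrable_def)
      with N[OF that] \<open>e > 0\<close> show ?thesis by (metis ennreal_le_iff half_gt_zero less_imp_le)
    qed
    then show "\<exists>no. \<forall>n\<ge>no. norm (expectation (\<lambda>\<omega>. (Y n \<omega> - Z \<omega>)\<^sup>2) - 0) < e"
      using \<open>e > 0\<close> by (intro exI[of _ N]) fastforce
  qed
qed

end

text \<open>A metric, up to null sets, for convergence in probability. Triangle inequalities for it
  replace the splitting of exceptional events, and it is meaningful for variables without any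
  moments.\<close>

definition prob_dist :: "'a measure \<Rightarrow> ('a \<Rightarrow> real) \<Rightarrow> ('a \<Rightarrow> real) \<Rightarrow> real" where
  "prob_dist M X Y = (\<integral>\<omega>. min 1 \<bar>X \<omega> - Y \<omega>\<bar> \<partial>M)"

context prob_space
begin

lemma prob_dist_nonneg: "0 \<le> prob_dist M X Y"
  by (simp add: prob_dist_def)

lemma prob_dist_commute: "prob_dist M X Y = prob_dist M Y X"
  by (simp add: prob_dist_def abs_minus_commute)

lemma prob_dist_integrable:
  assumes [measurable]: "X \<in> borel_measurable M" "Y \<in> borel_measurable M"
  shows "integrable M (\<lambda>\<omega>. min 1 \<bar>X \<omega> - Y \<omega>\<bar> :: real)"
  by (rule integrable_const_bound[where B=1]) auto

lemma prob_dist_triangle: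
  assumes [measurable]: "X \<in> borel_measurable M" "Y \<in> borel_measurable M" "Z \<in> borel_measurable M"
  shows "prob_dist M X Z \<le> prob_dist M X Y + prob_dist M Y Z"
  unfolding prob_dist_def
  by (subst Bochner_Integration.integral_add[symmetric])
     (auto intro!: integral_mono prob_dist_integrable Bochner_Integration.integrable_add)

lemma prob_dist_cong_AE:
  assumes "X \<in> borel_measurable M" "Y \<in> borel_measurable M"
    "X' \<in> borel_measurable M" "Y' \<in> borel_measurable M"
    "AE \<omega> in M. X \<omega> - Y \<omega> = X' \<omega> - Y' \<omega>"
  shows "prob_dist M X Y = prob_dist M X' Y'"
  unfolding prob_dist_def using assms by (intro integral_cong_AE) auto

lemma prob_dist_diff:
  assumes [measurable]: "X \<in> borel_measurable M" "Y \<in> borel_measurable M"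
    "X' \<in> borel_measurable M" "Y' \<in> borel_measurable M"
  shows "prob_dist M (\<lambda>\<omega>. X \<omega> - X' \<omega>) (\<lambda>\<omega>. Y \<omega> - Y' \<omega>) \<le> prob_dist M X Y + prob_dist M X' Y'"
  unfolding prob_dist_def
  by (subst Bochner_Integration.integral_add[symmetric])
     (auto intro!: integral_mono prob_dist_integrable Bochner_Integration.integrable_add)

text \<open>Through this bound the L2 estimates of the isometry enter statements about convergence
  in probability.\<close>

lemma prob_dist_le_L2:
  assumes X: "square_integrable M (\<lambda>\<omega>. X \<omega> - Y \<omega>)"
  shows "prob_dist M X Y \<le> sqrt (expectation (\<lambda>\<omega>. (X \<omega> - Y \<omega>)\<^sup>2))"
proof -
  have [measurable]: "(\<lambda>\<omega>. X \<omega> - Y \<omega>) \<in> borel_measurable M" using X by (simp add: square_integrable_def)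
  have s: "square_integrable M (\<lambda>\<omega>. min 1 \<bar>X \<omega> - Y \<omega>\<bar>)"
    unfolding square_integrable_def
    by (auto intro!: integrable_const_bound[where B=1] simp: abs_square_le_1 power_le_one)
  have "(prob_dist M X Y)\<^sup>2 \<le> expectation (\<lambda>\<omega>. (min 1 \<bar>X \<omega> - Y \<omega>\<bar>)\<^sup>2)"
    unfolding prob_dist_def by (rule expectation_square_le[OF s])
  also have "\<dots> \<le> expectation (\<lambda>\<omega>. (X \<omega> - Y \<omega>)\<^sup>2)"
  proof (rule integral_mono)
    fix \<omega>
    have "(min 1 \<bar>X \<omega> - Y \<omega>\<bar>)\<^sup>2 \<le> \<bar>X \<omega> - Y \<omega>\<bar>\<^sup>2" by (intro power_mono) auto
    then show "(min 1 \<bar>X \<omega> - Y \<omega>\<bar>)\<^sup>2 \<le> (X \<omega> - Y \<omega>)\<^sup>2" by simp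
  qed (use s X in \<open>auto simp: square_integrable_def\<close>)
  finally show ?thesis by (rule real_le_rsqrt)
qed

text \<open>Measurability is asked only of indices in I, which the filter eventually reaches: a
  one-sided process is known to be measurable only at times \<open>t \<ge> 0\<close>, and its
  stochastic continuity is stated along \<open>at s within {0..}\<close>. In one direction the
  integrand is at most a/2 off an event of small probability; the other is Markov's
  inequality.\<close>

lemma conv_in_prob_iff_prob_dist:
  assumes Y: "\<And>i. i \<in> I \<Longrightarrow> Y i \<in> borel_measurable M" and I: "\<forall>\<^sub>F i in F. i \<in> I"
    and [measurable]: "Z \<in> borel_measurable M"
  shows "conv_in_prob M F Y Z \<longleftrightarrow> ((\<lambda>i. prob_dist M (Y i) Z) \<longlongrightarrow> 0) F"
proof
  assume *: "conv_in_prob M F Y Z"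
  show "((\<lambda>i. prob_dist M (Y i) Z) \<longlongrightarrow> 0) F"
  proof (rule order_tendstoI)
    fix a :: real assume "a > 0"
    have "((\<lambda>i. prob {\<omega> \<in> space M. \<bar>Y i \<omega> - Z \<omega>\<bar> > a/2}) \<longlongrightarrow> 0) F"
      using * half_gt_zero[OF \<open>a > 0\<close>] unfolding conv_in_prob_def by blast
    then have "\<forall>\<^sub>F i in F. prob {\<omega> \<in> space M. \<bar>Y i \<omega> - Z \<omega>\<bar> > a/2} < a/2"
      using \<open>a > 0\<close> by (intro order_tendstoD) auto
    then show "\<forall>\<^sub>F i in F. prob_dist M (Y i) Z < a"
      using I
    proof eventually_elim
      case (elim i)
      note [measurable] = Y[OF elim(2)]
      let ?S = "{\<omega> \<in> space M. \<bar>Y i \<omega> - Z \<omega>\<bar> > a/2}"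
      have int: "integrable M (indicator ?S :: _ \<Rightarrow> real)"
        by (intro integrable_real_indicator) (auto simp: emeasure_eq_measure)
      have "prob_dist M (Y i) Z \<le> expectation (\<lambda>\<omega>. a/2 + indicator ?S \<omega>)"
        unfolding prob_dist_def
      proof (intro integral_mono prob_dist_integrable Bochner_Integration.integrable_add int)
        fix \<omega> assume "\<omega> \<in> space M"
        then show "min 1 \<bar>Y i \<omega> - Z \<omega>\<bar> \<le> a/2 + indicator ?S \<omega>"
          using \<open>a > 0\<close> by (cases "\<omega> \<in> ?S") (auto simp: min_def)
      qed auto
      also have "\<dots> = a/2 + prob ?S"
        using int by (subst Bochner_Integration.integral_add) (auto simp: prob_space)
      finally show ?case using elim(1) by simp
    qed
  qed (use less_le_trans[OF _ prob_dist_nonneg] in auto)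
next
  assume *: "((\<lambda>i. prob_dist M (Y i) Z) \<longlongrightarrow> 0) F"
  show "conv_in_prob M F Y Z"
    unfolding conv_in_prob_def
  proof (intro allI impI)
    fix e :: real assume "e > 0"
    \<comment> \<open>On the event that the difference exceeds e, the truncated difference is at
      least this value.\<close>
    define c where "c = min 1 e"
    have "c > 0" using \<open>e > 0\<close> by (simp add: c_def)
    show "((\<lambda>i. prob {\<omega> \<in> space M. \<bar>Y i \<omega> - Z \<omega>\<bar> > e}) \<longlongrightarrow> 0) F"
    proof (rule Lim_null_comparison)
      show "((\<lambda>i. prob_dist M (Y i) Z / c) \<longlongrightarrow> 0) F"
        using tendsto_divide[OF * tendsto_const[of c]] \<open>c > 0\<close> by simp
      show "\<forall>\<^sub>F i in F. norm (prob {\<omega> \<in> space M. \<bar>Y i \<omega> - Z \<omega>\<bar> > e}) \<le> prob_dist M (Y i) Z / c"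
        using I
      proof eventually_elim
        case (elim i)
        note [measurable] = Y[OF elim]
        let ?S = "{\<omega> \<in> space M. \<bar>Y i \<omega> - Z \<omega>\<bar> > e}"
        have int: "integrable M (\<lambda>\<omega>. indicator ?S \<omega> * c)"
          by (intro integrable_mult_left integrable_real_indicator) (auto simp: emeasure_eq_measure)
        have "prob ?S * c = expectation (\<lambda>\<omega>. indicator ?S \<omega> * c)" by simp
        also have "\<dots> \<le> prob_dist M (Y i) Z"
          unfolding prob_dist_def
        proof (intro integral_mono prob_dist_integrable int)
          fix \<omega> assume "\<omega> \<in> space M"
          then show "indicator ?S \<omega> * c \<le> min 1 \<bar>Y i \<omega> - Z \<omega>\<bar>"
            by (cases "\<omega> \<in> ?S") (auto simp: c_def)
        qed auto
        finally show ?case using \<open>c > 0\<close> by (simp add: field_simps)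
      qed
    qed
  qed
qed

text \<open>\<open>prob_dist\<close> tending to 0 is L1 convergence of the truncated differences,
  which yields an almost surely convergent subsequence; along it the truncation at 1 is eventually
  inactive.\<close>

lemma conv_in_prob_AE_subseq:
  assumes Y[measurable]: "\<And>n. Y n \<in> borel_measurable M" and [measurable]: "Z \<in> borel_measurable M"
    and lim: "(\<lambda>n. prob_dist M (Y n) Z) \<longlonglongrightarrow> 0"
  obtains r where "strict_mono r" "AE \<omega> in M. (\<lambda>k. Y (r k) \<omega>) \<longlonglongrightarrow> Z \<omega>"
proof -
  have "\<exists>r::nat\<Rightarrow>nat. strict_mono r \<and> (AE \<omega> in M. (\<lambda>k. min 1 \<bar>Y (r k) \<omega> - Z \<omega>\<bar>) \<longlonglongrightarrow> 0)"
    using lim unfolding prob_dist_def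
    by (intro tendsto_L1_AE_subseq prob_dist_integrable) (auto simp: abs_of_nonneg)
  then obtain r :: "nat \<Rightarrow> nat" where r: "strict_mono r" "AE \<omega> in M. (\<lambda>k. min 1 \<bar>Y (r k) \<omega> - Z \<omega>\<bar>) \<longlonglongrightarrow> 0"
    by blast
  have "AE \<omega> in M. (\<lambda>k. Y (r k) \<omega>) \<longlonglongrightarrow> Z \<omega>"
    using r(2)
  proof eventually_elim
    case (elim \<omega>)
    have "\<forall>\<^sub>F k in sequentially. min 1 \<bar>Y (r k) \<omega> - Z \<omega>\<bar> < 1"
      using elim by (rule order_tendstoD) simp
    then have "\<forall>\<^sub>F k in sequentially. min 1 \<bar>Y (r k) \<omega> - Z \<omega>\<bar> = \<bar>Y (r k) \<omega> - Z \<omega>\<bar>"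
      by eventually_elim auto
    from tendsto_cong[OF this] elim show ?case
      by (simp add: LIM_zero_iff tendsto_rabs_zero_iff)
  qed
  with r(1) show thesis using that by blast
qed

lemma L2_Cauchy_prob_limit:
  assumes Y: "\<And>n. square_integrable M (Y n)" and Z[measurable]: "Z \<in> borel_measurable M"
    and lim: "(\<lambda>n. prob_dist M (Y n) Z) \<longlonglongrightarrow> 0"
    and Cauchy: "\<And>e. e > 0 \<Longrightarrow> \<exists>N. \<forall>n\<ge>N. \<forall>m\<ge>N. expectation (\<lambda>\<omega>. (Y n \<omega> - Y m \<omega>)\<^sup>2) \<le> e"
  shows "square_integrable M Z" and "(\<lambda>n. expectation (\<lambda>\<omega>. (Y n \<omega> - Z \<omega>)\<^sup>2)) \<longlonglongrightarrow> 0"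
proof -
  have "Y n \<in> borel_measurable M" for n using Y by (simp add: square_integrable_def)
  then obtain r where "strict_mono r" "AE \<omega> in M. (\<lambda>k. Y (r k) \<omega>) \<longlonglongrightarrow> Z \<omega>"
    using conv_in_prob_AE_subseq[OF _ Z lim] by blast
  from L2_Cauchy_AE_subseq_limit[OF Y Z this Cauchy]
  show "square_integrable M Z" and "(\<lambda>n. expectation (\<lambda>\<omega>. (Y n \<omega> - Z \<omega>)\<^sup>2)) \<longlonglongrightarrow> 0"
    by auto
qed

end

section \<open>Moments of Levy processes\<close>

context prob_space
begin

lemma distr_eq_moments:
  assumes [measurable]: "X \<in> borel_measurable M" "Y \<in> borel_measurable M"
    and eq: "distr M borel X = distr M borel Y"
  shows "square_integrable M X \<longleftrightarrow> square_integrable M Y"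
    and "expectation X = (expectation Y :: real)"
    and "variance X = variance Y"
proof -
  have "integrable M (\<lambda>\<omega>. (X \<omega>)\<^sup>2) \<longleftrightarrow> integrable (distr M borel X) (\<lambda>x. x\<^sup>2)"
    by (subst integrable_distr_eq) auto
  also have "\<dots> \<longleftrightarrow> integrable M (\<lambda>\<omega>. (Y \<omega>)\<^sup>2)"
    unfolding eq by (subst integrable_distr_eq) auto
  finally show "square_integrable M X \<longleftrightarrow> square_integrable M Y" by (simp add: square_integrable_def)
  have "expectation X = integral\<^sup>L (distr M borel X) (\<lambda>x. x)" by (subst integral_distr) auto
  also have "\<dots> = expectation Y" unfolding eq by (subst integral_distr) auto
  finally show E: "expectation X = expectation Y" .
  have "variance X = integral\<^sup>L (distr M borel X) (\<lambda>x. (x - expectation X)\<^sup>2)"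
    by (subst integral_distr) auto
  also have "\<dots> = variance Y" unfolding eq E by (subst integral_distr) auto
  finally show "variance X = variance Y" .
qed

lemma variance_square_integrable:
  "square_integrable M X \<Longrightarrow> variance X = expectation (\<lambda>\<omega>. (X \<omega>)\<^sup>2) - (expectation X)\<^sup>2"
  by (rule variance_eq) (auto simp: square_integrable_integrable, simp add: square_integrable_def)

lemma moments_cong_AE:
  assumes "X \<in> borel_measurable M" "Y \<in> borel_measurable M" "AE \<omega> in M. X \<omega> = Y \<omega>"
  shows "square_integrable M X \<longleftrightarrow> square_integrable M Y"
    and "expectation X = (expectation Y :: real)"
    and "variance X = variance Y"
proof -
  have "distr M borel X = distr M borel Y" using assms by (intro distr_cong_AE) auto
  from distr_eq_moments[OF assms(1,2) this]
  show "square_integrable M X \<longleftrightarrow> square_integrable M Y" "expectation X = (expectation Y :: real)"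
    "variance X = variance Y" .
qed

lemma indep_var_nn_integral:
  fixes X Y :: "'a \<Rightarrow> ennreal"
  assumes "indep_var borel X borel Y"
  shows "(\<integral>\<^sup>+\<omega>. X \<omega> * Y \<omega> \<partial>M) = (\<integral>\<^sup>+\<omega>. X \<omega> \<partial>M) * (\<integral>\<^sup>+\<omega>. Y \<omega> \<partial>M)"
proof -
  have "(\<lambda>_. borel :: ennreal measure) = case_bool borel borel" by (rule ext) (simp split: bool.split)
  with assms have "indep_vars (\<lambda>_. borel) (case_bool X Y) UNIV" by (simp add: indep_var_def)
  from indep_vars_nn_integral[OF finite this] show ?thesis by (simp add: UNIV_bool mult.commute)
qed

text \<open>On the event \<open>\<bar>Y\<bar> \<le> K\<close>, which is independent of \<open>X\<close>, one has
  \<open>X\<^sup>2 \<le> 2 (X + Y)\<^sup>2 + 2 K\<^sup>2\<close>.\<close>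

lemma indep_sum_square_integrable:
  fixes X Y :: "'a \<Rightarrow> real"
  assumes indep: "indep_var borel X borel Y" and sum: "square_integrable M (\<lambda>\<omega>. X \<omega> + Y \<omega>)"
  shows "square_integrable M X"
proof -
  have [measurable]: "X \<in> borel_measurable M" "Y \<in> borel_measurable M"
    using indep_var_rv1[OF indep] indep_var_rv2[OF indep] by auto
  \<comment> \<open>\<open>Y\<close> is finite everywhere, so these events exhaust the space and
    cannot all be null.\<close>
  have "\<exists>K::nat. emeasure M {\<omega>\<in>space M. \<bar>Y \<omega>\<bar> \<le> real K} \<noteq> 0"
  proof (rule ccontr)
    assume "\<not> ?thesis"
    then have "(\<Union>K::nat. {\<omega>\<in>space M. \<bar>Y \<omega>\<bar> \<le> real K}) \<in> null_sets M"
      by (intro null_sets_UN) (auto simp: null_sets_def)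
    moreover have "(\<Union>K::nat. {\<omega>\<in>space M. \<bar>Y \<omega>\<bar> \<le> real K}) = space M"
      using real_arch_simple by blast
    ultimately show False using emeasure_space_1 by (simp add: null_sets_def)
  qed
  then obtain K :: nat where K: "emeasure M {\<omega>\<in>space M. \<bar>Y \<omega>\<bar> \<le> real K} \<noteq> 0" by blast
  define K' where "K' = real K"
  have "indep_var borel ((\<lambda>x. ennreal (x\<^sup>2)) \<circ> X) borel ((\<lambda>y. indicator {-K'..K'} y :: ennreal) \<circ> Y)"
    by (rule indep_var_compose[OF indep]) auto
  from indep_var_nn_integral[OF this]
  have "(\<integral>\<^sup>+\<omega>. ennreal ((X \<omega>)\<^sup>2) \<partial>M) * (\<integral>\<^sup>+\<omega>. indicator {-K'..K'} (Y \<omega>) \<partial>M)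
      = (\<integral>\<^sup>+\<omega>. ennreal ((X \<omega>)\<^sup>2) * indicator {-K'..K'} (Y \<omega>) \<partial>M)"
    by simp
  also have "\<dots> \<le> (\<integral>\<^sup>+\<omega>. ennreal (2 * (X \<omega> + Y \<omega>)\<^sup>2 + 2 * K'\<^sup>2) \<partial>M)"
  proof (intro nn_integral_mono)
    fix \<omega>
    show "ennreal ((X \<omega>)\<^sup>2) * indicator {-K'..K'} (Y \<omega>) \<le> ennreal (2 * (X \<omega> + Y \<omega>)\<^sup>2 + 2 * K'\<^sup>2)"
    proof (cases "Y \<omega> \<in> {-K'..K'}")
      case True
      \<comment> \<open>The right side minus the left side is the square of X + 2 Y.\<close>
      have "(X \<omega>)\<^sup>2 \<le> 2 * (X \<omega> + Y \<omega>)\<^sup>2 + 2 * (Y \<omega>)\<^sup>2"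
        using zero_le_power2[of "X \<omega> + 2 * Y \<omega>"] by (simp add: power2_eq_square algebra_simps)
      also have "(Y \<omega>)\<^sup>2 \<le> K'\<^sup>2" using True by (intro abs_le_square_iff[THEN iffD1]) auto
      finally show ?thesis using True by (simp add: ennreal_leI del: ennreal_plus)
    qed auto
  qed
  also have "\<dots> < \<infinity>"
  proof -
    have "integrable M (\<lambda>\<omega>. 2 * (X \<omega> + Y \<omega>)\<^sup>2 + 2 * K'\<^sup>2)"
      using sum by (auto simp: square_integrable_def)
    then show ?thesis by (subst nn_integral_eq_integral) auto
  qed
  finally have fin: "(\<integral>\<^sup>+\<omega>. ennreal ((X \<omega>)\<^sup>2) \<partial>M) * (\<integral>\<^sup>+\<omega>. indicator {-K'..K'} (Y \<omega>) \<partial>M) < \<infinity>" .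
  have "(\<integral>\<^sup>+\<omega>. indicator {-K'..K'} (Y \<omega>) \<partial>M) = (\<integral>\<^sup>+\<omega>. indicator {\<omega>\<in>space M. \<bar>Y \<omega>\<bar> \<le> K'} \<omega> \<partial>M)"
    by (intro nn_integral_cong) (auto simp: indicator_def abs_le_iff)
  also have "\<dots> \<noteq> 0" using K unfolding K'_def by (subst nn_integral_indicator) auto
  finally have "(\<integral>\<^sup>+\<omega>. ennreal ((X \<omega>)\<^sup>2) \<partial>M) < \<infinity>"
    using fin by (auto simp: ennreal_mult_less_top)
  then show ?thesis by (auto simp: square_integrable_def intro!: integrableI_nonneg)
qed

lemma variance_add_indep:
  assumes indep: "indep_var borel X borel Y"
    and X: "square_integrable M X" and Y: "square_integrable M Y"
  shows "variance (\<lambda>\<omega>. X \<omega> + Y \<omega>) = variance X + (variance Y :: real)"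
proof -
  have "expectation (\<lambda>\<omega>. X \<omega> * Y \<omega>) = expectation X * expectation Y"
    using X Y by (intro indep_var_lebesgue_integral indep square_integrable_integrable)
  moreover have "expectation (\<lambda>\<omega>. X \<omega> + Y \<omega>) = expectation X + expectation Y"
    using X Y by (intro Bochner_Integration.integral_add square_integrable_integrable)
  ultimately show ?thesis
    unfolding variance_square_integrable[OF X] variance_square_integrable[OF Y]
      variance_square_integrable[OF square_integrable_add[OF X Y]]
    by (subst expectation_square_sum[OF X Y]) (simp add: power2_sum)
qed

end

text \<open>Cauchy's functional equation on the half-line. Subtracting the linear function that
  agrees with f at \<delta> leaves an additive g with period \<delta>. Such a g inherits boundedness
  from one period, and a bounded additive function vanishes because g (n x) = n g x.\<close>

lemma additive_bounded_imp_linear: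
  fixes f :: "real \<Rightarrow> real"
  assumes add: "\<And>s h. 0 \<le> s \<Longrightarrow> 0 \<le> h \<Longrightarrow> f (s + h) = f s + f h"
    and "\<delta> > 0" and bound: "\<And>t. 0 \<le> t \<Longrightarrow> t \<le> \<delta> \<Longrightarrow> \<bar>f t\<bar> \<le> B" and "t \<ge> 0"
  shows "f t = t * f 1"
proof -
  define c where "c = f \<delta> / \<delta>"
  define g where "g x = f x - c * x" for x
  have g_add: "g (s + h) = g s + g h" if "0 \<le> s" "0 \<le> h" for s h
    using add[OF that] by (simp add: g_def algebra_simps)
  have g_mult: "g (real n * x) = real n * g x" if "0 \<le> x" for n x
  proof (induction n)
    case 0
    show ?case using g_add[of 0 0] by simp
  next
    case (Suc n)
    then show ?case using g_add[of x "real n * x"] that by (simp add: algebra_simps)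
  qed
  have "g \<delta> = 0" using \<open>\<delta> > 0\<close> by (simp add: g_def c_def)
  have g_bound: "\<bar>g x\<bar> \<le> B + \<bar>c\<bar> * \<delta>" if "0 \<le> x" for x
  proof -
    define n where "n = nat \<lfloor>x / \<delta>\<rfloor>"
    define y where "y = x - real n * \<delta>"
    have "real n \<le> x / \<delta>" "x / \<delta> \<le> real n + 1"
      using that \<open>\<delta> > 0\<close> by (auto simp: n_def)
    then have y: "0 \<le> y" "y \<le> \<delta>" using \<open>\<delta> > 0\<close> by (auto simp: y_def field_simps)
    have "g x = g (real n * \<delta> + y)" by (simp add: y_def)
    also have "\<dots> = g y" using g_add[of "real n * \<delta>" y] g_mult[of \<delta> n] y \<open>g \<delta> = 0\<close> \<open>\<delta> > 0\<close> by simp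
    also have "\<bar>g y\<bar> \<le> \<bar>f y\<bar> + \<bar>c\<bar> * y" using y by (simp add: g_def abs_mult order_trans[OF abs_triangle_ineq4])
    also have "\<dots> \<le> B + \<bar>c\<bar> * \<delta>" using y bound[of y] by (intro add_mono mult_left_mono) auto
    finally show ?thesis .
  qed
  have g0: "g x = 0" if "0 \<le> x" for x
  proof (rule ccontr)
    assume "g x \<noteq> 0"
    then obtain n :: nat where "B + \<bar>c\<bar> * \<delta> < real n * \<bar>g x\<bar>"
      using reals_Archimedean3[of "\<bar>g x\<bar>"] by auto
    also have "\<dots> = \<bar>g (real n * x)\<bar>" using g_mult[OF that] by (simp add: abs_mult)
    also have "\<dots> \<le> B + \<bar>c\<bar> * \<delta>" using that by (intro g_bound) simp
    finally show False by simp
  qed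
  from g0[of 1] g0[OF \<open>t \<ge> 0\<close>] show ?thesis by (simp add: g_def)
qed

section \<open>One-sided Levy processes: increments, left limits and moments\<close>

context prob_space
begin

lemma levy_process_measurable:
  "levy_process M L \<Longrightarrow> 0 \<le> t \<Longrightarrow> L t \<in> borel_measurable M"
  by (simp add: levy_process_def)

lemma levy_process_increment_distr:
  "levy_process M L \<Longrightarrow> 0 \<le> s \<Longrightarrow> 0 \<le> h \<Longrightarrow>
    distr M borel (\<lambda>\<omega>. L (s + h) \<omega> - L s \<omega>) = distr M borel (L h)"
  by (simp add: levy_process_def)

lemma levy_process_increments_indep:
  assumes "levy_process M L" "0 \<le> s" "0 \<le> h"
  shows "indep_var borel (\<lambda>\<omega>. L s \<omega> - L 0 \<omega>) borel (\<lambda>\<omega>. L (s + h) \<omega> - L s \<omega>)"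
proof -
  \<comment> \<open>A monotone time grid through 0, s and s + h, constant afterwards; only its first
    two increments are used.\<close>
  define t :: "nat \<Rightarrow> real" where "t i = (if i = 0 then 0 else if i = 1 then s else s + h)" for i
  have "0 \<le> t 0" "mono t" using assms by (auto simp: t_def mono_def)
  with assms(1) have "indep_vars (\<lambda>_. borel) (\<lambda>i \<omega>. L (t (Suc i)) \<omega> - L (t i) \<omega>) {..<2}"
    unfolding levy_process_def by blast
  also have "{..<2} = insert 0 {1::nat}" by auto
  finally show ?thesis using indep_vars_sum[of "{1::nat}" 0] by (force simp: t_def)
qed

lemma levy_process_prob_dist_tendsto:
  assumes L: "levy_process M L" and "s \<ge> 0"
  shows "((\<lambda>t. prob_dist M (L t) (L s)) \<longlongrightarrow> 0) (at s within {0..})"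
proof -
  have "conv_in_prob M (at s within {0..}) L (L s)" using assms by (simp add: levy_process_def)
  then show ?thesis
    using assms by (subst (asm) conv_in_prob_iff_prob_dist[where I = "{0..}"])
      (auto simp: levy_process_measurable eventually_at_filter)
qed

text \<open>There are no fixed discontinuities: stochastic continuity provides times increasing to t
  along which the values converge almost surely to \<open>L t\<close>, and the left limit of a
  cadlag path must agree with that limit. The negative half of the two-sided process, defined by
  left limits, is thereby reduced to the values of the second copy.\<close>

lemma levy_process_left_limit:
  assumes L: "levy_process M L" and "t > 0"
  shows "AE \<omega> in M. Lim (at_left t) (\<lambda>s. L s \<omega>) = L t \<omega>"
proof -
  define s :: "nat \<Rightarrow> real" where "s n = t - t / real (Suc n)" for n
  have s: "0 \<le> s n" "s n < t" for n using \<open>t > 0\<close> by (auto simp: s_def field_simps)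
  have "(\<lambda>n. t - t * inverse (real (Suc n))) \<longlonglongrightarrow> t - t * 0"
    by (intro tendsto_intros LIMSEQ_inverse_real_of_nat)
  then have s_lim: "s \<longlonglongrightarrow> t" by (simp add: s_def[abs_def] divide_inverse)
  have "filterlim s (at t within {0..}) sequentially"
    using s s_lim by (auto simp: filterlim_at less_imp_neq)
  from filterlim_compose[OF levy_process_prob_dist_tendsto[OF L] this] \<open>t > 0\<close>
  have "(\<lambda>n. prob_dist M (L (s n)) (L t)) \<longlonglongrightarrow> 0" by simp
  then obtain r where r: "strict_mono r" "AE \<omega> in M. (\<lambda>k. L (s (r k)) \<omega>) \<longlonglongrightarrow> L t \<omega>"
    using conv_in_prob_AE_subseq[of "\<lambda>n. L (s n)" "L t"]
      levy_process_measurable[OF L s(1)] levy_process_measurable[OF L less_imp_le[OF \<open>t > 0\<close>]]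
    by blast
  have "AE \<omega> in M. cadlag (\<lambda>t. L t \<omega>)" using L by (simp add: levy_process_def)
  with r(2) show ?thesis
  proof eventually_elim
    case (elim \<omega>)
    then obtain l where l: "((\<lambda>s. L s \<omega>) \<longlongrightarrow> l) (at_left t)" using \<open>t > 0\<close> by (auto simp: cadlag_def)
    have "(\<lambda>k. s (r k)) \<longlonglongrightarrow> t" using LIMSEQ_subseq_LIMSEQ[OF s_lim r(1)] by (simp add: o_def)
    then have "filterlim (\<lambda>k. s (r k)) (at_left t) sequentially"
      using s by (auto simp: filterlim_at less_imp_neq)
    from filterlim_compose[OF l this] have "(\<lambda>k. L (s (r k)) \<omega>) \<longlonglongrightarrow> l" .
    with elim(1) have "l = L t \<omega>" using LIMSEQ_unique by blast
    with l show ?case by (auto intro!: tendsto_Lim)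
  qed
qed

text \<open>The assumption concerns time 1 only. For s \<le> 1 the increment over [0, 1] is a sum of
  independent increments over [0, s] and [s, 1], and square integrability of such a sum descends to
  its summands. Later times are reached by adding unit increments.\<close>

lemma levy_process_square_integrable:
  assumes L: "levy_process M L" and L1: "square_integrable M (L 1)" and "t \<ge> 0"
  shows "square_integrable M (L t)"
proof -
  note [measurable] = levy_process_measurable[OF L]
  have incr: "square_integrable M (\<lambda>\<omega>. L (s + h) \<omega> - L s \<omega>) \<longleftrightarrow> square_integrable M (L h)"
    if "0 \<le> s" "0 \<le> h" for s h
    using that by (intro distr_eq_moments levy_process_increment_distr[OF L]) auto
  have small: "square_integrable M (L s)" if "0 \<le> s" "s \<le> 1" for s
  proof -
    have "square_integrable M (\<lambda>\<omega>. (L s \<omega> - L 0 \<omega>) + (L (s + (1 - s)) \<omega> - L s \<omega>))"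
      using incr[of 0 1] L1 by simp
    moreover have "indep_var borel (\<lambda>\<omega>. L s \<omega> - L 0 \<omega>) borel (\<lambda>\<omega>. L (s + (1 - s)) \<omega> - L s \<omega>)"
      using that by (intro levy_process_increments_indep L) auto
    ultimately have "square_integrable M (\<lambda>\<omega>. L s \<omega> - L 0 \<omega>)"
      using indep_sum_square_integrable by blast
    with incr[of 0 s] that show ?thesis by simp
  qed
  have "\<forall>s. 0 \<le> s \<and> s \<le> real n \<longrightarrow> square_integrable M (L s)" for n
  proof (induction n)
    case 0
    then show ?case using small by auto
  next
    case (Suc n)
    show ?case
    proof (intro allI impI, elim conjE)
      fix s :: real assume s: "0 \<le> s" "s \<le> real (Suc n)"
      show "square_integrable M (L s)"
      proof (cases "s \<le> 1")
        case False
        then have "square_integrable M (L (s - 1))" using Suc s by auto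
        from square_integrable_add[OF _ this, of "\<lambda>\<omega>. L (s - 1 + 1) \<omega> - L (s - 1) \<omega>"]
        show ?thesis using incr[of "s - 1" 1] L1 False by simp
      qed (use small s in auto)
    qed
  qed
  moreover obtain n :: nat where "t \<le> real n" using real_arch_simple by blast
  ultimately show ?thesis using \<open>t \<ge> 0\<close> by blast
qed

lemma levy_process_moments_additive:
  assumes L: "levy_process M L" and L1: "square_integrable M (L 1)" and sh: "0 \<le> s" "0 \<le> h"
  shows "expectation (L (s + h)) = expectation (L s) + (expectation (L h) :: real)"
    and "variance (L (s + h)) = variance (L s) + variance (L h)"
proof -
  note [measurable] = levy_process_measurable[OF L]
  note incr = distr_eq_moments[OF _ _ levy_process_increment_distr[OF L]]
  have sq: "square_integrable M (L t)" if "t \<ge> 0" for t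
    by (rule levy_process_square_integrable[OF L L1 that])
  have sq': "square_integrable M (\<lambda>\<omega>. L s \<omega> - L 0 \<omega>)"
    "square_integrable M (\<lambda>\<omega>. L (s + h) \<omega> - L s \<omega>)"
    using sh by (auto intro!: square_integrable_diff sq)
  have L0: "AE \<omega> in M. L 0 \<omega> = 0" using L by (simp add: levy_process_def)
  \<comment> \<open>\<open>L 0\<close> vanishes only almost surely, so it is kept inside the first
    increment.\<close>
  have AE: "AE \<omega> in M. L (s + h) \<omega> = (L s \<omega> - L 0 \<omega>) + (L (s + h) \<omega> - L s \<omega>)"
    using L0 by eventually_elim simp
  have "expectation (L (s + h)) = expectation (\<lambda>\<omega>. (L s \<omega> - L 0 \<omega>) + (L (s + h) \<omega> - L s \<omega>))"
    using sh by (intro moments_cong_AE(2)[OF _ _ AE]) auto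
  also have "\<dots> = expectation (\<lambda>\<omega>. L s \<omega> - L 0 \<omega>) + expectation (\<lambda>\<omega>. L (s + h) \<omega> - L s \<omega>)"
    using sq' by (intro Bochner_Integration.integral_add square_integrable_integrable)
  finally show "expectation (L (s + h)) = expectation (L s) + expectation (L h)"
    using incr(2)[of 0 s] incr(2)[of s h] sh by simp
  have "variance (L (s + h)) = variance (\<lambda>\<omega>. (L s \<omega> - L 0 \<omega>) + (L (s + h) \<omega> - L s \<omega>))"
    using sh by (intro moments_cong_AE(3)[OF _ _ AE]) auto
  also have "\<dots> = variance (\<lambda>\<omega>. L s \<omega> - L 0 \<omega>) + variance (\<lambda>\<omega>. L (s + h) \<omega> - L s \<omega>)"
    using sq' by (intro variance_add_indep levy_process_increments_indep L sh)
  finally show "variance (L (s + h)) = variance (L s) + variance (L h)"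
    using incr(3)[of 0 s] incr(3)[of s h] sh by simp
qed

text \<open>Variances are additive in time and nonnegative, hence bounded on [0, 1] by their value
  at 1, which is the regularity that Cauchy's equation requires.\<close>

lemma levy_process_variance:
  assumes L: "levy_process M L" and L1: "square_integrable M (L 1)" and "t \<ge> 0"
  shows "variance (L t) = t * variance (L 1)"
proof (rule additive_bounded_imp_linear[where \<delta> = 1 and B = "variance (L 1)"])
  fix s :: real assume s: "0 \<le> s" "s \<le> 1"
  have "0 \<le> variance (L s)" "0 \<le> variance (L (1 - s))" by (auto intro: integral_nonneg)
  with levy_process_moments_additive(2)[OF L L1, of s "1 - s"] s
  show "\<bar>variance (L s)\<bar> \<le> variance (L 1)" by simp
qed (use levy_process_moments_additive(2)[OF L L1] assms in auto)

text \<open>By stochastic continuity and Chebyshev's inequality the mean is bounded near \<open>0\<close>.\<close>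

lemma levy_process_expectation:
  assumes L: "levy_process M L" and L1: "square_integrable M (L 1)" and "t \<ge> 0"
  shows "expectation (L t) = t * (expectation (L 1) :: real)"
proof -
  define V where "V = variance (L 1)"
  \<comment> \<open>If the mean of \<open>L s\<close> exceeds K in absolute value, then either
    \<open>L s\<close> is more than 1 away from \<open>L 0\<close>, or it is at least 1 + 2 V away
    from its mean. The first event has probability below 1/2, the second at most V / (1 + 2 V)^2
    \<le> 1/2, and together they would have to cover the space.\<close>
  define K where "K = 2 + 2 * V"
  have "V \<ge> 0" by (auto simp: V_def intro: integral_nonneg)
  have "conv_in_prob M (at 0 within {0..}) L (L 0)" using L by (simp add: levy_process_def)
  then have "((\<lambda>t. prob {\<omega>\<in>space M. \<bar>L t \<omega> - L 0 \<omega>\<bar> > 1}) \<longlongrightarrow> 0) (at 0 within {0..})"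
    by (simp add: conv_in_prob_def)
  then have "\<forall>\<^sub>F t in at 0 within {0..}. prob {\<omega>\<in>space M. \<bar>L t \<omega> - L 0 \<omega>\<bar> > 1} < 1/2"
    by (rule order_tendstoD) simp
  then obtain d where d: "d > 0"
    "\<And>t. 0 < t \<Longrightarrow> t < d \<Longrightarrow> prob {\<omega>\<in>space M. \<bar>L t \<omega> - L 0 \<omega>\<bar> > 1} < 1/2"
    unfolding eventually_at by (auto simp: dist_real_def)
  have L0: "AE \<omega> in M. L 0 \<omega> = 0" using L by (simp add: levy_process_def)
  have bound: "\<bar>expectation (L s)\<bar> \<le> K" if s: "0 < s" "s < d" "s \<le> 1" for s
  proof (rule ccontr)
    assume "\<not> ?thesis"
    then have K: "\<bar>expectation (L s)\<bar> > K" by simp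
    have [measurable]: "L s \<in> borel_measurable M" "L 0 \<in> borel_measurable M"
      using s levy_process_measurable[OF L] by auto
    have sq: "square_integrable M (L s)" using s by (simp add: levy_process_square_integrable[OF L L1])
    have "1 = prob (space M)" by (simp add: prob_space)
    also have "\<dots> \<le> prob ({\<omega>\<in>space M. \<bar>L s \<omega> - L 0 \<omega>\<bar> > 1}
        \<union> {\<omega>\<in>space M. \<bar>L s \<omega> - expectation (L s)\<bar> \<ge> 1 + 2 * V})"
    proof (rule finite_measure_mono_AE, use L0 in eventually_elim)
      case (elim \<omega>)
      then show ?case using K by (auto simp: K_def)
    qed auto
    also have "\<dots> \<le> prob {\<omega>\<in>space M. \<bar>L s \<omega> - L 0 \<omega>\<bar> > 1}
        + prob {\<omega>\<in>space M. \<bar>L s \<omega> - expectation (L s)\<bar> \<ge> 1 + 2 * V}"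
      by (intro measure_Un_le) auto
    also have "prob {\<omega>\<in>space M. \<bar>L s \<omega> - expectation (L s)\<bar> \<ge> 1 + 2 * V}
        \<le> variance (L s) / (1 + 2 * V)\<^sup>2"
      using sq \<open>V \<ge> 0\<close> by (intro Chebyshev_inequality) (auto simp: square_integrable_def)
    also have "variance (L s) \<le> V"
      using levy_process_variance[OF L L1, of s] s \<open>V \<ge> 0\<close> mult_right_mono[of s 1 V] by (simp add: V_def)
    also have "V / (1 + 2 * V)\<^sup>2 \<le> 1/2"
      using \<open>V \<ge> 0\<close> by (simp add: divide_le_eq power2_eq_square algebra_simps)
    also have "prob {\<omega>\<in>space M. \<bar>L s \<omega> - L 0 \<omega>\<bar> > 1} < 1/2" using d(2) s by simp
    finally show False using \<open>V \<ge> 0\<close> by (simp add: divide_right_mono)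
  qed
  \<comment> \<open>The filter \<open>at 0 within {0..}\<close> says nothing about time 0 itself,
    which is treated separately.\<close>
  have "expectation (L 0) = expectation (\<lambda>_. 0 :: real)"
    using L0 levy_process_measurable[OF L, of 0] by (intro integral_cong_AE) auto
  then have E0: "expectation (L 0) = 0" by simp
  have "\<bar>expectation (L s)\<bar> \<le> K" if "0 \<le> s" "s \<le> min 1 (d/2)" for s
  proof (cases "s = 0")
    case True
    then show ?thesis using E0 \<open>V \<ge> 0\<close> by (simp add: K_def)
  qed (use bound[of s] that \<open>d > 0\<close> in auto)
  then show ?thesis
    using levy_process_moments_additive(1)[OF L L1] d(1) \<open>t \<ge> 0\<close>
    by (intro additive_bounded_imp_linear[where \<delta> = "min 1 (d/2)" and B = K]) auto
qed

lemma levy_process_increment_moments: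
  assumes L: "levy_process M L" and L1: "square_integrable M (L 1)" and ab: "0 \<le> a" "a \<le> b"
    and Y: "Y \<in> borel_measurable M" "AE \<omega> in M. Y \<omega> = L b \<omega> - L a \<omega>"
  shows "square_integrable M Y"
    and "expectation Y = (b - a) * expectation (L 1)"
    and "variance Y = (b - a) * variance (L 1)"
proof -
  have [measurable]: "L a \<in> borel_measurable M" "L b \<in> borel_measurable M" "L (b - a) \<in> borel_measurable M"
    using levy_process_measurable[OF L] ab by auto
  have "distr M borel Y = distr M borel (\<lambda>\<omega>. L (a + (b - a)) \<omega> - L a \<omega>)"
    using Y by (intro distr_cong_AE) auto
  also have "\<dots> = distr M borel (L (b - a))"
    using ab by (intro levy_process_increment_distr L) auto
  finally have eq: "distr M borel Y = distr M borel (L (b - a))" .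
  note m = distr_eq_moments[OF Y(1) _ eq]
  show "square_integrable M Y" "expectation Y = (b - a) * expectation (L 1)"
    "variance Y = (b - a) * variance (L 1)"
    using m ab levy_process_square_integrable[OF L L1, of "b - a"]
      levy_process_variance[OF L L1, of "b - a"] levy_process_expectation[OF L L1, of "b - a"]
    by auto
qed

text \<open>An interval on one side of 0 involves only one of the two copies. On the negative side
  \<open>L t\<close> is almost surely \<open>- L2 (- t)\<close>, so the increment is
  \<open>L2 (- a) \<omega> - L2 (- b) \<omega>\<close>, and \<open>L2 1\<close> has the same law as
  \<open>L 1\<close>. Intervals around 0 are assembled later from the additivity of the random
  measure.\<close>

lemma two_sided_levy_increment_moments:
  assumes L: "two_sided_levy_process M L" and sq: "square_integrable M (L 1)"
    and ab: "a \<le> b" "0 \<le> a \<or> b \<le> 0"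
    and Y: "Y \<in> borel_measurable M" "AE \<omega> in M. Y \<omega> = L b \<omega> - L a \<omega>"
  shows "square_integrable M Y \<and> expectation Y = (b - a) * expectation (L 1) \<and>
    variance Y = (b - a) * variance (L 1)"
proof -
  obtain L1 L2 where L1: "levy_process M L1" and L2: "levy_process M L2"
    and copies: "independent_copies M L1 L2"
    and L_eq: "\<And>\<omega> t. \<omega> \<in> space M \<Longrightarrow> L t \<omega> =
       (if t \<ge> 0 then L1 t \<omega> else - Lim (at_left (- t)) (\<lambda>s. L2 s \<omega>))"
    using L unfolding two_sided_levy_process_def by blast
  have [measurable]: "L1 1 \<in> borel_measurable M" "L2 1 \<in> borel_measurable M"
    using levy_process_measurable L1 L2 by auto
  have L1_1: "L 1 \<in> borel_measurable M" "AE \<omega> in M. L 1 \<omega> = L1 1 \<omega>"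
    using sq by (auto simp: square_integrable_def L_eq)
  note m1 = moments_cong_AE[OF L1_1(1) _ L1_1(2)]
  show ?thesis
  proof (cases "0 \<le> a")
    case True
    have "AE \<omega> in M. Y \<omega> = L1 b \<omega> - L1 a \<omega>"
      using Y(2) AE_space by eventually_elim (use True ab in \<open>simp add: L_eq\<close>)
    with levy_process_increment_moments[OF L1 _ True ab(1) Y(1)] m1 sq show ?thesis by simp
  next
    case False
    then have "a < 0" "b \<le> 0" using ab by auto
    define P where "P = (\<Pi>\<^sub>M t\<in>{0::real..}. borel :: real measure)"
    have *: "indep_var P (sample_path L1) P (sample_path L2)"
      "distr M P (sample_path L1) = distr M P (sample_path L2)"
      using copies by (auto simp: independent_copies_def Let_def P_def)
    have [measurable]: "sample_path L1 \<in> measurable M P" "sample_path L2 \<in> measurable M P"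
      using indep_var_rv1[OF *(1)] indep_var_rv2[OF *(1)] by auto
    have [measurable]: "(\<lambda>x. x 1) \<in> measurable P borel"
      unfolding P_def by (rule measurable_component_singleton) simp
    \<comment> \<open>Equality of the path laws is projected to the coordinate at time 1.\<close>
    have "distr M borel (L1 1) = distr (distr M P (sample_path L1)) borel (\<lambda>x. x 1)"
      by (subst distr_distr) (auto simp: o_def sample_path_def)
    also have "\<dots> = distr M borel (L2 1)"
      unfolding *(2) by (subst distr_distr) (auto simp: o_def sample_path_def)
    finally have eq12: "distr M borel (L1 1) = distr M borel (L2 1)" .
    note m2 = distr_eq_moments[OF _ _ eq12]
    have L_neg: "AE \<omega> in M. L t \<omega> = - L2 (- t) \<omega>" if "t \<le> 0" for t
    \<comment> \<open>At time 0 the two-sided process is given by \<open>L1\<close> and not by a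
      left limit of \<open>L2\<close>; both copies vanish there almost surely.\<close>
    proof (cases "t = 0")
      case True
      have "AE \<omega> in M. L1 0 \<omega> = 0" "AE \<omega> in M. L2 0 \<omega> = 0"
        using L1 L2 by (auto simp: levy_process_def)
      then show ?thesis
        using AE_space by eventually_elim (simp add: L_eq True)
    next
      case False
      with that have "AE \<omega> in M. Lim (at_left (- t)) (\<lambda>s. L2 s \<omega>) = L2 (- t) \<omega>"
        by (intro levy_process_left_limit L2) auto
      then show ?thesis
        using AE_space by eventually_elim (use False that in \<open>simp add: L_eq\<close>)
    qed
    have "AE \<omega> in M. Y \<omega> = L2 (- a) \<omega> - L2 (- b) \<omega>"
      using Y(2) L_neg[OF \<open>b \<le> 0\<close>] L_neg[OF less_imp_le[OF \<open>a < 0\<close>]]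
      by eventually_elim simp
    with levy_process_increment_moments[OF L2 _ _ _ Y(1), of "- b" "- a"] m1 m2 sq ab \<open>b \<le> 0\<close>
    show ?thesis by simp
  qed
qed

end

section \<open>The Levy random measure\<close>

lemma bounded_borelI: "A \<in> sets borel \<Longrightarrow> bounded A \<Longrightarrow> A \<in> bounded_borel"
  by (simp add: bounded_borel_def)

lemma bounded_borel_sets: "A \<in> bounded_borel \<Longrightarrow> A \<in> sets borel"
  by (simp add: bounded_borel_def)

lemma bounded_borel_Ioc [simp]: "{a<..b} \<in> bounded_borel"
  by (simp add: bounded_borel_def)

lemma bounded_borel_empty [simp]: "{} \<in> bounded_borel"
  by (simp add: bounded_borel_def)

lemma bounded_borel_Un [intro]: "A \<in> bounded_borel \<Longrightarrow> B \<in> bounded_borel \<Longrightarrow> A \<union> B \<in> bounded_borel"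
  by (auto simp: bounded_borel_def)

lemma bounded_borel_Int [intro]: "A \<in> bounded_borel \<Longrightarrow> B \<in> sets borel \<Longrightarrow> A \<inter> B \<in> bounded_borel"
  by (auto simp: bounded_borel_def intro: bounded_Int)

lemma bounded_borel_Int' [intro]: "A \<in> sets borel \<Longrightarrow> B \<in> bounded_borel \<Longrightarrow> A \<inter> B \<in> bounded_borel"
  by (auto simp: bounded_borel_def intro: bounded_Int)

lemma bounded_borel_Diff [intro]: "A \<in> bounded_borel \<Longrightarrow> B \<in> sets borel \<Longrightarrow> A - B \<in> bounded_borel"
  by (auto simp: bounded_borel_def intro: bounded_diff)

lemma bounded_borel_emeasure [simp]: "A \<in> bounded_borel \<Longrightarrow> emeasure lborel A \<noteq> \<infinity>"
  using emeasure_bounded_finite[of A] by (auto simp: bounded_borel_def)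

lemma bounded_borel_emeasure' [simp]: "A \<in> bounded_borel \<Longrightarrow> emeasure lborel A \<noteq> \<top>"
  using bounded_borel_emeasure[of A] by simp

text \<open>Declared only now: as a simplification rule it loops with \<open>bounded_borel_def\<close>.\<close>

declare bounded_borel_sets [simp, intro]

lemma measure_bounded_borel_Un:
  "A \<in> bounded_borel \<Longrightarrow> B \<in> bounded_borel \<Longrightarrow> A \<inter> B = {} \<Longrightarrow>
    measure lborel (A \<union> B) = measure lborel A + measure lborel B"
  by (intro measure_Union) auto

text \<open>Dynkin's lemma for half-open intervals, which are stable under intersection. Bounded
  sets are not closed under complement, so the argument runs on traces inside an interval I
  containing A, where the complement of B becomes \<open>I - B \<inter> I\<close>. Proper
  differences and disjoint unions are the operations along which a random measure can be followed
  almost surely.\<close>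

lemma bounded_borel_induct [consumes 1, case_names Ioc Diff Union]:
  assumes A: "A \<in> bounded_borel"
    and Ioc: "\<And>a b. a \<le> b \<Longrightarrow> P {a<..b}"
    and Diff: "\<And>A B. A \<in> bounded_borel \<Longrightarrow> B \<in> bounded_borel \<Longrightarrow> A \<subseteq> B \<Longrightarrow> P A \<Longrightarrow> P B \<Longrightarrow> P (B - A)"
    and Union: "\<And>A :: nat \<Rightarrow> real set. range A \<subseteq> bounded_borel \<Longrightarrow> disjoint_family A \<Longrightarrow>
      bounded (\<Union>n. A n) \<Longrightarrow> (\<And>n. P (A n)) \<Longrightarrow> P (\<Union>n. A n)"
  shows "P A"
proof -
  obtain N where N: "\<And>x. x \<in> A \<Longrightarrow> \<bar>x\<bar> \<le> N"
    using A unfolding bounded_borel_def bounded_real by blast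
  \<comment> \<open>Half-open, so that I itself falls under \<open>Ioc\<close>. The margin 1 keeps
    the left endpoint outside A, and the absolute values cover a negative N, possible when A is
    empty.\<close>
  define I where "I = {- \<bar>N\<bar> - 1<..\<bar>N\<bar> + 1}"
  have "A \<subseteq> I"
  proof
    fix x assume "x \<in> A"
    from N[OF this] show "x \<in> I" by (auto simp: I_def)
  qed
  have P_empty: "P {}" using Ioc[of 0 0] by simp
  have P_Ioc: "P {a<..b}" for a b using Ioc[of a b] P_empty by (cases "a \<le> b") auto
  have I: "I \<in> bounded_borel" "P I" using P_Ioc by (auto simp: I_def)
  have sets: "B \<in> sets borel" if "B \<in> sigma_sets UNIV (range (\<lambda>(a, b). {a<..b::real}))" for B
    using that unfolding borel_sigma_sets_Ioc by (subst sets_measure_of) auto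
  have "Int_stable (range (\<lambda>(a, b). {a<..b::real}))"
    by (force simp: Int_stable_def Int_greaterThanAtMost image_iff)
  moreover have "range (\<lambda>(a, b). {a<..b::real}) \<subseteq> Pow UNIV" by simp
  moreover have "A \<in> sigma_sets UNIV (range (\<lambda>(a, b). {a<..b::real}))"
    using A unfolding bounded_borel_def borel_sigma_sets_Ioc by (subst (asm) sets_measure_of) auto
  ultimately have "P (A \<inter> I)"
  proof (induction rule: sigma_sets_induct_disjoint)
    fix B assume "B \<in> range (\<lambda>(a, b). {a<..b::real})"
    then show "P (B \<inter> I)" by (auto simp: I_def Int_greaterThanAtMost intro: P_Ioc)
  next
    fix B assume "B \<in> sigma_sets UNIV (range (\<lambda>(a, b). {a<..b::real}))" "P (B \<inter> I)"
    moreover have "(UNIV - B) \<inter> I = I - B \<inter> I" by auto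
    ultimately show "P ((UNIV - B) \<inter> I)"
      using I sets by (metis Diff bounded_borel_Int' inf_le2)
  next
    fix B :: "nat \<Rightarrow> real set"
    assume B: "disjoint_family B" "range B \<subseteq> sigma_sets UNIV (range (\<lambda>(a, b). {a<..b::real}))"
      "\<And>i. P (B i \<inter> I)"
    have "P (\<Union>i. B i \<inter> I)"
    proof (rule Union)
      show "range (\<lambda>i. B i \<inter> I) \<subseteq> bounded_borel" using B(2) I(1) sets by blast
      show "disjoint_family (\<lambda>i. B i \<inter> I)" using B(1) by (auto simp: disjoint_family_on_def)
      show "bounded (\<Union>i. B i \<inter> I)" by (rule bounded_subset[of I]) (auto simp: I_def)
    qed (rule B)
    then show "P (\<Union> (range B) \<inter> I)" by (simp add: Int_UN_distrib2)
  qed (use P_empty in auto)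
  with \<open>A \<subseteq> I\<close> show ?thesis by (simp add: Int_absorb2)
qed

section \<open>Almost sure additivity, uniqueness and moments of the random measure\<close>

context prob_space
begin

lemma levy_random_measure_measurable:
  "levy_random_measure M L \<Lambda> \<Longrightarrow> A \<in> bounded_borel \<Longrightarrow> \<Lambda> A \<in> borel_measurable M"
  by (simp add: levy_random_measure_def)

lemma levy_random_measure_sums:
  "levy_random_measure M L \<Lambda> \<Longrightarrow> range A \<subseteq> bounded_borel \<Longrightarrow> disjoint_family A \<Longrightarrow>
    bounded (\<Union>n. A n) \<Longrightarrow> AE \<omega> in M. (\<lambda>n::nat. \<Lambda> (A n) \<omega>) sums \<Lambda> (\<Union>n. A n) \<omega>"
  unfolding levy_random_measure_def by blast

text \<open>Independence and additivity are stated for sequences of sets, so the pair is embedded in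
  the sequence A, B, {}, {}, and so on. The tail disappears because \<open>\<Lambda> {}\<close> is
  almost surely 0.\<close>

lemma levy_random_measure_Un:
  assumes \<Lambda>: "levy_random_measure M L \<Lambda>"
    and AB: "A \<in> bounded_borel" "B \<in> bounded_borel" "A \<inter> B = {}"
  shows "indep_var borel (\<Lambda> A) borel (\<Lambda> B)"
    and "AE \<omega> in M. \<Lambda> (A \<union> B) \<omega> = \<Lambda> A \<omega> + \<Lambda> B \<omega>"
proof -
  have *: "range (binaryset A B) \<subseteq> bounded_borel" "disjoint_family (binaryset A B)"
    "bounded (\<Union>n. binaryset A B n)"
    using AB by (auto simp: range_binaryset_eq UN_binaryset_eq disjoint_family_on_def binaryset_def
      bounded_borel_def simp del: bounded_borel_sets)
  then have "indep_vars (\<lambda>_. borel) (\<lambda>n. \<Lambda> (binaryset A B n)) UNIV"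
    using \<Lambda> unfolding levy_random_measure_def by blast
  then have "indep_vars (\<lambda>_. borel) (\<lambda>n. \<Lambda> (binaryset A B n)) (insert 0 {1})"
    by (rule indep_vars_subset) simp
  from indep_vars_sum[OF _ _ this] show "indep_var borel (\<Lambda> A) borel (\<Lambda> B)"
    by (simp add: binaryset_def)
  \<comment> \<open>A series with constant term \<open>\<Lambda> {} \<omega>\<close> can converge
    only if that term is 0.\<close>
  have "AE \<omega> in M. (\<lambda>n::nat. \<Lambda> {} \<omega>) sums \<Lambda> {} \<omega>"
    using levy_random_measure_sums[OF \<Lambda>, of "\<lambda>_. {}"] by (simp add: disjoint_family_on_def)
  then have "AE \<omega> in M. \<Lambda> {} \<omega> = 0"
    by eventually_elim (use summable_LIMSEQ_zero[OF sums_summable] in \<open>force simp: LIMSEQ_const_iff\<close>)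
  with levy_random_measure_sums[OF \<Lambda> *] show "AE \<omega> in M. \<Lambda> (A \<union> B) \<omega> = \<Lambda> A \<omega> + \<Lambda> B \<omega>"
  proof eventually_elim
    case (elim \<omega>)
    from binaryset_sums[of "\<lambda>A. \<Lambda> A \<omega>" A B] elim show ?case
      by (simp add: UN_binaryset_eq sums_unique2)
  qed
qed

lemma levy_random_measure_Diff:
  assumes \<Lambda>: "levy_random_measure M L \<Lambda>"
    and AB: "A \<in> bounded_borel" "B \<in> bounded_borel" "A \<subseteq> B"
  shows "AE \<omega> in M. \<Lambda> (B - A) \<omega> = \<Lambda> B \<omega> - \<Lambda> A \<omega>"
proof -
  have "A \<union> (B - A) = B" using AB by auto
  with levy_random_measure_Un(2)[OF \<Lambda>, of A "B - A"] AB
  have "AE \<omega> in M. \<Lambda> B \<omega> = \<Lambda> A \<omega> + \<Lambda> (B - A) \<omega>" by auto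
  then show ?thesis by eventually_elim simp
qed

text \<open>Two integrals may be witnessed by different random measures. Both are tied to the
  increments of \<open>L\<close> on half-open intervals, and this propagates to all bounded Borel
  sets.\<close>

lemma levy_random_measure_unique:
  assumes \<Lambda>: "levy_random_measure M L \<Lambda>" and \<Lambda>': "levy_random_measure M L \<Lambda>'"
    and A: "A \<in> bounded_borel"
  shows "AE \<omega> in M. \<Lambda> A \<omega> = \<Lambda>' A \<omega>"
  using A
proof (induction rule: bounded_borel_induct)
  case (Ioc a b)
  with \<Lambda> \<Lambda>' have "AE \<omega> in M. \<Lambda> {a<..b} \<omega> = L b \<omega> - L a \<omega>" "AE \<omega> in M. \<Lambda>' {a<..b} \<omega> = L b \<omega> - L a \<omega>"
    by (auto simp: levy_random_measure_def)
  then show ?case by eventually_elim simp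
next
  case (Diff A B)
  from Diff(4,5) levy_random_measure_Diff[OF \<Lambda> Diff(1-3)] levy_random_measure_Diff[OF \<Lambda>' Diff(1-3)]
  show ?case by eventually_elim simp
next
  case (Union A)
  from Union(4) have "AE \<omega> in M. \<forall>n. \<Lambda> (A n) \<omega> = \<Lambda>' (A n) \<omega>" by (simp add: AE_all_countable)
  with levy_random_measure_sums[OF \<Lambda> Union(1-3)] levy_random_measure_sums[OF \<Lambda>' Union(1-3)]
  show ?case by eventually_elim (auto dest: sums_unique2)
qed

text \<open>Having the stated moments is preserved by the set operations of \<open>bounded_borel_induct\<close>; for
  disjoint unions, the partial sums converge almost surely and are Cauchy in \<open>L\<^sup>2\<close>.\<close>

lemma levy_random_measure_moments:
  assumes L: "two_sided_levy_process M L" and L1: "square_integrable M (L 1)"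
    and \<Lambda>: "levy_random_measure M L \<Lambda>" and A: "A \<in> bounded_borel"
  defines "\<mu> \<equiv> expectation (L 1)" and "V \<equiv> variance (L 1)"
  shows "square_integrable M (\<Lambda> A)"
    and "expectation (\<Lambda> A) = \<mu> * measure lborel A"
    and "expectation (\<lambda>\<omega>. (\<Lambda> A \<omega>)\<^sup>2) = V * measure lborel A + \<mu>\<^sup>2 * (measure lborel A)\<^sup>2"
proof -
  define M2 where "M2 A \<longleftrightarrow> square_integrable M (\<Lambda> A) \<and> expectation (\<Lambda> A) = \<mu> * measure lborel A
    \<and> expectation (\<lambda>\<omega>. (\<Lambda> A \<omega>)\<^sup>2) = V * measure lborel A + \<mu>\<^sup>2 * (measure lborel A)\<^sup>2" for A
  have "V \<ge> 0" by (auto simp: V_def intro: integral_nonneg)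
  note meas = levy_random_measure_measurable[OF \<Lambda>]
  have cross: "expectation (\<lambda>\<omega>. \<Lambda> A \<omega> * \<Lambda> B \<omega>) = expectation (\<Lambda> A) * expectation (\<Lambda> B)"
    if "A \<in> bounded_borel" "B \<in> bounded_borel" "A \<inter> B = {}"
      "square_integrable M (\<Lambda> A)" "square_integrable M (\<Lambda> B)" for A B
    using that by (intro indep_var_lebesgue_integral levy_random_measure_Un(1)[OF \<Lambda>]
      square_integrable_integrable)
  have M2_Un: "M2 (A \<union> B)"
    if AB: "A \<in> bounded_borel" "B \<in> bounded_borel" "A \<inter> B = {}" and "M2 A" "M2 B" for A B
  proof -
    have sq: "square_integrable M (\<Lambda> A)" "square_integrable M (\<Lambda> B)" using that by (auto simp: M2_def)
    have AE: "AE \<omega> in M. \<Lambda> A \<omega> + \<Lambda> B \<omega> = \<Lambda> (A \<union> B) \<omega>"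
      using levy_random_measure_Un(2)[OF \<Lambda> AB] by eventually_elim simp
    have [measurable]: "\<Lambda> A \<in> borel_measurable M" "\<Lambda> B \<in> borel_measurable M" "\<Lambda> (A \<union> B) \<in> borel_measurable M"
      using AB by (auto intro: meas)
    have "expectation (\<Lambda> (A \<union> B)) = expectation (\<lambda>\<omega>. \<Lambda> A \<omega> + \<Lambda> B \<omega>)"
      using AE by (intro integral_cong_AE) auto
    also have "\<dots> = expectation (\<Lambda> A) + expectation (\<Lambda> B)"
      using sq by (intro Bochner_Integration.integral_add square_integrable_integrable)
    finally have 1: "expectation (\<Lambda> (A \<union> B)) = \<mu> * measure lborel (A \<union> B)"
      using that by (simp add: M2_def measure_bounded_borel_Un algebra_simps)
    have "expectation (\<lambda>\<omega>. (\<Lambda> (A \<union> B) \<omega>)\<^sup>2) = expectation (\<lambda>\<omega>. (\<Lambda> A \<omega> + \<Lambda> B \<omega>)\<^sup>2)"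
      using AE by (intro integral_cong_AE) auto
    also have "\<dots> = V * measure lborel (A \<union> B) + \<mu>\<^sup>2 * (measure lborel (A \<union> B))\<^sup>2"
      using that unfolding expectation_square_sum[OF sq] cross[OF AB sq]
      by (simp add: M2_def measure_bounded_borel_Un power2_eq_square algebra_simps)
    finally show ?thesis
      using 1 square_integrable_cong_AE[OF square_integrable_add[OF sq] _ AE] by (simp add: M2_def)
  qed
  have M2_Diff: "M2 (B - A)"
    if AB: "A \<in> bounded_borel" "B \<in> bounded_borel" "A \<subseteq> B" and "M2 A" "M2 B" for A B
  proof -
    have sq: "square_integrable M (\<Lambda> A)" "square_integrable M (\<Lambda> B)" using that by (auto simp: M2_def)
    have AE: "AE \<omega> in M. \<Lambda> B \<omega> - \<Lambda> A \<omega> = \<Lambda> (B - A) \<omega>"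
      using levy_random_measure_Diff[OF \<Lambda> AB] by eventually_elim simp
    have [measurable]: "\<Lambda> A \<in> borel_measurable M" "\<Lambda> B \<in> borel_measurable M" "\<Lambda> (B - A) \<in> borel_measurable M"
      using AB by (auto intro: meas)
    have sqD: "square_integrable M (\<Lambda> (B - A))"
      using square_integrable_cong_AE[OF square_integrable_diff[OF sq(2,1)] _ AE] by simp
    have m: "measure lborel (B - A) = measure lborel B - measure lborel A"
      using AB by (intro measure_Diff) auto
    have "expectation (\<Lambda> (B - A)) = expectation (\<lambda>\<omega>. \<Lambda> B \<omega> - \<Lambda> A \<omega>)"
      using AE by (intro integral_cong_AE) auto
    also have "\<dots> = expectation (\<Lambda> B) - expectation (\<Lambda> A)"
      using sq by (intro Bochner_Integration.integral_diff square_integrable_integrable)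
    finally have 1: "expectation (\<Lambda> (B - A)) = \<mu> * measure lborel (B - A)"
      using that by (simp add: M2_def m algebra_simps)
    have c: "expectation (\<lambda>\<omega>. \<Lambda> A \<omega> * \<Lambda> (B - A) \<omega>) = expectation (\<Lambda> A) * expectation (\<Lambda> (B - A))"
      using AB sq sqD by (intro cross) auto
    \<comment> \<open>B is the disjoint union of A and B - A, so its second moment, already known,
      is expanded and solved for that of the difference.\<close>
    have "expectation (\<lambda>\<omega>. (\<Lambda> B \<omega>)\<^sup>2) = expectation (\<lambda>\<omega>. (\<Lambda> A \<omega> + \<Lambda> (B - A) \<omega>)\<^sup>2)"
    proof (intro integral_cong_AE)
      show "AE \<omega> in M. (\<Lambda> B \<omega>)\<^sup>2 = (\<Lambda> A \<omega> + \<Lambda> (B - A) \<omega>)\<^sup>2"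
        using AE by eventually_elim (simp add: algebra_simps)
    qed auto
    then have "expectation (\<lambda>\<omega>. (\<Lambda> (B - A) \<omega>)\<^sup>2)
        = V * measure lborel (B - A) + \<mu>\<^sup>2 * (measure lborel (B - A))\<^sup>2"
      using that unfolding expectation_square_sum[OF sq(1) sqD] c 1
      by (simp add: M2_def m power2_eq_square algebra_simps)
    with 1 sqD show ?thesis by (simp add: M2_def)
  qed
  have M2_Ioc: "M2 {a<..b}" if "a \<le> b" "0 \<le> a \<or> b \<le> 0" for a b
  proof -
    have "AE \<omega> in M. \<Lambda> {a<..b} \<omega> = L b \<omega> - L a \<omega>"
      using \<Lambda> that by (auto simp: levy_random_measure_def)
    from two_sided_levy_increment_moments[OF L L1 that meas[OF bounded_borel_Ioc] this]
    have m: "square_integrable M (\<Lambda> {a<..b})" "expectation (\<Lambda> {a<..b}) = (b - a) * \<mu>"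
      "variance (\<Lambda> {a<..b}) = (b - a) * V"
      by (auto simp: \<mu>_def V_def)
    have "expectation (\<lambda>\<omega>. (\<Lambda> {a<..b} \<omega>)\<^sup>2) = (b - a) * V + ((b - a) * \<mu>)\<^sup>2"
      using variance_square_integrable[OF m(1)] m(3) unfolding m(2) by simp
    with m show ?thesis using that by (simp add: M2_def power_mult_distrib mult.commute)
  qed
  have "M2 A"
    using A
  proof (induction rule: bounded_borel_induct)
    case (Ioc a b)
    show ?case
    \<comment> \<open>An interval around 0 meets both copies of the process and is split
      there.\<close>
    proof (cases "0 \<le> a \<or> b \<le> 0")
      case False
      then have "M2 ({a<..0} \<union> {0<..b})" by (intro M2_Un M2_Ioc) auto
      also have "{a<..0} \<union> {0<..b} = {a<..b}" using False by auto
      finally show ?thesis .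
    qed (use Ioc M2_Ioc in blast)
  next
    case (Diff A B)
    then show ?case by (rule M2_Diff)
  next
    case (Union A)
    define U where "U k = (\<Union>i<k. A i)" for k
    have U_union: "(\<Union>k. U k) = (\<Union>n. A n)" by (auto simp: U_def)
    have A: "A n \<in> bounded_borel" for n using Union(1) by auto
    have U_Suc: "U (Suc k) = U k \<union> A k" for k by (auto simp: U_def lessThan_Suc)
    have U_disj: "U k \<inter> A k = {}" for k
    proof -
      have "A i \<inter> A k = {}" if "i < k" for i
        by (rule disjoint_family_onD[OF Union(2)]) (use that in simp_all)
      then show ?thesis by (auto simp: U_def)
    qed
    have U: "U k \<in> bounded_borel" for k
      by (induction k) (simp_all add: U_Suc bounded_borel_Un A, simp add: U_def)
    have M2_U: "M2 (U k)" for k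
    proof (induction k)
      case 0
      show ?case using M2_Ioc[of 0 0] by (simp add: U_def)
    next
      case (Suc k)
      then show ?case unfolding U_Suc by (intro M2_Un U A U_disj Union.IH)
    qed
    have U_mono: "U k \<subseteq> U l" if "k \<le> l" for k l
      using that unfolding U_def by (intro UN_mono) auto
    define u where "u k = measure lborel (U k)" for k
    have UA: "(\<Union>n. A n) \<in> bounded_borel" using Union(1,3) by (auto simp: bounded_borel_def simp del: bounded_borel_sets)
    have u_lim: "u \<longlonglongrightarrow> measure lborel (\<Union>n. A n)"
      unfolding u_def U_union[symmetric] using U UA U_mono
      by (intro Lim_measure_incseq) (auto simp: U_union incseq_def)
    have AE_U: "AE \<omega> in M. \<forall>k. \<Lambda> (U k) \<omega> = (\<Sum>i<k. \<Lambda> (A i) \<omega>)"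
      unfolding AE_all_countable
    proof
      fix k
      show "AE \<omega> in M. \<Lambda> (U k) \<omega> = (\<Sum>i<k. \<Lambda> (A i) \<omega>)"
      proof (induction k)
        case 0
        \<comment> \<open>Additivity on two empty sets forces \<open>\<Lambda> {}\<close> to vanish
          almost surely.\<close>
        have "AE \<omega> in M. \<Lambda> ({} \<union> {}) \<omega> = \<Lambda> {} \<omega> + \<Lambda> {} \<omega>"
          by (intro levy_random_measure_Un[OF \<Lambda>]) auto
        then show ?case by eventually_elim (simp add: U_def)
      next
        case (Suc k)
        with levy_random_measure_Un(2)[OF \<Lambda> U A U_disj, of k] show ?case
          by eventually_elim (simp add: U_Suc)
      qed
    qed
    \<comment> \<open>The whole sequence converges almost surely; \<open>id\<close> presents it as a
      subsequence of itself.\<close>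
    have lim: "AE \<omega> in M. (\<lambda>k. \<Lambda> (U (id k)) \<omega>) \<longlonglongrightarrow> \<Lambda> (\<Union>n. A n) \<omega>"
      using AE_U levy_random_measure_sums[OF \<Lambda> Union(1-3)]
      by eventually_elim (simp add: sums_def)
    have sq_U: "square_integrable M (\<Lambda> (U k))" for k using M2_U by (simp add: M2_def)
    have incr: "expectation (\<lambda>\<omega>. (\<Lambda> (U m) \<omega> - \<Lambda> (U n) \<omega>)\<^sup>2) = V * \<bar>u m - u n\<bar> + \<mu>\<^sup>2 * (u m - u n)\<^sup>2"
      for m n
    proof (induction n m rule: linorder_wlog)
      case (le n m)
      have [measurable]: "\<Lambda> (U m) \<in> borel_measurable M" "\<Lambda> (U n) \<in> borel_measurable M"
        "\<Lambda> (U m - U n) \<in> borel_measurable M"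
        using U by (auto intro!: meas)
      have "M2 (U m - U n)" using le by (intro M2_Diff U U_mono M2_U)
      moreover have "measure lborel (U m - U n) = u m - u n"
        unfolding u_def using U U_mono[OF le] by (intro measure_Diff) auto
      moreover have "expectation (\<lambda>\<omega>. (\<Lambda> (U m) \<omega> - \<Lambda> (U n) \<omega>)\<^sup>2) = expectation (\<lambda>\<omega>. (\<Lambda> (U m - U n) \<omega>)\<^sup>2)"
        using levy_random_measure_Diff[OF \<Lambda> U U U_mono[OF le]] by (intro integral_cong_AE) auto
      moreover have "u m - u n \<ge> 0" using measure_nonneg calculation(2) by metis
      ultimately show ?case by (simp add: M2_def)
    qed (simp add: power2_commute abs_minus_commute)
    have Cauchy: "\<exists>N. \<forall>n\<ge>N. \<forall>m\<ge>N. expectation (\<lambda>\<omega>. (\<Lambda> (U n) \<omega> - \<Lambda> (U m) \<omega>)\<^sup>2) \<le> e" if "e > 0" for e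
    proof -
      \<comment> \<open>Once |u n - u m| \<le> d \<le> 1, its square is at most d as well, so the
        second moment of the difference is at most (V + \<mu>^2) d. The summand 1 keeps the
        denominator positive.\<close>
      define d where "d = min 1 (e / (V + \<mu>\<^sup>2 + 1))"
      have pos: "V + \<mu>\<^sup>2 + 1 > 0" using \<open>V \<ge> 0\<close> by (simp add: add_nonneg_pos)
      then have d: "0 < d" "d \<le> 1" using \<open>e > 0\<close> by (auto simp: d_def)
      have "(V + \<mu>\<^sup>2 + 1) * d \<le> (V + \<mu>\<^sup>2 + 1) * (e / (V + \<mu>\<^sup>2 + 1))"
        using pos by (intro mult_left_mono) (auto simp: d_def)
      then have d': "(V + \<mu>\<^sup>2 + 1) * d \<le> e" using pos by simp
      obtain N where N: "\<And>m n. m \<ge> N \<Longrightarrow> n \<ge> N \<Longrightarrow> norm (u m - u n) < d"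
        using LIMSEQ_imp_Cauchy[OF u_lim] d(1) unfolding Cauchy_iff by blast
      have "expectation (\<lambda>\<omega>. (\<Lambda> (U n) \<omega> - \<Lambda> (U m) \<omega>)\<^sup>2) \<le> e" if "n \<ge> N" "m \<ge> N" for n m
      proof -
        have le: "\<bar>u n - u m\<bar> \<le> d" using N[OF that] by simp
        have "(u n - u m)\<^sup>2 = \<bar>u n - u m\<bar> * \<bar>u n - u m\<bar>" by (simp add: power2_eq_square)
        also have "\<dots> \<le> d * 1" using le d by (intro mult_mono) auto
        finally have "V * \<bar>u n - u m\<bar> + \<mu>\<^sup>2 * (u n - u m)\<^sup>2 \<le> V * d + \<mu>\<^sup>2 * d"
          using le \<open>V \<ge> 0\<close> by (intro add_mono mult_left_mono) auto
        also have "\<dots> \<le> e" using d d' by (simp add: algebra_simps)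
        finally show ?thesis by (simp add: incr)
      qed
      then show ?thesis by blast
    qed
    note L2 = L2_Cauchy_AE_subseq_limit[OF sq_U meas[OF UA] strict_mono_id lim Cauchy]
    note mom = L2_tendsto_moments[OF sq_U L2]
    have "(\<lambda>k. expectation (\<Lambda> (U k))) \<longlonglongrightarrow> \<mu> * measure lborel (\<Union>n. A n)"
      using tendsto_mult[OF tendsto_const[of \<mu>] u_lim] M2_U by (simp add: M2_def u_def)
    moreover have "(\<lambda>k. expectation (\<lambda>\<omega>. (\<Lambda> (U k) \<omega>)\<^sup>2))
        \<longlonglongrightarrow> V * measure lborel (\<Union>n. A n) + \<mu>\<^sup>2 * (measure lborel (\<Union>n. A n))\<^sup>2"
    proof -
      have "(\<lambda>k. V * u k + \<mu>\<^sup>2 * (u k)\<^sup>2)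
        \<longlonglongrightarrow> V * measure lborel (\<Union>n. A n) + \<mu>\<^sup>2 * (measure lborel (\<Union>n. A n))\<^sup>2"
        by (intro tendsto_intros u_lim)
      then show ?thesis using M2_U by (simp add: M2_def u_def)
    qed
    ultimately show ?case
      using mom L2(1) LIMSEQ_unique unfolding M2_def by blast
  qed
  then show "square_integrable M (\<Lambda> A)" "expectation (\<Lambda> A) = \<mu> * measure lborel A"
    "expectation (\<lambda>\<omega>. (\<Lambda> A \<omega>)\<^sup>2) = V * measure lborel A + \<mu>\<^sup>2 * (measure lborel A)\<^sup>2"
    by (auto simp: M2_def)
qed

text \<open>With P the common part and Q, R the two differences, the product expands into P^2 + P R
  + P Q + Q R. Only the square carries variance; the other products pair independent variables and
  contribute products of means.\<close>

lemma levy_random_measure_cross_moment: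
  assumes L: "two_sided_levy_process M L" and L1: "square_integrable M (L 1)"
    and \<Lambda>: "levy_random_measure M L \<Lambda>" and AB: "A \<in> bounded_borel" "B \<in> bounded_borel"
  shows "expectation (\<lambda>\<omega>. \<Lambda> A \<omega> * \<Lambda> B \<omega>) =
    variance (L 1) * measure lborel (A \<inter> B) + (expectation (L 1))\<^sup>2 * (measure lborel A * measure lborel B)"
proof -
  define P Q R where "P = A \<inter> B" and "Q = A - B" and "R = B - A"
  have PQR: "P \<in> bounded_borel" "Q \<in> bounded_borel" "R \<in> bounded_borel" using AB by (auto simp: P_def Q_def R_def)
  define \<mu> V where "\<mu> = expectation (L 1)" and "V = variance (L 1)"
  note mom = levy_random_measure_moments[OF L L1 \<Lambda>, folded \<mu>_def V_def]
  note sq = mom(1)[OF PQR(1)] mom(1)[OF PQR(2)] mom(1)[OF PQR(3)]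
  have A_eq: "A = P \<union> Q" "P \<inter> Q = {}" and B_eq: "B = P \<union> R" "P \<inter> R = {}" and QR: "Q \<inter> R = {}"
    by (auto simp: P_def Q_def R_def)
  have AE: "AE \<omega> in M. \<Lambda> A \<omega> = \<Lambda> P \<omega> + \<Lambda> Q \<omega>" "AE \<omega> in M. \<Lambda> B \<omega> = \<Lambda> P \<omega> + \<Lambda> R \<omega>"
    using levy_random_measure_Un(2)[OF \<Lambda>] PQR A_eq B_eq by metis+
  have cross: "expectation (\<lambda>\<omega>. \<Lambda> C \<omega> * \<Lambda> D \<omega>) = \<mu>\<^sup>2 * (measure lborel C * measure lborel D)"
    if "C \<in> bounded_borel" "D \<in> bounded_borel" "C \<inter> D = {}" for C D
    using indep_var_lebesgue_integral[OF levy_random_measure_Un(1)[OF \<Lambda> that]] that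
    by (simp add: mom square_integrable_integrable power2_eq_square)
  have [measurable]: "\<Lambda> A \<in> borel_measurable M" "\<Lambda> B \<in> borel_measurable M"
    "\<Lambda> P \<in> borel_measurable M" "\<Lambda> Q \<in> borel_measurable M" "\<Lambda> R \<in> borel_measurable M"
    using AB PQR by (auto intro: levy_random_measure_measurable[OF \<Lambda>])
  have "expectation (\<lambda>\<omega>. \<Lambda> A \<omega> * \<Lambda> B \<omega>) = expectation (\<lambda>\<omega>. (\<Lambda> P \<omega>)\<^sup>2 + \<Lambda> P \<omega> * \<Lambda> R \<omega> +
      (\<Lambda> P \<omega> * \<Lambda> Q \<omega> + \<Lambda> Q \<omega> * \<Lambda> R \<omega>))"
  proof (intro integral_cong_AE)
    show "AE \<omega> in M. \<Lambda> A \<omega> * \<Lambda> B \<omega> = (\<Lambda> P \<omega>)\<^sup>2 + \<Lambda> P \<omega> * \<Lambda> R \<omega> + (\<Lambda> P \<omega> * \<Lambda> Q \<omega> + \<Lambda> Q \<omega> * \<Lambda> R \<omega>)"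
      using AE by eventually_elim (simp add: algebra_simps power2_eq_square)
  qed auto
  also have "\<dots> = expectation (\<lambda>\<omega>. (\<Lambda> P \<omega>)\<^sup>2) + expectation (\<lambda>\<omega>. \<Lambda> P \<omega> * \<Lambda> R \<omega>) +
      (expectation (\<lambda>\<omega>. \<Lambda> P \<omega> * \<Lambda> Q \<omega>) + expectation (\<lambda>\<omega>. \<Lambda> Q \<omega> * \<Lambda> R \<omega>))"
    using sq square_integrable_mult[OF sq(1,2)] square_integrable_mult[OF sq(1,3)]
      square_integrable_mult[OF sq(2,3)] by (simp add: square_integrable_def)
  also have "\<dots> = V * measure lborel P + \<mu>\<^sup>2 * (measure lborel A * measure lborel B)"
    using PQR A_eq B_eq QR
    by (simp add: cross mom measure_bounded_borel_Un power2_eq_square[of "measure lborel P"] algebra_simps)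
  finally show ?thesis unfolding P_def \<mu>_def V_def .
qed

end

section \<open>The isometry for step integrals\<close>

lemma step_fun_measurable: "step_fun g \<Longrightarrow> g \<in> borel_measurable borel"
  by (auto simp: step_fun_def intro: borel_measurable_simple_function)

lemma step_fun_finite_range: "step_fun g \<Longrightarrow> finite (range g)"
  by (auto simp: step_fun_def simple_function_def)

lemma step_fun_vimage:
  assumes "step_fun g" "y \<noteq> 0" "A \<in> sets borel"
  shows "A \<inter> g -` {y} \<in> bounded_borel"
proof (rule bounded_borelI)
  show "A \<inter> g -` {y} \<in> sets borel"
    using measurable_sets[OF step_fun_measurable[OF assms(1)], of "{y}"] assms by auto
  show "bounded (A \<inter> g -` {y})"
    by (rule bounded_subset[of "{x. g x \<noteq> 0}"]) (use assms in \<open>auto simp: step_fun_def\<close>)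
qed

lemma step_fun_mult_indicator:
  assumes "step_fun g" "A \<in> sets borel"
  shows "step_fun (\<lambda>x. indicator A x * g x)"
proof -
  have "simple_function borel (\<lambda>x. indicator A x * g x)"
    using assms by (intro simple_function_mult simple_function_indicator) (auto simp: step_fun_def)
  moreover have "bounded {x. indicator A x * g x \<noteq> 0}"
    by (rule bounded_subset[of "{x. g x \<noteq> 0}"]) (use assms in \<open>auto simp: step_fun_def\<close>)
  ultimately show ?thesis by (simp add: step_fun_def)
qed

lemma step_fun_diff:
  assumes "step_fun g" "step_fun h"
  shows "step_fun (\<lambda>x. g x - h x)"
proof -
  have "simple_function borel (\<lambda>x. g x - h x)"
    using assms by (intro simple_function_diff) (auto simp: step_fun_def)
  moreover have "bounded {x. g x - h x \<noteq> 0}"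
    by (rule bounded_subset[of "{x. g x \<noteq> 0} \<union> {x. h x \<noteq> 0}"]) (use assms in \<open>auto simp: step_fun_def\<close>)
  ultimately show ?thesis by (simp add: step_fun_def)
qed

lemma step_fun_level_sum:
  assumes "step_fun g"
  shows "indicator A x * g x = (\<Sum>y\<in>range g - {0}. y * indicator (A \<inter> g -` {y}) x)"
proof -
  have "(\<Sum>y\<in>range g - {0}. y * indicator (A \<inter> g -` {y}) x)
      = (\<Sum>y\<in>range g - {0}. if y = g x then indicator A x * g x else 0)"
    by (intro sum.cong) (auto simp: indicator_def)
  also have "\<dots> = indicator A x * g x"
    using step_fun_finite_range[OF assms] by (subst sum.delta) auto
  finally show ?thesis by simp
qed

lemma integrable_indicator_bounded_borel:
  "A \<in> bounded_borel \<Longrightarrow> integrable lborel (indicator A :: real \<Rightarrow> real)"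
  by (intro integrable_real_indicator) (auto simp: less_top[symmetric])

lemma step_fun_integral:
  assumes "step_fun g" "A \<in> sets borel"
  shows "integrable lborel (\<lambda>x. indicator A x * g x)"
    and "(\<integral>x. indicator A x * g x \<partial>lborel) = (\<Sum>y\<in>range g - {0}. y * measure lborel (A \<inter> g -` {y}))"
proof -
  have int: "integrable lborel (indicator (A \<inter> g -` {y}) :: real \<Rightarrow> real)" if "y \<in> range g - {0}" for y
    using that assms by (intro integrable_indicator_bounded_borel step_fun_vimage) auto
  show "integrable lborel (\<lambda>x. indicator A x * g x)"
    unfolding step_fun_level_sum[OF assms(1)]
    by (intro Bochner_Integration.integrable_sum integrable_mult_right int)
  show "(\<integral>x. indicator A x * g x \<partial>lborel) = (\<Sum>y\<in>range g - {0}. y * measure lborel (A \<inter> g -` {y}))"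
    unfolding step_fun_level_sum[OF assms(1)]
    by (subst Bochner_Integration.integral_sum) (auto intro!: integrable_mult_right int)
qed

lemma step_fun_product_integral:
  assumes g: "step_fun g" "A \<in> sets borel" and h: "step_fun h" "B \<in> sets borel"
  shows "integrable lborel (\<lambda>x. (indicator A x * g x) * (indicator B x * h x))"
    and "(\<integral>x. (indicator A x * g x) * (indicator B x * h x) \<partial>lborel) =
      (\<Sum>y\<in>range g - {0}. \<Sum>z\<in>range h - {0}. (y * z) * measure lborel ((A \<inter> g -` {y}) \<inter> (B \<inter> h -` {z})))"
proof -
  have eq: "(indicator A x * g x) * (indicator B x * h x) =
      (\<Sum>y\<in>range g - {0}. \<Sum>z\<in>range h - {0}. (y * z) * indicator ((A \<inter> g -` {y}) \<inter> (B \<inter> h -` {z})) x)" for x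
    unfolding step_fun_level_sum[OF g(1)] step_fun_level_sum[OF h(1)] sum_product
    by (simp add: indicator_inter_arith ac_simps)
  have int: "integrable lborel (indicator ((A \<inter> g -` {y}) \<inter> (B \<inter> h -` {z})) :: real \<Rightarrow> real)"
    if "y \<in> range g - {0}" "z \<in> range h - {0}" for y z
  proof -
    have "A \<inter> g -` {y} \<in> bounded_borel" "B \<inter> h -` {z} \<in> bounded_borel"
      using that g h step_fun_vimage by auto
    then show ?thesis
      using integrable_indicator_bounded_borel[OF bounded_borel_Int[OF _ bounded_borel_sets]] by blast
  qed
  show "integrable lborel (\<lambda>x. (indicator A x * g x) * (indicator B x * h x))"
    unfolding eq by (intro Bochner_Integration.integrable_sum integrable_mult_right int)
  show "(\<integral>x. (indicator A x * g x) * (indicator B x * h x) \<partial>lborel) =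
      (\<Sum>y\<in>range g - {0}. \<Sum>z\<in>range h - {0}. (y * z) * measure lborel ((A \<inter> g -` {y}) \<inter> (B \<inter> h -` {z})))"
    unfolding eq
    by (simp only: Bochner_Integration.integral_sum Bochner_Integration.integrable_sum
        integrable_mult_right int integral_mult_right_zero integral_indicator space_lborel Int_UNIV_right
        UNIV_I cong: sum.cong) simp
qed

text \<open>The interface is the first two moments of \<open>\<Lambda>\<close>. They determine the
  isometry and even, almost surely, the linearity of step integrals.\<close>

locale L2_random_measure = prob_space M for M :: "'a measure" +
  fixes \<Lambda> :: "real set \<Rightarrow> 'a \<Rightarrow> real" and \<mu> V :: real
  assumes sq: "A \<in> bounded_borel \<Longrightarrow> square_integrable M (\<Lambda> A)"
    and mean: "A \<in> bounded_borel \<Longrightarrow> expectation (\<Lambda> A) = \<mu> * measure lborel A"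
    and cross: "A \<in> bounded_borel \<Longrightarrow> B \<in> bounded_borel \<Longrightarrow> expectation (\<lambda>\<omega>. \<Lambda> A \<omega> * \<Lambda> B \<omega>) =
      V * measure lborel (A \<inter> B) + \<mu>\<^sup>2 * (measure lborel A * measure lborel B)"
    and V_nonneg: "0 \<le> V"
begin

text \<open>The mixed second moment of the integrals of u and v: a white noise part with intensity V
  plus the product of the two means.\<close>

definition ip :: "(real \<Rightarrow> real) \<Rightarrow> (real \<Rightarrow> real) \<Rightarrow> real" where
  "ip u v = V * (\<integral>x. u x * v x \<partial>lborel) + \<mu>\<^sup>2 * ((\<integral>x. u x \<partial>lborel) * (\<integral>x. v x \<partial>lborel))"

lemma step_integral_square_integrable:
  assumes "step_fun g" "A \<in> sets borel"
  shows "square_integrable M (step_integral \<Lambda> A g)"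
  unfolding step_integral_def[abs_def] using assms
  by (intro square_integrable_sum square_integrable_cmult sq step_fun_vimage) auto

lemma step_integral_measurable:
  "step_fun g \<Longrightarrow> A \<in> sets borel \<Longrightarrow> step_integral \<Lambda> A g \<in> borel_measurable M"
  using step_integral_square_integrable by (simp add: square_integrable_def)

lemma step_integral_mean:
  assumes "step_fun g" "A \<in> sets borel"
  shows "expectation (step_integral \<Lambda> A g) = \<mu> * (\<integral>x. indicator A x * g x \<partial>lborel)"
proof -
  have \<Lambda>: "integrable M (\<Lambda> (A \<inter> g -` {y}))" "expectation (\<Lambda> (A \<inter> g -` {y})) = \<mu> * measure lborel (A \<inter> g -` {y})"
    if "y \<in> range g - {0}" for y
    using that step_fun_vimage[OF assms(1) _ assms(2), of y]
    by (auto intro!: square_integrable_integrable sq mean)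
  have "expectation (step_integral \<Lambda> A g) = (\<Sum>y\<in>range g - {0}. y * (\<mu> * measure lborel (A \<inter> g -` {y})))"
    unfolding step_integral_def[abs_def]
    by (subst Bochner_Integration.integral_sum) (auto intro!: integrable_mult_right \<Lambda>(1) sum.cong simp: \<Lambda>(2))
  then show ?thesis
    unfolding step_fun_integral(2)[OF assms] by (simp add: sum_distrib_left mult_ac)
qed

lemma step_integral_cross:
  assumes g: "step_fun g" "A \<in> sets borel" and h: "step_fun h" "B \<in> sets borel"
  shows "expectation (\<lambda>\<omega>. step_integral \<Lambda> A g \<omega> * step_integral \<Lambda> B h \<omega>) =
    ip (\<lambda>x. indicator A x * g x) (\<lambda>x. indicator B x * h x)"
proof -
  let ?R = "range g - {0}" and ?S = "range h - {0}"
  let ?A = "\<lambda>y. A \<inter> g -` {y}" and ?B = "\<lambda>z. B \<inter> h -` {z}"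
  have A: "?A y \<in> bounded_borel" if "y \<in> ?R" for y using that g step_fun_vimage by auto
  have B: "?B z \<in> bounded_borel" if "z \<in> ?S" for z using that h step_fun_vimage by auto
  have int: "integrable M (\<lambda>\<omega>. \<Lambda> (?A y) \<omega> * \<Lambda> (?B z) \<omega>)" if "y \<in> ?R" "z \<in> ?S" for y z
    using that by (intro square_integrable_mult sq A B)
  have "expectation (\<lambda>\<omega>. step_integral \<Lambda> A g \<omega> * step_integral \<Lambda> B h \<omega>) =
      expectation (\<lambda>\<omega>. \<Sum>y\<in>?R. \<Sum>z\<in>?S. (y * z) * (\<Lambda> (?A y) \<omega> * \<Lambda> (?B z) \<omega>))"
    unfolding step_integral_def sum_product by (simp add: mult_ac)
  also have "\<dots> = (\<Sum>y\<in>?R. \<Sum>z\<in>?S. expectation (\<lambda>\<omega>. (y * z) * (\<Lambda> (?A y) \<omega> * \<Lambda> (?B z) \<omega>)))"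
    by (subst Bochner_Integration.integral_sum; (intro sum.cong refl)?)
       (auto intro!: Bochner_Integration.integrable_sum integrable_mult_right int Bochner_Integration.integral_sum
         simp del: integral_mult_right_zero)
  also have "\<dots> = (\<Sum>y\<in>?R. \<Sum>z\<in>?S. (y * z) * (V * measure lborel (?A y \<inter> ?B z)
      + \<mu>\<^sup>2 * (measure lborel (?A y) * measure lborel (?B z))))"
    by (intro sum.cong refl) (simp add: cross[OF A B])
  also have "\<dots> = V * (\<Sum>y\<in>?R. \<Sum>z\<in>?S. (y * z) * measure lborel (?A y \<inter> ?B z))
      + \<mu>\<^sup>2 * ((\<Sum>y\<in>?R. y * measure lborel (?A y)) * (\<Sum>z\<in>?S. z * measure lborel (?B z)))"
    unfolding sum_product by (simp add: sum_distrib_left sum.distrib algebra_simps)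
  also have "\<dots> = ip (\<lambda>x. indicator A x * g x) (\<lambda>x. indicator B x * h x)"
    by (simp add: ip_def step_fun_integral[OF g] step_fun_integral[OF h] step_fun_product_integral[OF g h])
  finally show ?thesis .
qed

lemma step_integral_isometry:
  assumes g: "step_fun g" "A \<in> sets borel" and h: "step_fun h" "B \<in> sets borel"
  shows "expectation (\<lambda>\<omega>. (step_integral \<Lambda> A g \<omega> - step_integral \<Lambda> B h \<omega>)\<^sup>2) =
    V * (\<integral>x. (indicator A x * g x - indicator B x * h x)\<^sup>2 \<partial>lborel) +
    \<mu>\<^sup>2 * (\<integral>x. indicator A x * g x - indicator B x * h x \<partial>lborel)\<^sup>2"
proof -
  let ?u = "\<lambda>x. indicator A x * g x" and ?v = "\<lambda>x. indicator B x * h x"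
  have "expectation (\<lambda>\<omega>. (step_integral \<Lambda> A g \<omega> - step_integral \<Lambda> B h \<omega>)\<^sup>2) = ip ?u ?u + ip ?v ?v - 2 * ip ?u ?v"
    using expectation_square_diff[OF step_integral_square_integrable[OF g] step_integral_square_integrable[OF h]]
      step_integral_cross[OF g g] step_integral_cross[OF h h] step_integral_cross[OF g h]
    by (simp add: power2_eq_square)
  also have "\<dots> = V * ((\<integral>x. ?u x * ?u x \<partial>lborel) + (\<integral>x. ?v x * ?v x \<partial>lborel) - 2 * (\<integral>x. ?u x * ?v x \<partial>lborel))
      + \<mu>\<^sup>2 * ((\<integral>x. ?u x \<partial>lborel) - (\<integral>x. ?v x \<partial>lborel))\<^sup>2"
    by (simp add: ip_def power2_eq_square algebra_simps)
  also have "(\<integral>x. ?u x * ?u x \<partial>lborel) + (\<integral>x. ?v x * ?v x \<partial>lborel) - 2 * (\<integral>x. ?u x * ?v x \<partial>lborel)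
      = (\<integral>x. ?u x * ?u x + ?v x * ?v x - 2 * (?u x * ?v x) \<partial>lborel)"
    using step_fun_product_integral(1)[OF g g] step_fun_product_integral(1)[OF h h]
      step_fun_product_integral(1)[OF g h]
    by (simp del: mult.assoc mult.left_commute)
  also have "(\<lambda>x. ?u x * ?u x + ?v x * ?v x - 2 * (?u x * ?v x)) = (\<lambda>x. (?u x - ?v x)\<^sup>2)"
    by (simp add: power2_eq_square algebra_simps)
  also have "(\<integral>x. ?u x \<partial>lborel) - (\<integral>x. ?v x \<partial>lborel) = (\<integral>x. ?u x - ?v x \<partial>lborel)"
    using step_fun_integral(1)[OF g] step_fun_integral(1)[OF h] by simp
  finally show ?thesis .
qed

text \<open>Linearity comes for free: the second moment of the defect vanishes.\<close>

lemma step_integral_diff_AE: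
  assumes g: "step_fun g" "A \<in> sets borel" and h: "step_fun h" "B \<in> sets borel"
    and k: "step_fun k" "C \<in> sets borel"
    and eq: "\<And>x. indicator C x * k x = indicator A x * g x - indicator B x * h x"
  shows "AE \<omega> in M. step_integral \<Lambda> C k \<omega> = step_integral \<Lambda> A g \<omega> - step_integral \<Lambda> B h \<omega>"
proof -
  let ?G = "step_integral \<Lambda> A g" and ?H = "step_integral \<Lambda> B h" and ?K = "step_integral \<Lambda> C k"
  let ?u = "\<lambda>x. indicator A x * g x" and ?v = "\<lambda>x. indicator B x * h x" and ?w = "\<lambda>x. indicator C x * k x"
  note sqi = step_integral_square_integrable[OF g] step_integral_square_integrable[OF h]
    step_integral_square_integrable[OF k]
  note sqD = square_integrable_diff[OF sqi(1,2)]
  have int1: "(\<integral>x. ?w x \<partial>lborel) = (\<integral>x. ?u x \<partial>lborel) - (\<integral>x. ?v x \<partial>lborel)"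
    unfolding eq using step_fun_integral(1)[OF g] step_fun_integral(1)[OF h] by simp
  have int2: "(\<integral>x. ?w x * z x \<partial>lborel) = (\<integral>x. ?u x * z x \<partial>lborel) - (\<integral>x. ?v x * z x \<partial>lborel)"
    if "integrable lborel (\<lambda>x. ?u x * z x)" "integrable lborel (\<lambda>x. ?v x * z x)" for z
    unfolding eq left_diff_distrib using that by (rule Bochner_Integration.integral_diff)
  have ip_left: "ip ?w (\<lambda>x. indicator D x * l x) =
      ip ?u (\<lambda>x. indicator D x * l x) - ip ?v (\<lambda>x. indicator D x * l x)"
    if "step_fun l" "D \<in> sets borel" for l D
    unfolding ip_def int1
      int2[OF step_fun_product_integral(1)[OF g that] step_fun_product_integral(1)[OF h that]]
    by (simp only: algebra_simps)
  have ip_sym: "ip a b = ip b a" for a b by (simp add: ip_def mult.commute)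
  have "expectation (\<lambda>\<omega>. ((?G \<omega> - ?H \<omega>) - ?K \<omega>)\<^sup>2) =
      expectation (\<lambda>\<omega>. (?G \<omega> - ?H \<omega>)\<^sup>2) + expectation (\<lambda>\<omega>. (?K \<omega>)\<^sup>2)
      - 2 * expectation (\<lambda>\<omega>. (?G \<omega> - ?H \<omega>) * ?K \<omega>)"
    by (rule expectation_square_diff[OF sqD sqi(3)])
  also have "expectation (\<lambda>\<omega>. (?G \<omega> - ?H \<omega>)\<^sup>2) = ip ?u ?u + ip ?v ?v - 2 * ip ?u ?v"
    using expectation_square_diff[OF sqi(1,2)]
      step_integral_cross[OF g g] step_integral_cross[OF h h] step_integral_cross[OF g h]
    by (simp add: power2_eq_square)
  also have "expectation (\<lambda>\<omega>. (?K \<omega>)\<^sup>2) = ip ?w ?w"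
    using step_integral_cross[OF k k] by (simp add: power2_eq_square)
  also have "expectation (\<lambda>\<omega>. (?G \<omega> - ?H \<omega>) * ?K \<omega>) = ip ?u ?w - ip ?v ?w"
    using step_integral_cross[OF g k] step_integral_cross[OF h k]
      square_integrable_mult[OF sqi(1,3)] square_integrable_mult[OF sqi(2,3)]
    by (simp add: left_diff_distrib)
  also have "ip ?u ?u + ip ?v ?v - 2 * ip ?u ?v + ip ?w ?w - 2 * (ip ?u ?w - ip ?v ?w) = 0"
  proof -
    \<comment> \<open>The bilinearity relations make the expanded square collapse; the identity is
      stated for plain reals so that the integrals stay opaque.\<close>
    have "uu + vv - 2 * uv + ww - 2 * (uw - vw) = 0"
      if "ww = uw - vw" "uw = uu - uv" "vw = uv - vv" for uu vv ww uv uw vw :: real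
      using that by simp
    moreover have "ip ?u ?w = ip ?u ?u - ip ?u ?v"
      unfolding ip_sym[of ?u ?w] ip_sym[of ?u ?v] by (rule ip_left[OF g])
    moreover have "ip ?v ?w = ip ?u ?v - ip ?v ?v"
      unfolding ip_sym[of ?v ?w] by (rule ip_left[OF h])
    ultimately show ?thesis using ip_left[OF k] by blast
  qed
  finally have "expectation (\<lambda>\<omega>. ((?G \<omega> - ?H \<omega>) - ?K \<omega>)\<^sup>2) = 0" .
  then have "AE \<omega> in M. ((?G \<omega> - ?H \<omega>) - ?K \<omega>)\<^sup>2 = 0"
    using square_integrable_diff[OF sqD sqi(3)]
    by (subst (asm) integral_nonneg_eq_0_iff_AE) (auto simp: square_integrable_def)
  then show ?thesis by eventually_elim simp
qed

end

section \<open>Uniqueness and moments of the integral\<close>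

text \<open>Domination of the identity takes the place of monotonicity of \<open>r\<close>, since
  the indices of the humps are only known to satisfy \<open>j \<le> n j\<close>.\<close>

lemma (in prob_space) prob_dist_Cauchy_subseq:
  assumes [measurable]: "\<And>n. Y n \<in> borel_measurable M" "Z \<in> borel_measurable M"
    and Cauchy: "\<And>e. e > 0 \<Longrightarrow> \<exists>N. \<forall>n\<ge>N. \<forall>m\<ge>N. prob_dist M (Y n) (Y m) < e"
    and r: "\<And>i::nat. i \<le> r i" and lim: "(\<lambda>i. prob_dist M (Y (r i)) Z) \<longlonglongrightarrow> 0"
  shows "(\<lambda>n. prob_dist M (Y n) Z) \<longlonglongrightarrow> 0"
proof (rule LIMSEQ_I)
  fix e :: real assume "e > 0"
  then have "e/2 > 0" by simp
  from Cauchy[OF this] obtain N where N: "\<And>n m. n \<ge> N \<Longrightarrow> m \<ge> N \<Longrightarrow> prob_dist M (Y n) (Y m) < e/2"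
    by blast
  have "\<forall>\<^sub>F i in sequentially. prob_dist M (Y (r i)) Z < e/2 \<and> i \<ge> N"
    using order_tendstoD(2)[OF lim \<open>e/2 > 0\<close>] eventually_ge_at_top by (rule eventually_conj)
  then obtain i where i: "prob_dist M (Y (r i)) Z < e/2" "i \<ge> N"
    using eventually_happens by force
  have "prob_dist M (Y n) Z < e" if "n \<ge> N" for n
    using prob_dist_triangle[of "Y n" "Y (r i)" Z] N[OF that order_trans[OF i(2) r]] i(1) by simp
  then show "\<exists>no. \<forall>n\<ge>no. norm (prob_dist M (Y n) Z - 0) < e"
    using prob_dist_nonneg by (intro exI[of _ N]) simp
qed

context L2_random_measure
begin

text \<open>The single weight \<open>\<bar>h x\<bar> + (h x)\<^sup>2\<close> controls both parts of
  the second moment: its first term the squared mean, its second term the variance.\<close>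

lemma step_integral_prob_dist_le:
  assumes h: "step_fun h" and A: "A \<in> sets borel"
    and small: "(\<integral>x. indicator A x * (\<bar>h x\<bar> + (h x)\<^sup>2) \<partial>lborel) \<le> d"
  shows "prob_dist M (step_integral \<Lambda> A h) (\<lambda>_. 0) \<le> sqrt (V * d + \<mu>\<^sup>2 * d\<^sup>2)"
proof -
  let ?u = "\<lambda>x. indicator A x * h x"
  note sqi = step_integral_square_integrable[OF h A]
  have int: "integrable lborel ?u" "integrable lborel (\<lambda>x. ?u x * ?u x)"
    using step_fun_integral(1)[OF h A] step_fun_product_integral(1)[OF h A h A] by auto
  have u: "\<bar>?u x\<bar> + (?u x)\<^sup>2 = indicator A x * (\<bar>h x\<bar> + (h x)\<^sup>2)" for x
    by (simp add: indicator_def)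
  have nn: "0 \<le> (\<integral>x. \<bar>?u x\<bar> \<partial>lborel)" "0 \<le> (\<integral>x. (?u x)\<^sup>2 \<partial>lborel)" by simp_all
  have "(\<integral>x. \<bar>?u x\<bar> \<partial>lborel) + (\<integral>x. (?u x)\<^sup>2 \<partial>lborel) = (\<integral>x. \<bar>?u x\<bar> + (?u x)\<^sup>2 \<partial>lborel)"
    using int by (intro Bochner_Integration.integral_add[symmetric]) (simp_all add: power2_eq_square)
  then have sum: "(\<integral>x. \<bar>?u x\<bar> \<partial>lborel) + (\<integral>x. (?u x)\<^sup>2 \<partial>lborel) \<le> d" using small unfolding u by simp
  have "\<bar>\<integral>x. ?u x \<partial>lborel\<bar> \<le> (\<integral>x. \<bar>?u x\<bar> \<partial>lborel)" by (rule integral_abs_bound)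
  then have "\<bar>\<integral>x. ?u x \<partial>lborel\<bar> \<le> \<bar>d\<bar>" using sum nn by linarith
  then have 1: "(\<integral>x. ?u x \<partial>lborel)\<^sup>2 \<le> d\<^sup>2" by (simp only: abs_le_square_iff)
  have 2: "(\<integral>x. (?u x)\<^sup>2 \<partial>lborel) \<le> d" using sum nn by linarith
  have "expectation (\<lambda>\<omega>. (step_integral \<Lambda> A h \<omega> - 0)\<^sup>2) =
      V * (\<integral>x. (?u x)\<^sup>2 \<partial>lborel) + \<mu>\<^sup>2 * (\<integral>x. ?u x \<partial>lborel)\<^sup>2"
    using step_integral_cross[OF h A h A] by (simp add: ip_def power2_eq_square)
  also have "\<dots> \<le> V * d + \<mu>\<^sup>2 * d\<^sup>2"
    using 1 2 V_nonneg by (intro add_mono mult_left_mono) auto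
  finally have "expectation (\<lambda>\<omega>. (step_integral \<Lambda> A h \<omega> - 0)\<^sup>2) \<le> V * d + \<mu>\<^sup>2 * d\<^sup>2" .
  moreover have "prob_dist M (step_integral \<Lambda> A h) (\<lambda>_. 0) \<le> sqrt (expectation (\<lambda>\<omega>. (step_integral \<Lambda> A h \<omega> - 0)\<^sup>2))"
    by (rule prob_dist_le_L2) (use sqi in simp)
  ultimately show ?thesis using real_sqrt_le_mono order_trans by blast
qed

text \<open>A gliding hump argument. The sets \<open>D m\<close> exhaust the line; the indices \<open>n j\<close> and \<open>p j\<close> are
  chosen such that \<open>h (n j)\<close> lives essentially on the block \<open>D (p (j + 1)) - D (p j)\<close>. With \<open>S\<close> the
  union of the even blocks, the integrals over \<open>S\<close> are small along odd \<open>j\<close> and those over \<open>- S\<close>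
  along even \<open>j\<close>; being Cauchy in probability, both tend to \<open>0\<close>.\<close>

lemma step_integral_null_limit:
  assumes h: "\<And>n. step_fun (h n)" and lim: "AE x in lborel. (\<lambda>n. h n x) \<longlonglongrightarrow> 0"
    and Cauchy: "\<And>A e. A \<in> sets borel \<Longrightarrow> e > 0 \<Longrightarrow>
      \<exists>N. \<forall>n\<ge>N. \<forall>m\<ge>N. prob_dist M (step_integral \<Lambda> A (h n)) (step_integral \<Lambda> A (h m)) < e"
  shows "(\<lambda>n. prob_dist M (step_integral \<Lambda> UNIV (h n)) (\<lambda>_. 0)) \<longlonglongrightarrow> 0"
proof -
  note [measurable] = step_fun_measurable[OF h]
  note meas = step_integral_measurable[OF h]
  define w where "w n x = \<bar>h n x\<bar> + (h n x)\<^sup>2" for n x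
  have w_meas[measurable]: "w n \<in> borel_measurable borel" for n unfolding w_def[abs_def] by measurable
  have w_nonneg: "0 \<le> w n x" for n x by (simp add: w_def)
  have w_int: "integrable lborel (w n)" for n
    using step_fun_integral(1)[OF h, of UNIV n] step_fun_product_integral(1)[OF h _ h, of UNIV UNIV n n]
    by (auto simp: w_def[abs_def] power2_eq_square)
  have w_lim: "AE x in lborel. (\<lambda>n. w n x) \<longlonglongrightarrow> 0"
    using lim
  proof eventually_elim
    case (elim x)
    have "(\<lambda>n. \<bar>h n x\<bar> + (h n x)\<^sup>2) \<longlonglongrightarrow> \<bar>0\<bar> + 0\<^sup>2" by (intro tendsto_intros elim)
    then show ?case by (simp add: w_def)
  qed
  \<comment> \<open>On \<open>D m\<close> every \<open>w n\<close> is bounded by m and the domain is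
    bounded, as dominated convergence needs. Almost every point lies in some \<open>D m\<close>,
    because a convergent sequence is bounded.\<close>
  define D where "D m = {x. \<bar>x\<bar> \<le> real m \<and> (\<forall>n. w n x \<le> real m)}" for m :: nat
  have D_sets[measurable]: "D m \<in> sets borel" for m unfolding D_def by measurable
  have D_mono: "D m \<subseteq> D m'" if "m \<le> m'" for m m'
    using that by (auto simp: D_def intro: order_trans)
  have D_exhaust: "AE x in lborel. \<exists>m. x \<in> D m"
    using w_lim
  proof eventually_elim
    case (elim x)
    then have "Bseq (\<lambda>n. w n x)" by (intro convergent_imp_Bseq convergentI)
    then obtain K where K: "\<And>n. norm (w n x) \<le> K" by (auto simp: Bseq_def)
    obtain m :: nat where "max \<bar>x\<bar> K \<le> real m" using real_arch_simple by blast
    moreover have "w n x \<le> K" for n using K[of n] by simp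
    ultimately show ?case by (intro exI[of _ m]) (auto simp: D_def intro: order_trans)
  qed
  have \<alpha>: "(\<lambda>n. \<integral>x. indicator (D m) x * w n x \<partial>lborel) \<longlonglongrightarrow> 0" for m
  proof -
    have "(\<lambda>n. \<integral>x. indicator (D m) x * w n x \<partial>lborel) \<longlonglongrightarrow> integral\<^sup>L lborel (\<lambda>_::real. 0 :: real)"
    proof (rule integral_dominated_convergence[where w = "\<lambda>x. real m * indicator {- real m..real m} x"])
      show "integrable lborel (\<lambda>x. real m * indicator {- real m..real m} x)"
        by (intro integrable_mult_right integrable_indicator_bounded_borel bounded_borelI) auto
      show "AE x in lborel. (\<lambda>n. indicator (D m) x * w n x) \<longlonglongrightarrow> 0"
        using w_lim by eventually_elim (rule tendsto_mult_right_zero)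
      show "AE x in lborel. norm (indicator (D m) x * w n x) \<le> real m * indicator {- real m..real m} x" for n
        using w_nonneg by (intro AE_I2) (auto simp: D_def indicator_def abs_le_iff)
    qed auto
    then show ?thesis by simp
  qed
  have \<beta>: "(\<lambda>m. \<integral>x. indicator (- D m) x * w n x \<partial>lborel) \<longlonglongrightarrow> 0" for n
  proof -
    have "(\<lambda>m. \<integral>x. indicator (- D m) x * w n x \<partial>lborel) \<longlonglongrightarrow> integral\<^sup>L lborel (\<lambda>_::real. 0 :: real)"
    proof (rule integral_dominated_convergence[where w = "w n"])
      show "AE x in lborel. (\<lambda>m. indicator (- D m) x * w n x) \<longlonglongrightarrow> 0"
        using D_exhaust
      proof eventually_elim
        case (elim x)
        then obtain m0 where "x \<in> D m0" by blast
        then have "\<forall>\<^sub>F m in sequentially. indicator (- D m) x * w n x = 0"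
          using D_mono by (intro eventually_sequentiallyI[of m0]) (auto simp: indicator_def)
        then show ?case by (rule tendsto_eventually)
      qed
      show "AE x in lborel. norm (indicator (- D m) x * w n x) \<le> w n x" for m
        using w_nonneg by (intro AE_I2) (auto simp: indicator_def)
    qed (auto intro: w_int)
    then show ?thesis by simp
  qed
  \<comment> \<open>The dependent choice runs over pairs (n, m). \<open>P\<close> makes
    \<open>w n\<close> small inside \<open>D m\<close>, and \<open>Q\<close> makes it small outside
    the next, larger set. Thus n is chosen after m, and the next m after n.\<close>
  define P where "P j s \<longleftrightarrow> j \<le> fst s \<and> (\<integral>x. indicator (D (snd s)) x * w (fst s) x \<partial>lborel) < 1 / real (Suc j)"
    for j :: nat and s :: "nat \<times> nat"
  define Q where "Q j s s' \<longleftrightarrow> snd s \<le> snd s' \<and>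
      (\<integral>x. indicator (- D (snd s')) x * w (fst s) x \<partial>lborel) < 1 / real (Suc j)"
    for j :: nat and s s' :: "nat \<times> nat"
  have ex_n: "\<exists>n\<ge>j. (\<integral>x. indicator (D m) x * w n x \<partial>lborel) < 1 / real (Suc j)" for j m
  proof -
    have "\<forall>\<^sub>F n in sequentially. (\<integral>x. indicator (D m) x * w n x \<partial>lborel) < 1 / real (Suc j) \<and> j \<le> n"
      using order_tendstoD(2)[OF \<alpha>[of m], of "1 / real (Suc j)"] eventually_ge_at_top
      by (intro eventually_conj) auto
    then show ?thesis using eventually_happens by force
  qed
  have ex_m: "\<exists>m\<ge>k. (\<integral>x. indicator (- D m) x * w n x \<partial>lborel) < 1 / real (Suc j)" for j n k
  proof -
    have "\<forall>\<^sub>F m in sequentially. (\<integral>x. indicator (- D m) x * w n x \<partial>lborel) < 1 / real (Suc j) \<and> k \<le> m"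
      using order_tendstoD(2)[OF \<beta>[of n], of "1 / real (Suc j)"] eventually_ge_at_top
      by (intro eventually_conj) auto
    then show ?thesis using eventually_happens by force
  qed
  have "\<exists>s. \<forall>j. P j (s j) \<and> Q j (s j) (s (Suc j))"
  proof (rule dependent_nat_choice)
    show "\<exists>s. P 0 s" using ex_n[of 0 0] by (auto simp: P_def)
    fix s j
    obtain m where m: "snd s \<le> m" "(\<integral>x. indicator (- D m) x * w (fst s) x \<partial>lborel) < 1 / real (Suc j)"
      using ex_m by blast
    obtain n where "Suc j \<le> n" "(\<integral>x. indicator (D m) x * w n x \<partial>lborel) < 1 / real (Suc (Suc j))"
      using ex_n by blast
    with m show "\<exists>s'. P (Suc j) s' \<and> Q j s s'"
      by (intro exI[of _ "(n, m)"]) (simp add: P_def Q_def)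
  qed
  then obtain s where s: "\<And>j. P j (s j)" "\<And>j. Q j (s j) (s (Suc j))" by blast
  define n p where "n j = fst (s j)" and "p j = snd (s j)" for j
  have n_ge: "j \<le> n j" and n_small: "(\<integral>x. indicator (D (p j)) x * w (n j) x \<partial>lborel) < 1 / real (Suc j)"
    and p_Suc: "p j \<le> p (Suc j)"
    and p_small: "(\<integral>x. indicator (- D (p (Suc j))) x * w (n j) x \<partial>lborel) < 1 / real (Suc j)" for j
    using s by (auto simp: P_def Q_def n_def p_def)
  have D_p_mono: "D (p i) \<subseteq> D (p j)" if "i \<le> j" for i j
    using lift_Suc_mono_le[of p, OF p_Suc that] by (rule D_mono)
  \<comment> \<open>A set that misses the block is covered by \<open>D (p j)\<close> and the
    complement of \<open>D (p (Suc j))\<close>. Each of them contributes less than 1 / (j + 1) to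
    the weight, hence the numerator 2.\<close>
  have off_block: "prob_dist M (step_integral \<Lambda> T (h (n j))) (\<lambda>_. 0)
      \<le> sqrt (V * (2 / real (Suc j)) + \<mu>\<^sup>2 * (2 / real (Suc j))\<^sup>2)"
    if T[measurable]: "T \<in> sets borel" and sub: "T \<inter> (D (p (Suc j)) - D (p j)) = {}" for T j
  proof (rule step_integral_prob_dist_le[OF h T])
    have int: "integrable lborel (\<lambda>x. indicator B x * w (n j) x)" if "B \<in> sets borel" for B
      using integrable_real_mult_indicator[of B lborel "w (n j)"] that w_int by (simp add: mult.commute)
    have "(\<integral>x. indicator T x * w (n j) x \<partial>lborel)
        \<le> (\<integral>x. indicator (D (p j)) x * w (n j) x + indicator (- D (p (Suc j))) x * w (n j) x \<partial>lborel)"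
    proof (rule integral_mono)
      fix x
      show "indicator T x * w (n j) x \<le> indicator (D (p j)) x * w (n j) x + indicator (- D (p (Suc j))) x * w (n j) x"
        using sub w_nonneg[of "n j" x] by (auto simp: indicator_def)
    qed (auto intro!: int Bochner_Integration.integrable_add)
    also have "\<dots> = (\<integral>x. indicator (D (p j)) x * w (n j) x \<partial>lborel) + (\<integral>x. indicator (- D (p (Suc j))) x * w (n j) x \<partial>lborel)"
      by (intro Bochner_Integration.integral_add int) auto
    also have "\<dots> \<le> 2 / real (Suc j)" using n_small[of j] p_small[of j] by simp
    finally show "(\<integral>x. indicator T x * (\<bar>h (n j) x\<bar> + (h (n j) x)\<^sup>2) \<partial>lborel) \<le> 2 / real (Suc j)"
      by (simp only: w_def)
  qed
  have along: "(\<lambda>k. prob_dist M (step_integral \<Lambda> T (h k)) (\<lambda>_. 0)) \<longlonglongrightarrow> 0"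
    if T: "T \<in> sets borel" and r: "\<And>i::nat. i \<le> r i"
      and sub: "\<And>i. T \<inter> (D (p (Suc (r i))) - D (p (r i))) = {}" for T r
  proof (rule prob_dist_Cauchy_subseq[where r = "\<lambda>i. n (r i)"])
    show "i \<le> n (r i)" for i using r n_ge order_trans by blast
    show "(\<lambda>i. prob_dist M (step_integral \<Lambda> T (h (n (r i)))) (\<lambda>_. 0)) \<longlonglongrightarrow> 0"
    proof (rule tendsto_sandwich[OF _ _ tendsto_const])
      let ?b = "\<lambda>i. sqrt (V * (2 * inverse (real (Suc i))) + \<mu>\<^sup>2 * (2 * inverse (real (Suc i)))\<^sup>2)"
      have "?b \<longlonglongrightarrow> sqrt (V * (2 * 0) + \<mu>\<^sup>2 * (2 * 0)\<^sup>2)"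
        by (intro tendsto_intros LIMSEQ_inverse_real_of_nat)
      then show "?b \<longlonglongrightarrow> 0" by simp
      have "prob_dist M (step_integral \<Lambda> T (h (n (r i)))) (\<lambda>_. 0) \<le> ?b i" for i
      proof -
        have "2 / real (Suc (r i)) \<le> 2 * inverse (real (Suc i))"
          using r[of i] by (simp add: divide_inverse)
        then have "V * (2 / real (Suc (r i))) + \<mu>\<^sup>2 * (2 / real (Suc (r i)))\<^sup>2
            \<le> V * (2 * inverse (real (Suc i))) + \<mu>\<^sup>2 * (2 * inverse (real (Suc i)))\<^sup>2"
          using V_nonneg by (intro add_mono mult_left_mono power_mono) auto
        then show ?thesis using order_trans[OF off_block[OF T sub] real_sqrt_le_mono] by blast
      qed
      then show "\<forall>\<^sub>F i in sequentially. prob_dist M (step_integral \<Lambda> T (h (n (r i)))) (\<lambda>_. 0) \<le> ?b i"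
        by simp
    qed (use prob_dist_nonneg in auto)
  qed (use Cauchy[OF T] meas[OF T] in auto)
  define S where "S = (\<Union>i. D (p (Suc (2 * i))) - D (p (2 * i)))"
  have S[measurable]: "S \<in> sets borel" unfolding S_def by measurable
  have S_lim: "(\<lambda>k. prob_dist M (step_integral \<Lambda> S (h k)) (\<lambda>_. 0)) \<longlonglongrightarrow> 0"
  proof (rule along[of S "\<lambda>i. Suc (2 * i)"])
    fix i
    show "S \<inter> (D (p (Suc (Suc (2 * i)))) - D (p (Suc (2 * i)))) = {}"
    proof (rule equals0I)
      fix x assume x: "x \<in> S \<inter> (D (p (Suc (Suc (2 * i)))) - D (p (Suc (2 * i))))"
      then obtain i' where i': "x \<in> D (p (Suc (2 * i')))" "x \<notin> D (p (2 * i'))" by (auto simp: S_def)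
      show False
      \<comment> \<open>Nesting separates the blocks. An earlier even block lies inside the set that
        the odd block removes; for a later even block, the odd block lies inside the set that the
        even one removes.\<close>
      proof (cases "i' \<le> i")
        case True
        then show False using D_p_mono[of "Suc (2 * i')" "Suc (2 * i)"] i' x by auto
      next
        case False
        then show False using D_p_mono[of "Suc (Suc (2 * i))" "2 * i'"] i' x by auto
      qed
    qed
  qed auto
  have cS_lim: "(\<lambda>k. prob_dist M (step_integral \<Lambda> (- S) (h k)) (\<lambda>_. 0)) \<longlonglongrightarrow> 0"
    by (rule along[of "- S" "\<lambda>i. 2 * i"]) (auto simp: S_def)
  \<comment> \<open>No single index sequence makes the integral over the whole line small; it is the
    sum of two parts, each known to tend to 0 by its own subsequence.\<close>
  have le: "prob_dist M (step_integral \<Lambda> UNIV (h k)) (\<lambda>_. 0) \<le>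
      prob_dist M (step_integral \<Lambda> (- S) (h k)) (\<lambda>_. 0) + prob_dist M (step_integral \<Lambda> S (h k)) (\<lambda>_. 0)" for k
  proof -
    have "AE \<omega> in M. step_integral \<Lambda> (- S) (h k) \<omega> = step_integral \<Lambda> UNIV (h k) \<omega> - step_integral \<Lambda> S (h k) \<omega>"
      by (rule step_integral_diff_AE) (auto simp: h indicator_def)
    then have "prob_dist M (step_integral \<Lambda> UNIV (h k)) (step_integral \<Lambda> S (h k))
        = prob_dist M (step_integral \<Lambda> (- S) (h k)) (\<lambda>_. 0)"
      by (intro prob_dist_cong_AE meas) (auto elim: eventually_mono)
    with prob_dist_triangle[of "step_integral \<Lambda> UNIV (h k)" "step_integral \<Lambda> S (h k)" "\<lambda>_. 0"] meas
    show ?thesis by simp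
  qed
  show ?thesis
  proof (rule tendsto_sandwich[OF _ _ tendsto_const])
    show "(\<lambda>k. prob_dist M (step_integral \<Lambda> (- S) (h k)) (\<lambda>_. 0)
        + prob_dist M (step_integral \<Lambda> S (h k)) (\<lambda>_. 0)) \<longlonglongrightarrow> 0"
      using tendsto_add[OF cS_lim S_lim] by simp
  qed (use le prob_dist_nonneg in simp_all)
qed

text \<open>The truncated functions \<open>f'\<close> are dominated by multiples of
  \<open>f\<close>, so the isometry makes their integrals Cauchy in L2 over every Borel set. The
  remainders \<open>h\<close> therefore inherit from \<open>g\<close> the Cauchy property in
  probability over every Borel set, which is what removing them requires.\<close>

lemma step_integral_limit_moments:
  assumes g: "\<And>n. step_fun (g n)" and lim: "AE x in lborel. (\<lambda>n. g n x) \<longlonglongrightarrow> f x"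
    and f[measurable]: "f \<in> borel_measurable borel" and f1: "integrable lborel f"
    and f2: "integrable lborel (\<lambda>x. (f x)\<^sup>2)"
    and conv: "\<And>A. A \<in> sets borel \<Longrightarrow> \<exists>Z\<in>borel_measurable M. conv_in_prob M sequentially (\<lambda>n. step_integral \<Lambda> A (g n)) Z"
    and Y[measurable]: "Y \<in> borel_measurable M"
    and Y_lim: "conv_in_prob M sequentially (\<lambda>n. step_integral \<Lambda> UNIV (g n)) Y"
  shows "square_integrable M Y" and "expectation Y = \<mu> * (\<integral>x. f x \<partial>lborel)"
    and "expectation (\<lambda>\<omega>. (Y \<omega>)\<^sup>2) = V * (\<integral>x. (f x)\<^sup>2 \<partial>lborel) + \<mu>\<^sup>2 * (\<integral>x. f x \<partial>lborel)\<^sup>2"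
proof -
  note [measurable] = step_fun_measurable[OF g]
  \<comment> \<open>Any factor above 1 serves. At points of convergence with f x \<noteq> 0 the
    value g n x is eventually kept, and where f x = 0 the truncated value is 0, so the truncated
    functions still converge to f.\<close>
  define C where "C n = {x. \<bar>g n x\<bar> \<le> 2 * \<bar>f x\<bar>}" for n
  have C[measurable]: "C n \<in> sets borel" for n unfolding C_def by measurable
  define f' where "f' n x = indicator (C n) x * g n x" for n x
  define h where "h n x = g n x - f' n x" for n x
  have f': "step_fun (f' n)" for n unfolding f'_def[abs_def] by (intro step_fun_mult_indicator g C)
  have h: "step_fun (h n)" for n unfolding h_def[abs_def] by (intro step_fun_diff g f')
  note [measurable] = step_fun_measurable[OF f'] step_fun_measurable[OF h]
  note f'_meas = step_integral_measurable[OF f'] and g_meas = step_integral_measurable[OF g]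
    and h_meas = step_integral_measurable[OF h]
  have f'_bound: "\<bar>f' n x\<bar> \<le> 2 * \<bar>f x\<bar>" for n x by (auto simp: f'_def C_def indicator_def)
  have f'_lim: "AE x in lborel. (\<lambda>n. f' n x) \<longlonglongrightarrow> f x"
    using lim
  proof eventually_elim
    case (elim x)
    show ?case
    proof (cases "f x = 0")
      case True
      then have "f' n x = 0" for n using f'_bound[of n x] by simp
      with True show ?thesis by simp
    next
      case False
      then have "\<bar>f x\<bar> < 2 * \<bar>f x\<bar>" by simp
      then have "\<forall>\<^sub>F n in sequentially. \<bar>g n x\<bar> < 2 * \<bar>f x\<bar>"
        using order_tendstoD(2)[OF tendsto_rabs[OF elim]] by blast
      then have "\<forall>\<^sub>F n in sequentially. g n x = f' n x"
        by eventually_elim (simp add: f'_def C_def)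
      from tendsto_cong[OF this] elim show ?thesis by simp
    qed
  qed
  have h_lim: "AE x in lborel. (\<lambda>n. h n x) \<longlonglongrightarrow> 0"
    using lim f'_lim
  proof eventually_elim
    case (elim x)
    from tendsto_diff[OF elim] show ?case by (simp add: h_def)
  qed
  have diff_bound: "\<bar>f' n x - f x\<bar> \<le> 3 * \<bar>f x\<bar>" for n x using f'_bound[of n x] by linarith
  have diff_bound2: "(f' n x - f x)\<^sup>2 \<le> 9 * (f x)\<^sup>2" for n x
    using power_mono[OF diff_bound abs_ge_zero, of n x 2] by (simp add: power_mult_distrib)
  define a where "a n = (\<integral>x. \<bar>f' n x - f x\<bar> \<partial>lborel)" for n
  define b where "b n = (\<integral>x. (f' n x - f x)\<^sup>2 \<partial>lborel)" for n
  have int_a: "integrable lborel (\<lambda>x. \<bar>f' n x - f x\<bar>)" for n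
    by (rule Bochner_Integration.integrable_bound[of _ "\<lambda>x. 3 * \<bar>f x\<bar>"]) (use f1 diff_bound in auto)
  have int_b: "integrable lborel (\<lambda>x. (f' n x - f x)\<^sup>2)" for n
    by (rule Bochner_Integration.integrable_bound[of _ "\<lambda>x. 9 * (f x)\<^sup>2"]) (use f2 diff_bound2 in auto)
  have "a \<longlonglongrightarrow> integral\<^sup>L lborel (\<lambda>_::real. 0 :: real)"
    unfolding a_def[abs_def]
  proof (rule integral_dominated_convergence[where w = "\<lambda>x. 3 * \<bar>f x\<bar>"])
    show "AE x in lborel. (\<lambda>n. \<bar>f' n x - f x\<bar>) \<longlonglongrightarrow> 0"
      using f'_lim by eventually_elim (simp add: LIM_zero tendsto_rabs_zero)
  qed (use f1 diff_bound in auto)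
  then have a_lim: "a \<longlonglongrightarrow> 0" by simp
  have "b \<longlonglongrightarrow> integral\<^sup>L lborel (\<lambda>_::real. 0 :: real)"
    unfolding b_def[abs_def]
  proof (rule integral_dominated_convergence[where w = "\<lambda>x. 9 * (f x)\<^sup>2"])
    show "AE x in lborel. (\<lambda>n. (f' n x - f x)\<^sup>2) \<longlonglongrightarrow> 0"
      using f'_lim
    proof eventually_elim
      case (elim x)
      from tendsto_power[OF LIM_zero[OF elim], of 2] show ?case by simp
    qed
  qed (use f2 diff_bound2 in auto)
  then have b_lim: "b \<longlonglongrightarrow> 0" by simp
  \<comment> \<open>By (s + t)^2 \<le> 2 s^2 + 2 t^2, passing from \<open>f' n\<close> to
    \<open>f' m\<close> through f costs at most \<open>c n + c m\<close> in the isometry.\<close>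
  define c where "c n = V * (2 * b n) + \<mu>\<^sup>2 * (2 * (a n)\<^sup>2)" for n
  have "c \<longlonglongrightarrow> V * (2 * 0) + \<mu>\<^sup>2 * (2 * 0\<^sup>2)"
    unfolding c_def[abs_def] by (intro tendsto_intros a_lim b_lim)
  then have c_lim: "c \<longlonglongrightarrow> 0" by simp
  have L2_bound: "expectation (\<lambda>\<omega>. (step_integral \<Lambda> A (f' n) \<omega> - step_integral \<Lambda> A (f' m) \<omega>)\<^sup>2) \<le> c n + c m"
    if A: "A \<in> sets borel" for A n m
  proof -
    let ?u = "\<lambda>x. indicator A x * f' n x - indicator A x * f' m x"
    have u_int: "integrable lborel ?u"
      using step_fun_integral(1)[OF f' A] by simp
    have "\<bar>\<integral>x. ?u x \<partial>lborel\<bar> \<le> (\<integral>x. \<bar>?u x\<bar> \<partial>lborel)" by (rule integral_abs_bound)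
    also have "\<dots> \<le> (\<integral>x. \<bar>f' n x - f x\<bar> + \<bar>f' m x - f x\<bar> \<partial>lborel)"
      by (rule integral_mono) (use u_int int_a in \<open>auto simp: indicator_def\<close>)
    also have "\<dots> = a n + a m" unfolding a_def by (intro Bochner_Integration.integral_add int_a)
    finally have "\<bar>\<integral>x. ?u x \<partial>lborel\<bar> \<le> \<bar>a n + a m\<bar>" by simp
    then have "(\<integral>x. ?u x \<partial>lborel)\<^sup>2 \<le> (a n + a m)\<^sup>2" by (simp only: abs_le_square_iff)
    also have "\<dots> \<le> 2 * (a n)\<^sup>2 + 2 * (a m)\<^sup>2"
      using sum_squares_bound[of "a n" "a m"] by (simp add: power2_sum)
    finally have 1: "(\<integral>x. ?u x \<partial>lborel)\<^sup>2 \<le> 2 * (a n)\<^sup>2 + 2 * (a m)\<^sup>2" .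
    have pt: "(?u x)\<^sup>2 \<le> 2 * (f' n x - f x)\<^sup>2 + 2 * (f' m x - f x)\<^sup>2" for x
    proof (cases "x \<in> A")
      case True
      have "(s - t)\<^sup>2 \<le> 2 * s\<^sup>2 + 2 * t\<^sup>2" for s t :: real
        using zero_le_power2[of "s + t"] by (simp add: power2_sum power2_diff)
      from this[of "f' n x - f x" "f' m x - f x"] True show ?thesis by simp
    qed simp
    have "(\<integral>x. (?u x)\<^sup>2 \<partial>lborel) \<le> (\<integral>x. 2 * (f' n x - f x)\<^sup>2 + 2 * (f' m x - f x)\<^sup>2 \<partial>lborel)"
    proof (rule integral_mono')
      show "integrable lborel (\<lambda>x. 2 * (f' n x - f x)\<^sup>2 + 2 * (f' m x - f x)\<^sup>2)"
        using int_b by simp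
    qed (use pt in auto)
    also have "\<dots> = 2 * b n + 2 * b m" unfolding b_def using int_b by simp
    finally have 2: "(\<integral>x. (?u x)\<^sup>2 \<partial>lborel) \<le> 2 * b n + 2 * b m" .
    have "V * (\<integral>x. (?u x)\<^sup>2 \<partial>lborel) + \<mu>\<^sup>2 * (\<integral>x. ?u x \<partial>lborel)\<^sup>2
        \<le> V * (2 * b n + 2 * b m) + \<mu>\<^sup>2 * (2 * (a n)\<^sup>2 + 2 * (a m)\<^sup>2)"
      using 1 2 V_nonneg by (intro add_mono mult_left_mono) auto
    then show ?thesis
      unfolding step_integral_isometry[OF f' A f' A] by (simp add: c_def algebra_simps)
  qed
  have L2_Cauchy: "\<exists>N. \<forall>n\<ge>N. \<forall>m\<ge>N.
      expectation (\<lambda>\<omega>. (step_integral \<Lambda> A (f' n) \<omega> - step_integral \<Lambda> A (f' m) \<omega>)\<^sup>2) \<le> e"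
    if A: "A \<in> sets borel" and "e > 0" for A e
  proof -
    obtain N where N: "\<And>n. n \<ge> N \<Longrightarrow> c n < e/2"
      using order_tendstoD(2)[OF c_lim half_gt_zero[OF \<open>e > 0\<close>]] unfolding eventually_sequentially by blast
    have "expectation (\<lambda>\<omega>. (step_integral \<Lambda> A (f' n) \<omega> - step_integral \<Lambda> A (f' m) \<omega>)\<^sup>2) \<le> e"
      if "n \<ge> N" "m \<ge> N" for n m
      using L2_bound[OF A, of n m] N[OF that(1)] N[OF that(2)] by linarith
    then show ?thesis by blast
  qed
  have h_eq: "AE \<omega> in M. step_integral \<Lambda> A (h n) \<omega> = step_integral \<Lambda> A (g n) \<omega> - step_integral \<Lambda> A (f' n) \<omega>"
    if "A \<in> sets borel" for A n
    using that by (intro step_integral_diff_AE g h f') (simp_all add: h_def algebra_simps)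
  have h_Cauchy: "\<exists>N. \<forall>n\<ge>N. \<forall>m\<ge>N. prob_dist M (step_integral \<Lambda> A (h n)) (step_integral \<Lambda> A (h m)) < e"
    if A: "A \<in> sets borel" and "e > 0" for A e
  proof -
    obtain Z where Z[measurable]: "Z \<in> borel_measurable M"
      and Zc: "conv_in_prob M sequentially (\<lambda>n. step_integral \<Lambda> A (g n)) Z"
      using conv[OF A] by blast
    have Z_lim: "(\<lambda>n. prob_dist M (step_integral \<Lambda> A (g n)) Z) \<longlonglongrightarrow> 0"
      using Zc by (subst (asm) conv_in_prob_iff_prob_dist[where I = UNIV]) (auto intro: g_meas A)
    \<comment> \<open>Three quarters of e are spent: two on \<open>g n\<close> and
      \<open>g m\<close> around their limit in probability, one on \<open>f'\<close> through
      L2.\<close>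
    have "e/4 > 0" using \<open>e > 0\<close> by simp
    obtain N1 where N1: "\<And>n. n \<ge> N1 \<Longrightarrow> prob_dist M (step_integral \<Lambda> A (g n)) Z < e/4"
      using order_tendstoD(2)[OF Z_lim \<open>e/4 > 0\<close>] unfolding eventually_sequentially by blast
    obtain N2 where N2: "\<And>n m. n \<ge> N2 \<Longrightarrow> m \<ge> N2 \<Longrightarrow>
        expectation (\<lambda>\<omega>. (step_integral \<Lambda> A (f' n) \<omega> - step_integral \<Lambda> A (f' m) \<omega>)\<^sup>2) \<le> (e/4)\<^sup>2"
      using L2_Cauchy[OF A, of "(e/4)\<^sup>2"] \<open>e > 0\<close> by auto
    have "prob_dist M (step_integral \<Lambda> A (h n)) (step_integral \<Lambda> A (h m)) < e"
      if nm: "n \<ge> max N1 N2" "m \<ge> max N1 N2" for n m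
    proof -
      let ?G = "\<lambda>n. step_integral \<Lambda> A (g n)" and ?F = "\<lambda>n. step_integral \<Lambda> A (f' n)"
      have [measurable]: "?G k \<in> borel_measurable M" "?F k \<in> borel_measurable M" for k
        using A by (auto intro: g_meas f'_meas)
      have "prob_dist M (step_integral \<Lambda> A (h n)) (step_integral \<Lambda> A (h m)) =
          prob_dist M (\<lambda>\<omega>. ?G n \<omega> - ?F n \<omega>) (\<lambda>\<omega>. ?G m \<omega> - ?F m \<omega>)"
      proof (rule prob_dist_cong_AE)
        show "AE \<omega> in M. step_integral \<Lambda> A (h n) \<omega> - step_integral \<Lambda> A (h m) \<omega> =
            ?G n \<omega> - ?F n \<omega> - (?G m \<omega> - ?F m \<omega>)"
          using h_eq[OF A, of n] h_eq[OF A, of m] by eventually_elim simp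
      qed (auto intro: h_meas A)
      also have "\<dots> \<le> prob_dist M (?G n) (?G m) + prob_dist M (?F n) (?F m)"
        by (intro prob_dist_diff) auto
      also have "prob_dist M (?G n) (?G m) \<le> prob_dist M (?G n) Z + prob_dist M Z (?G m)"
        by (intro prob_dist_triangle) auto
      also have "prob_dist M (?G n) Z + prob_dist M Z (?G m) < e/2"
        using N1[of n] N1[of m] nm by (simp add: prob_dist_commute[of Z])
      also have "prob_dist M (?F n) (?F m) \<le> sqrt (expectation (\<lambda>\<omega>. (?F n \<omega> - ?F m \<omega>)\<^sup>2))"
        by (intro prob_dist_le_L2 square_integrable_diff step_integral_square_integrable f' A)
      also have "\<dots> \<le> e/4"
        using N2[of n m] nm \<open>e > 0\<close> by (intro real_le_lsqrt) auto
      finally show ?thesis using \<open>e > 0\<close> by simp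
    qed
    then show ?thesis by blast
  qed
  note h_null = step_integral_null_limit[OF h h_lim h_Cauchy]
  have Y_lim': "(\<lambda>n. prob_dist M (step_integral \<Lambda> UNIV (g n)) Y) \<longlonglongrightarrow> 0"
    using Y_lim by (subst (asm) conv_in_prob_iff_prob_dist[where I = UNIV]) (auto intro: g_meas)
  have F_le: "prob_dist M (step_integral \<Lambda> UNIV (f' n)) Y \<le>
      prob_dist M (step_integral \<Lambda> UNIV (h n)) (\<lambda>_. 0) + prob_dist M (step_integral \<Lambda> UNIV (g n)) Y" for n
  proof -
    have "prob_dist M (step_integral \<Lambda> UNIV (g n)) (step_integral \<Lambda> UNIV (f' n))
        = prob_dist M (step_integral \<Lambda> UNIV (h n)) (\<lambda>_. 0)"
      using h_eq[of UNIV n] by (intro prob_dist_cong_AE g_meas f'_meas h_meas) (auto elim: eventually_mono)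
    with prob_dist_triangle[of "step_integral \<Lambda> UNIV (f' n)" "step_integral \<Lambda> UNIV (g n)" Y] g_meas f'_meas
    show ?thesis by (simp add: prob_dist_commute)
  qed
  have F_lim: "(\<lambda>n. prob_dist M (step_integral \<Lambda> UNIV (f' n)) Y) \<longlonglongrightarrow> 0"
  proof (rule tendsto_sandwich[OF _ _ tendsto_const])
    show "(\<lambda>n. prob_dist M (step_integral \<Lambda> UNIV (h n)) (\<lambda>_. 0) + prob_dist M (step_integral \<Lambda> UNIV (g n)) Y)
        \<longlonglongrightarrow> 0"
      using tendsto_add[OF h_null Y_lim'] by simp
  qed (use F_le prob_dist_nonneg in simp_all)
  have F_sq: "square_integrable M (step_integral \<Lambda> UNIV (f' n))" for n
    by (intro step_integral_square_integrable f') simp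
  note L2 = L2_Cauchy_prob_limit[OF F_sq Y F_lim L2_Cauchy]
  show "square_integrable M Y" by (rule L2) auto
  note mom = L2_tendsto_moments[OF F_sq L2]
  have int_f': "(\<lambda>n. \<integral>x. f' n x \<partial>lborel) \<longlonglongrightarrow> (\<integral>x. f x \<partial>lborel)"
    by (rule integral_dominated_convergence[where w = "\<lambda>x. 2 * \<bar>f x\<bar>"]) (use f1 f'_lim f'_bound in auto)
  have int_f'2: "(\<lambda>n. \<integral>x. (f' n x)\<^sup>2 \<partial>lborel) \<longlonglongrightarrow> (\<integral>x. (f x)\<^sup>2 \<partial>lborel)"
  proof (rule integral_dominated_convergence[where w = "\<lambda>x. 4 * (f x)\<^sup>2"])
    show "AE x in lborel. (\<lambda>n. (f' n x)\<^sup>2) \<longlonglongrightarrow> (f x)\<^sup>2"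
      using f'_lim by eventually_elim (rule tendsto_power)
    have "(f' n x)\<^sup>2 \<le> 4 * (f x)\<^sup>2" for n x
      using power_mono[OF f'_bound abs_ge_zero, of n x 2] by (simp add: power_mult_distrib)
    then show "AE x in lborel. norm ((f' n x)\<^sup>2) \<le> 4 * (f x)\<^sup>2" for n by auto
  qed (use f2 in auto)
  have "expectation (step_integral \<Lambda> UNIV (f' n)) = \<mu> * (\<integral>x. f' n x \<partial>lborel)" for n
    using step_integral_mean[OF f', of UNIV n] by simp
  with tendsto_mult[OF tendsto_const[of \<mu>] int_f']
  have "(\<lambda>n. expectation (step_integral \<Lambda> UNIV (f' n))) \<longlonglongrightarrow> \<mu> * (\<integral>x. f x \<partial>lborel)" by simp
  moreover have "(\<lambda>n. expectation (step_integral \<Lambda> UNIV (f' n))) \<longlonglongrightarrow> expectation Y"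
    by (rule mom) auto
  ultimately show "expectation Y = \<mu> * (\<integral>x. f x \<partial>lborel)" using LIMSEQ_unique by blast
  have "expectation (\<lambda>\<omega>. (step_integral \<Lambda> UNIV (f' n) \<omega>)\<^sup>2) =
      V * (\<integral>x. (f' n x)\<^sup>2 \<partial>lborel) + \<mu>\<^sup>2 * (\<integral>x. f' n x \<partial>lborel)\<^sup>2" for n
    using step_integral_cross[OF f' _ f', of UNIV UNIV n n] by (simp add: ip_def power2_eq_square)
  moreover have "(\<lambda>n. V * (\<integral>x. (f' n x)\<^sup>2 \<partial>lborel) + \<mu>\<^sup>2 * (\<integral>x. f' n x \<partial>lborel)\<^sup>2)
      \<longlonglongrightarrow> V * (\<integral>x. (f x)\<^sup>2 \<partial>lborel) + \<mu>\<^sup>2 * (\<integral>x. f x \<partial>lborel)\<^sup>2"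
    by (intro tendsto_intros int_f' int_f'2)
  moreover have "(\<lambda>n. expectation (\<lambda>\<omega>. (step_integral \<Lambda> UNIV (f' n) \<omega>)\<^sup>2)) \<longlonglongrightarrow> expectation (\<lambda>\<omega>. (Y \<omega>)\<^sup>2)"
    by (rule mom) auto
  ultimately show "expectation (\<lambda>\<omega>. (Y \<omega>)\<^sup>2) = V * (\<integral>x. (f x)\<^sup>2 \<partial>lborel) + \<mu>\<^sup>2 * (\<integral>x. f x \<partial>lborel)\<^sup>2"
    using LIMSEQ_unique by simp
qed

end

section \<open>Correlations of exponential integrals\<close>

context prob_space
begin

lemma L2_random_measure_levy:
  assumes "two_sided_levy_process M L" "square_integrable M (L 1)" "levy_random_measure M L \<Lambda>"
  shows "L2_random_measure M \<Lambda> (expectation (L 1)) (variance (L 1))"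
  by unfold_locales
     (use levy_random_measure_moments[OF assms] levy_random_measure_cross_moment[OF assms] in
       \<open>auto intro: integral_nonneg\<close>)

lemma step_integral_unique:
  assumes \<Lambda>: "levy_random_measure M L \<Lambda>" and \<Lambda>': "levy_random_measure M L \<Lambda>'"
    and g: "step_fun g" and A: "A \<in> sets borel"
  shows "AE \<omega> in M. step_integral \<Lambda> A g \<omega> = step_integral \<Lambda>' A g \<omega>"
proof -
  have "AE \<omega> in M. \<forall>y\<in>range g - {0}. \<Lambda> (A \<inter> g -` {y}) \<omega> = \<Lambda>' (A \<inter> g -` {y}) \<omega>"
    using step_fun_finite_range[OF g] g A
    by (intro AE_finite_allI levy_random_measure_unique[OF \<Lambda> \<Lambda>'] step_fun_vimage) auto
  then show ?thesis unfolding step_integral_def by eventually_elim (rule sum.cong; simp)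
qed

text \<open>The two limits may belong to different random measures. Up to null sets the second is
  exchanged for the first in each step integral, and only then are step integrals
  subtracted.\<close>

lemma step_integral_conv_diff:
  assumes L: "two_sided_levy_process M L" "square_integrable M (L 1)"
    and \<Lambda>: "levy_random_measure M L \<Lambda>" and \<Lambda>': "levy_random_measure M L \<Lambda>'"
    and g: "\<And>n. step_fun (g n)" and g': "\<And>n. step_fun (g' n)" and A: "A \<in> sets borel"
    and [measurable]: "Z \<in> borel_measurable M" "Z' \<in> borel_measurable M"
    and Z: "conv_in_prob M sequentially (\<lambda>n. step_integral \<Lambda> A (g n)) Z"
    and Z': "conv_in_prob M sequentially (\<lambda>n. step_integral \<Lambda>' A (g' n)) Z'"
  shows "conv_in_prob M sequentially (\<lambda>n. step_integral \<Lambda> A (\<lambda>x. g n x - g' n x)) (\<lambda>\<omega>. Z \<omega> - Z' \<omega>)"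
proof -
  interpret R: L2_random_measure M \<Lambda> "expectation (L 1)" "variance (L 1)"
    by (rule L2_random_measure_levy[OF L \<Lambda>])
  interpret R': L2_random_measure M \<Lambda>' "expectation (L 1)" "variance (L 1)"
    by (rule L2_random_measure_levy[OF L \<Lambda>'])
  let ?G = "\<lambda>n. step_integral \<Lambda> A (g n)" and ?G' = "\<lambda>n. step_integral \<Lambda>' A (g' n)"
  let ?D = "\<lambda>n. step_integral \<Lambda> A (\<lambda>x. g n x - g' n x)"
  note d = step_fun_diff[OF g g']
  have [measurable]: "?G n \<in> borel_measurable M" "?G' n \<in> borel_measurable M" "?D n \<in> borel_measurable M" for n
    using R.step_integral_measurable[OF g A] R'.step_integral_measurable[OF g' A]
      R.step_integral_measurable[OF d A] by auto
  have le: "prob_dist M (?D n) (\<lambda>\<omega>. Z \<omega> - Z' \<omega>) \<le> prob_dist M (?G n) Z + prob_dist M (?G' n) Z'" for n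
  proof -
    have "AE \<omega> in M. ?D n \<omega> = ?G n \<omega> - step_integral \<Lambda> A (g' n) \<omega>"
      by (rule R.step_integral_diff_AE[OF g A g' A d A]) (simp add: right_diff_distrib)
    with step_integral_unique[OF \<Lambda> \<Lambda>' g' A, of n]
    have "AE \<omega> in M. ?D n \<omega> - (Z \<omega> - Z' \<omega>) = (?G n \<omega> - ?G' n \<omega>) - (Z \<omega> - Z' \<omega>)"
      by eventually_elim simp
    then have "prob_dist M (?D n) (\<lambda>\<omega>. Z \<omega> - Z' \<omega>) = prob_dist M (\<lambda>\<omega>. ?G n \<omega> - ?G' n \<omega>) (\<lambda>\<omega>. Z \<omega> - Z' \<omega>)"
      by (intro prob_dist_cong_AE) auto
    also have "\<dots> \<le> prob_dist M (?G n) Z + prob_dist M (?G' n) Z'" by (intro prob_dist_diff) auto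
    finally show ?thesis .
  qed
  have lim: "(\<lambda>n. prob_dist M (?G n) Z) \<longlonglongrightarrow> 0" "(\<lambda>n. prob_dist M (?G' n) Z') \<longlonglongrightarrow> 0"
    using Z Z' by (auto simp: conv_in_prob_iff_prob_dist[where I = UNIV])
  have "(\<lambda>n. prob_dist M (?D n) (\<lambda>\<omega>. Z \<omega> - Z' \<omega>)) \<longlonglongrightarrow> 0"
  proof (rule tendsto_sandwich[OF _ _ tendsto_const])
    show "(\<lambda>n. prob_dist M (?G n) Z + prob_dist M (?G' n) Z') \<longlonglongrightarrow> 0" using tendsto_add[OF lim] by simp
  qed (use le prob_dist_nonneg in simp_all)
  then show ?thesis by (subst conv_in_prob_iff_prob_dist[where I = UNIV]) auto
qed

text \<open>This turns an increment of X into a single integral and supplies the difference that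
  polarization needs.\<close>

lemma has_levy_integral_diff:
  assumes L: "two_sided_levy_process M L" "square_integrable M (L 1)"
    and Y: "has_levy_integral M L f Y" and Y': "has_levy_integral M L f' Y'"
  shows "has_levy_integral M L (\<lambda>x. f x - f' x) (\<lambda>\<omega>. Y \<omega> - Y' \<omega>)"
proof -
  obtain \<Lambda> g where \<Lambda>: "levy_random_measure M L \<Lambda>" and g: "\<And>n. step_fun (g n)"
    and g_lim: "AE x in lborel. (\<lambda>n. g n x) \<longlonglongrightarrow> f x"
    and g_conv: "\<And>A. A \<in> sets borel \<Longrightarrow> \<exists>Z\<in>borel_measurable M. conv_in_prob M sequentially (\<lambda>n. step_integral \<Lambda> A (g n)) Z"
    and g_Y: "conv_in_prob M sequentially (\<lambda>n. step_integral \<Lambda> UNIV (g n)) Y"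
    using Y unfolding has_levy_integral_def by blast
  obtain \<Lambda>' g' where \<Lambda>': "levy_random_measure M L \<Lambda>'" and g': "\<And>n. step_fun (g' n)"
    and g'_lim: "AE x in lborel. (\<lambda>n. g' n x) \<longlonglongrightarrow> f' x"
    and g'_conv: "\<And>A. A \<in> sets borel \<Longrightarrow> \<exists>Z\<in>borel_measurable M. conv_in_prob M sequentially (\<lambda>n. step_integral \<Lambda>' A (g' n)) Z"
    and g'_Y: "conv_in_prob M sequentially (\<lambda>n. step_integral \<Lambda>' UNIV (g' n)) Y'"
    using Y' unfolding has_levy_integral_def by blast
  have meas: "f \<in> borel_measurable borel" "f' \<in> borel_measurable borel"
    "Y \<in> borel_measurable M" "Y' \<in> borel_measurable M"
    using Y Y' by (auto simp: has_levy_integral_def)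
  note diff = step_integral_conv_diff[OF L \<Lambda> \<Lambda>' g g']
  show ?thesis
    unfolding has_levy_integral_def
  proof (intro conjI exI[of _ \<Lambda>] exI[of _ "\<lambda>n x. g n x - g' n x"] allI ballI)
    show "AE x in lborel. (\<lambda>n. g n x - g' n x) \<longlonglongrightarrow> f x - f' x"
      using g_lim g'_lim by eventually_elim (rule tendsto_diff)
    show "\<exists>Z\<in>borel_measurable M. conv_in_prob M sequentially (\<lambda>n. step_integral \<Lambda> A (\<lambda>x. g n x - g' n x)) Z"
      if A: "A \<in> sets borel" for A
    proof -
      obtain Z Z' where Z: "Z \<in> borel_measurable M" "Z' \<in> borel_measurable M"
        "conv_in_prob M sequentially (\<lambda>n. step_integral \<Lambda> A (g n)) Z"
        "conv_in_prob M sequentially (\<lambda>n. step_integral \<Lambda>' A (g' n)) Z'"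
        using g_conv[OF A] g'_conv[OF A] by blast
      show ?thesis
        using Z(1,2) by (intro bexI[of _ "\<lambda>\<omega>. Z \<omega> - Z' \<omega>"] diff[OF A Z]) auto
    qed
    show "conv_in_prob M sequentially (\<lambda>n. step_integral \<Lambda> UNIV (\<lambda>x. g n x - g' n x)) (\<lambda>\<omega>. Y \<omega> - Y' \<omega>)"
      by (rule diff) (use meas g_Y g'_Y in auto)
  qed (use \<Lambda> step_fun_diff[OF g g'] meas in auto)
qed

lemma has_levy_integral_moments:
  assumes L: "two_sided_levy_process M L" "square_integrable M (L 1)"
    and Y: "has_levy_integral M L f Y"
    and f: "integrable lborel f" "square_integrable lborel f"
  shows "square_integrable M Y"
    and "expectation Y = expectation (L 1) * (\<integral>x. f x \<partial>lborel)"
    and "expectation (\<lambda>\<omega>. (Y \<omega>)\<^sup>2) =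
      variance (L 1) * (\<integral>x. (f x)\<^sup>2 \<partial>lborel) + (expectation (L 1))\<^sup>2 * (\<integral>x. f x \<partial>lborel)\<^sup>2"
proof -
  obtain \<Lambda> g where \<Lambda>: "levy_random_measure M L \<Lambda>" and g: "\<And>n. step_fun (g n)"
    and g_lim: "AE x in lborel. (\<lambda>n. g n x) \<longlonglongrightarrow> f x"
    and g_conv: "\<And>A. A \<in> sets borel \<Longrightarrow> \<exists>Z\<in>borel_measurable M. conv_in_prob M sequentially (\<lambda>n. step_integral \<Lambda> A (g n)) Z"
    and g_Y: "conv_in_prob M sequentially (\<lambda>n. step_integral \<Lambda> UNIV (g n)) Y"
    using Y unfolding has_levy_integral_def by blast
  have meas: "f \<in> borel_measurable borel" "Y \<in> borel_measurable M"
    using Y by (auto simp: has_levy_integral_def)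
  have f2: "integrable lborel (\<lambda>x. (f x)\<^sup>2)" using f by (simp add: square_integrable_def)
  interpret L2_random_measure M \<Lambda> "expectation (L 1)" "variance (L 1)"
    by (rule L2_random_measure_levy[OF L \<Lambda>])
  note * = step_integral_limit_moments[OF g g_lim meas(1) f(1) f2 g_conv meas(2) g_Y]
  show "square_integrable M Y" "expectation Y = expectation (L 1) * (\<integral>x. f x \<partial>lborel)"
    "expectation (\<lambda>\<omega>. (Y \<omega>)\<^sup>2) =
      variance (L 1) * (\<integral>x. (f x)\<^sup>2 \<partial>lborel) + (expectation (L 1))\<^sup>2 * (\<integral>x. f x \<partial>lborel)\<^sup>2"
    using * by auto
qed

lemma has_levy_integral_variance:
  assumes "two_sided_levy_process M L" "square_integrable M (L 1)"
    and "has_levy_integral M L f Y" and "integrable lborel f" "square_integrable lborel f"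
  shows "variance Y = variance (L 1) * (\<integral>x. (f x)\<^sup>2 \<partial>lborel)"
  using variance_square_integrable[OF has_levy_integral_moments(1)[OF assms]]
    has_levy_integral_moments(2,3)[OF assms]
  by (simp add: power_mult_distrib)

text \<open>Polarization: the second moments of Y, Y' and their difference determine the mixed
  moment, and centring removes its mean part \<open>\<mu>\<^sup>2 * (?a * ?a')\<close>.\<close>

lemma has_levy_integral_cov:
  assumes L: "two_sided_levy_process M L" "square_integrable M (L 1)"
    and Y: "has_levy_integral M L f Y" and f: "integrable lborel f" "square_integrable lborel f"
    and Y': "has_levy_integral M L f' Y'" and f': "integrable lborel f'" "square_integrable lborel f'"
  shows "cov M Y Y' = variance (L 1) * (\<integral>x. f x * f' x \<partial>lborel)"
proof -
  define \<mu> V where "\<mu> = expectation (L 1)" and "V = variance (L 1)"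
  let ?a = "\<integral>x. f x \<partial>lborel" and ?a' = "\<integral>x. f' x \<partial>lborel"
  note m = has_levy_integral_moments[OF L Y f, folded \<mu>_def V_def]
    and m' = has_levy_integral_moments[OF L Y' f', folded \<mu>_def V_def]
    and md = has_levy_integral_moments[OF L has_levy_integral_diff[OF L Y Y']
      Bochner_Integration.integrable_diff[OF f(1) f'(1)] square_integrable_diff[OF f(2) f'(2)],
      folded \<mu>_def V_def]
  have int: "integrable lborel (\<lambda>x. (f x)\<^sup>2)" "integrable lborel (\<lambda>x. (f' x)\<^sup>2)"
    "integrable lborel (\<lambda>x. f x * f' x)"
    using f f' square_integrable_mult[OF f(2) f'(2)] by (auto simp: square_integrable_def)
  have "(\<integral>x. (f x - f' x)\<^sup>2 \<partial>lborel) = (\<integral>x. (f x)\<^sup>2 + (f' x)\<^sup>2 - 2 * (f x * f' x) \<partial>lborel)"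
    by (simp add: power2_diff mult.assoc)
  also have "\<dots> = (\<integral>x. (f x)\<^sup>2 \<partial>lborel) + (\<integral>x. (f' x)\<^sup>2 \<partial>lborel) - 2 * (\<integral>x. f x * f' x \<partial>lborel)"
    using int by simp
  finally have sq: "(\<integral>x. (f x - f' x)\<^sup>2 \<partial>lborel) =
      (\<integral>x. (f x)\<^sup>2 \<partial>lborel) + (\<integral>x. (f' x)\<^sup>2 \<partial>lborel) - 2 * (\<integral>x. f x * f' x \<partial>lborel)" .
  have "(\<integral>x. f x - f' x \<partial>lborel) = ?a - ?a'" using f f' by simp
  with md(3) sq have "expectation (\<lambda>\<omega>. (Y \<omega> - Y' \<omega>)\<^sup>2) =
      V * ((\<integral>x. (f x)\<^sup>2 \<partial>lborel) + (\<integral>x. (f' x)\<^sup>2 \<partial>lborel) - 2 * (\<integral>x. f x * f' x \<partial>lborel)) + \<mu>\<^sup>2 * (?a - ?a')\<^sup>2"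
    by simp
  then have prod: "expectation (\<lambda>\<omega>. Y \<omega> * Y' \<omega>) = V * (\<integral>x. f x * f' x \<partial>lborel) + \<mu>\<^sup>2 * (?a * ?a')"
    using expectation_square_diff[OF m(1) m'(1)] m(3) m'(3)
    by (simp add: power2_diff algebra_simps)
  have int': "integrable M Y" "integrable M Y'" "integrable M (\<lambda>\<omega>. Y \<omega> * Y' \<omega>)"
    using m m' by (auto intro: square_integrable_mult square_integrable_integrable)
  have "cov M Y Y' = expectation (\<lambda>\<omega>. Y \<omega> * Y' \<omega> - expectation Y' * Y \<omega> - expectation Y * Y' \<omega>
      + expectation Y * expectation Y')"
    unfolding cov_def by (simp add: algebra_simps)
  also have "\<dots> = expectation (\<lambda>\<omega>. Y \<omega> * Y' \<omega>) - expectation Y * expectation Y'"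
    using int' by (simp add: prob_space)
  finally show ?thesis unfolding prod m(2) m'(2) V_def by (simp add: power2_eq_square)
qed

end

section \<open>Integrals of products of two-sided exponentials\<close>

lemma has_bochner_integral_exp_Ici:
  assumes "c > (0::real)"
  shows "has_bochner_integral lborel (\<lambda>x. exp (- c * x) * indicator {0..} x) (1 / c)"
proof (rule has_bochner_integral_nn_integral)
  have "(\<integral>\<^sup>+x. ennreal (exp (- c * x)) * indicator {0..} x \<partial>lborel) = ennreal (0 - (- exp (- c * 0) / c))"
  proof (rule nn_integral_FTC_atLeast)
    show "((\<lambda>x. - exp (- c * x) / c) has_real_derivative exp (- c * x)) (at x)" for x
      using assms by (auto intro!: derivative_eq_intros)
    have "filterlim (\<lambda>x. - c * x) at_bot at_top"
      by (rule filterlim_tendsto_neg_mult_at_bot[OF tendsto_const _ filterlim_ident]) (use assms in simp)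
    then have "((\<lambda>x. - exp (- c * x) / c) \<longlongrightarrow> - 0 / c) at_top"
      using assms by (intro tendsto_intros filterlim_compose[OF exp_at_bot]) auto
    then show "((\<lambda>x. - exp (- c * x) / c) \<longlongrightarrow> 0) at_top" by simp
  qed auto
  then show "(\<integral>\<^sup>+x. ennreal (exp (- c * x) * indicator {0..} x) \<partial>lborel) = ennreal (1 / c)"
    by (simp add: ennreal_mult'' ennreal_indicator)
qed (use assms in \<open>auto intro!: AE_I2\<close>)

text \<open>Between s and t the product is constant, equal to exp (- l (t - s)). Outside it decays
  from that value at rate 2 l, so each tail contributes a factor 1 / (2 l).\<close>

lemma has_bochner_integral_two_sided_exp_product_ordered:
  fixes l s t :: real
  assumes "l > 0" "s \<le> t"
  shows "has_bochner_integral lborel (\<lambda>u. exp (- l * \<bar>s - u\<bar>) * exp (- l * \<bar>t - u\<bar>))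
    (exp (- l * (t - s)) * (t - s + 1 / l))"
proof -
  define e where "e x = exp (- (2 * l) * x) * indicator {0..} x" for x :: real
  have e: "has_bochner_integral lborel e (1 / (2 * l))"
    unfolding e_def using assms by (intro has_bochner_integral_exp_Ici) simp
  have left: "has_bochner_integral lborel (\<lambda>u. e (s + (- 1) * u)) (1 / (2 * l))"
    using e by (subst (asm) lborel_has_bochner_integral_real_affine_iff[of "- 1" _ _ s]) auto
  have right: "has_bochner_integral lborel (\<lambda>u. e (- t + 1 * u)) (1 / (2 * l))"
    using e by (subst (asm) lborel_has_bochner_integral_real_affine_iff[of 1 _ _ "- t"]) auto
  have mid: "has_bochner_integral lborel (indicator {s<..t} :: real \<Rightarrow> real) (t - s)"
    using has_bochner_integral_real_indicator[of "{s<..t}" lborel] assms by simp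
  have [measurable]: "e \<in> borel_measurable borel" unfolding e_def[abs_def] by measurable
  have "has_bochner_integral lborel
      (\<lambda>u. exp (- l * (t - s)) * (e (s + (- 1) * u) + indicator {s<..t} u + e (- t + 1 * u)))
      (exp (- l * (t - s)) * (1 / (2 * l) + (t - s) + 1 / (2 * l)))"
    by (intro has_bochner_integral_mult_right has_bochner_integral_add left mid right)
  also have "1 / (2 * l) + (t - s) + 1 / (2 * l) = t - s + 1 / l" using assms by (simp add: field_simps)
  also have "has_bochner_integral lborel
      (\<lambda>u. exp (- l * (t - s)) * (e (s + (- 1) * u) + indicator {s<..t} u + e (- t + 1 * u)))
      (exp (- l * (t - s)) * (t - s + 1 / l)) \<longleftrightarrow> ?thesis"
  proof (rule has_bochner_integral_cong_AE)
    \<comment> \<open>The point t is excluded because two of the three summands count it.\<close>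
    show "AE u in lborel. exp (- l * (t - s)) * (e (s + (- 1) * u) + indicator {s<..t} u + e (- t + 1 * u)) =
        exp (- l * \<bar>s - u\<bar>) * exp (- l * \<bar>t - u\<bar>)"
      using AE_lborel_singleton[of t]
    proof eventually_elim
      case (elim u)
      consider "u \<le> s" | "s < u" "u < t" | "t < u" using elim assms by linarith
      then show ?case
        using assms elim
        by cases (auto simp: e_def indicator_def exp_add[symmetric] algebra_simps)
    qed
  qed auto
  finally show ?thesis .
qed

lemma has_bochner_integral_two_sided_exp_product:
  fixes l s t :: real
  assumes "l > 0"
  shows "has_bochner_integral lborel (\<lambda>u. exp (- l * \<bar>s - u\<bar>) * exp (- l * \<bar>t - u\<bar>))
    (exp (- l * \<bar>t - s\<bar>) * (\<bar>t - s\<bar> + 1 / l))"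
proof (cases "s \<le> t")
  case True
  then have "\<bar>t - s\<bar> = t - s" by simp
  with has_bochner_integral_two_sided_exp_product_ordered[OF assms True] show ?thesis by simp
next
  case False
  then have "\<bar>t - s\<bar> = s - t" by simp
  with False show ?thesis
    using has_bochner_integral_two_sided_exp_product_ordered[OF assms, of t s] by (simp add: mult.commute)
qed

lemma two_sided_exp_integrable:
  fixes l t :: real
  assumes "l > 0"
  shows "integrable lborel (\<lambda>u. exp (- l * \<bar>t - u\<bar>))"
    and "square_integrable lborel (\<lambda>u. exp (- l * \<bar>t - u\<bar>))"
proof -
  \<comment> \<open>A single kernel is the square of the kernel with half the rate, so the product
    formula at s = t covers it too.\<close>
  have "exp (- (l / 2) * \<bar>t - u\<bar>) * exp (- (l / 2) * \<bar>t - u\<bar>) = exp (- l * \<bar>t - u\<bar>)" for u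
    by (simp add: exp_add[symmetric])
  with has_bochner_integral_two_sided_exp_product[of "l / 2" t t] assms
  show "integrable lborel (\<lambda>u. exp (- l * \<bar>t - u\<bar>))" by (auto dest: integrable.intros)
  show "square_integrable lborel (\<lambda>u. exp (- l * \<bar>t - u\<bar>))"
    using has_bochner_integral_two_sided_exp_product[of l t t] assms
    unfolding square_integrable_def power2_eq_square by (auto dest: integrable.intros)
qed

text \<open>Up to the factor V, \<gamma> is the covariance function of X. Expanding the product of
  two unit increments leaves minus its second difference at lag a - b.\<close>

lemma two_sided_exp_increment_integral:
  fixes l a b :: real
  assumes "l > 0"
  defines "\<gamma> \<equiv> \<lambda>h. exp (- l * \<bar>h\<bar>) * (\<bar>h\<bar> + 1 / l)"
  shows "(\<integral>u. (exp (- l * \<bar>a + 1 - u\<bar>) - exp (- l * \<bar>a - u\<bar>)) *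
      (exp (- l * \<bar>b + 1 - u\<bar>) - exp (- l * \<bar>b - u\<bar>)) \<partial>lborel) =
    2 * \<gamma> (a - b) - \<gamma> (a - b + 1) - \<gamma> (a - b - 1)"
proof -
  define K where "K t u = exp (- l * \<bar>t - u\<bar>)" for t u :: real
  have K: "has_bochner_integral lborel (\<lambda>u. K s u * K t u) (\<gamma> (s - t))" for s t
    using has_bochner_integral_two_sided_exp_product[OF assms(1), of s t]
    by (simp add: K_def \<gamma>_def abs_minus_commute)
  have "has_bochner_integral lborel (\<lambda>u. K (a + 1) u * K (b + 1) u - K (a + 1) u * K b u
      - (K a u * K (b + 1) u - K a u * K b u))
      (\<gamma> (a + 1 - (b + 1)) - \<gamma> (a + 1 - b) - (\<gamma> (a - (b + 1)) - \<gamma> (a - b)))"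
    by (intro has_bochner_integral_diff K)
  then have "has_bochner_integral lborel (\<lambda>u. (K (a + 1) u - K a u) * (K (b + 1) u - K b u))
      (2 * \<gamma> (a - b) - \<gamma> (a - b + 1) - \<gamma> (a - b - 1))"
    by (simp add: algebra_simps)
  then show ?thesis unfolding K_def by (rule has_bochner_integral_integral_eq)
qed

section \<open>The correlation of the unit increments\<close>

theorem corollary4p2:
  fixes M :: "'a measure" and L X :: "real \<Rightarrow> 'a \<Rightarrow> real" and l :: real
  assumes "prob_space M"
    and "l > 0"
    and "two_sided_levy_process M L"
    and "square_integrable M (L 1)"
    and "prob_space.variance M (L 1) > 0"
    and "\<And>t. t \<ge> 0 \<Longrightarrow> has_levy_integral M L (\<lambda>u. exp (- l * \<bar>t - u\<bar>)) (X t)"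
  shows "(\<forall>k::nat. k \<ge> 1 \<longrightarrow>
            has_corr M (\<lambda>\<omega>. X (real k + 1) \<omega> - X (real k) \<omega>) (\<lambda>\<omega>. X 1 \<omega> - X 0 \<omega>)
              (exp (- l * real k) *
                 (1/2 + 1/2 * ((1 - exp l + l * exp l) / (1 - exp (- l) - l * exp (- l))))
               + l * real k * exp (- l * real k) *
                 (1/2 + 1/2 * ((1 - exp l + l * exp (- l)) / (1 - exp (- l) - l * exp (- l))))))
       \<and> has_corr M (\<lambda>\<omega>. X 2 \<omega> - X 1 \<omega>) (\<lambda>\<omega>. X 1 \<omega> - X 0 \<omega>)
           (exp (- l) *
              ((1 + l) / 2 + 1/2 * ((1 + l - exp l + l\<^sup>2 * exp (- l))
                                     / (1 - exp (- l) - l * exp (- l)))))"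
proof -
  interpret prob_space M by fact
  note L = \<open>two_sided_levy_process M L\<close> \<open>square_integrable M (L 1)\<close>
  define V where "V = variance (L 1)"
  define D where "D = 1 - exp (- l) - l * exp (- l)"
  define \<gamma> where "\<gamma> h = exp (- l * \<bar>h\<bar>) * (\<bar>h\<bar> + 1 / l)" for h
  define F where "F a u = exp (- l * \<bar>a + 1 - u\<bar>) - exp (- l * \<bar>a - u\<bar>)" for a u :: real
  define Y where "Y a \<omega> = X (a + 1) \<omega> - X a \<omega>" for a \<omega>
  have "V > 0" using assms by (simp add: V_def)
  \<comment> \<open>Multiplied by exp (- l), this says D > 0, and D is the factor that makes the
    variance of the increments positive.\<close>
  have "1 + l < exp l"
    using exp_lower_Taylor_quadratic[of l] \<open>l > 0\<close> zero_less_power[of l 2] by linarith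
  then have "(1 + l) * exp (- l) < exp l * exp (- l)" by (intro mult_strict_right_mono) auto
  then have "D > 0" by (simp add: D_def exp_minus_inverse algebra_simps)
  have Y: "has_levy_integral M L (F a) (Y a)" if "a \<ge> 0" for a
    unfolding F_def[abs_def] Y_def[abs_def] using that assms(6) by (intro has_levy_integral_diff L) auto
  have F: "integrable lborel (F a)" "square_integrable lborel (F a)" for a
    unfolding F_def[abs_def] using two_sided_exp_integrable[OF \<open>l > 0\<close>]
    by (auto intro!: square_integrable_diff)
  have F_int: "(\<integral>u. F a u * F b u \<partial>lborel) = 2 * \<gamma> (a - b) - \<gamma> (a - b + 1) - \<gamma> (a - b - 1)" for a b
    unfolding F_def \<gamma>_def by (rule two_sided_exp_increment_integral[OF \<open>l > 0\<close>])
  have sq: "square_integrable M (Y a)" if "a \<ge> 0" for a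
    by (rule has_levy_integral_moments(1)[OF L Y[OF that] F])
  have var: "variance (Y a) = V * (2 * D / l)" if "a \<ge> 0" for a
  proof -
    have "variance (Y a) = V * (\<integral>u. F a u * F a u \<partial>lborel)"
      using has_levy_integral_variance[OF L Y[OF that] F] by (simp add: V_def power2_eq_square)
    also have "(\<integral>u. F a u * F a u \<partial>lborel) = 2 * D / l"
      unfolding F_int using \<open>l > 0\<close> by (simp add: \<gamma>_def D_def field_simps)
    finally show ?thesis .
  qed
  have cov: "cov M (Y (real k)) (Y 0) / (V * (2 * D / l)) =
      exp (- l * real k) * (1/2 + 1/2 * ((1 - exp l + l * exp l) / D))
      + l * real k * exp (- l * real k) * (1/2 + 1/2 * ((1 - exp l + l * exp (- l)) / D))"
    if "k \<ge> 1" for k :: nat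
  proof -
    have "cov M (Y (real k)) (Y 0) = V * (2 * \<gamma> (real k) - \<gamma> (real k + 1) - \<gamma> (real k - 1))"
      using has_levy_integral_cov[OF L Y F Y F, of "real k" 0] F_int[of "real k" 0] by (simp add: V_def)
    also have "\<gamma> (real k) = exp (- l * real k) * (real k + 1 / l)" by (simp add: \<gamma>_def)
    also have "\<gamma> (real k + 1) = exp (- l * real k) * exp (- l) * (real k + 1 + 1 / l)"
      by (simp add: \<gamma>_def exp_add[symmetric] algebra_simps)
    \<comment> \<open>Here k \<ge> 1 removes the absolute value; the closed form fails at k =
      0.\<close>
    also have "\<gamma> (real k - 1) = exp (- l * real k) * exp l * (real k - 1 + 1 / l)"
      using that by (simp add: \<gamma>_def exp_add[symmetric] algebra_simps)
    also have "V * (2 * (E * (real k + 1 / l)) - E * exp (- l) * (real k + 1 + 1 / l)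
        - E * exp l * (real k - 1 + 1 / l)) / (V * (2 * D / l)) =
      E * (1/2 + 1/2 * ((1 - exp l + l * exp l) / D))
      + l * real k * E * (1/2 + 1/2 * ((1 - exp l + l * exp (- l)) / D))" for E
    proof -
      \<comment> \<open>The coefficients of E and of l k E are each written as D plus a remainder;
        on division by 2 D they become the two summands 1/2 and the two fractions of the
        formula.\<close>
      have "2 * (E * (real k + 1 / l)) - E * exp (- l) * (real k + 1 + 1 / l) - E * exp l * (real k - 1 + 1 / l)
          = (E * (D + (1 - exp l + l * exp l)) + l * real k * E * (D + (1 - exp l + l * exp (- l)))) / l"
        using \<open>l > 0\<close> by (simp add: D_def field_simps)
      moreover have "V * ((E * (D + p) + l * real k * E * (D + q)) / l) / (V * (2 * D / l)) =
          E * (1/2 + 1/2 * (p / D)) + l * real k * E * (1/2 + 1/2 * (q / D))" for p q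
        using \<open>l > 0\<close> \<open>V > 0\<close> \<open>D > 0\<close> by (simp add: field_simps)
      ultimately show ?thesis by (simp only:)
    qed
    finally show ?thesis .
  qed
  have corr: "has_corr M (Y (real k)) (Y 0)
      (exp (- l * real k) * (1/2 + 1/2 * ((1 - exp l + l * exp l) / D))
      + l * real k * exp (- l * real k) * (1/2 + 1/2 * ((1 - exp l + l * exp (- l)) / D)))"
    if "k \<ge> 1" for k :: nat
  proof -
    have pos: "V * (2 * D / l) > 0" using \<open>l > 0\<close> \<open>V > 0\<close> \<open>D > 0\<close> by simp
    \<comment> \<open>Both increments have the same variance, so the product of the two square roots
      is that variance.\<close>
    show ?thesis
      unfolding has_corr_def var[OF of_nat_0_le_iff] var[OF order_refl] cov[OF that, symmetric]
      using pos \<open>l > 0\<close> \<open>V > 0\<close> \<open>D > 0\<close> sq[of "real k"] sq[of 0] by simp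
  qed
  have "has_corr M (Y (real 1)) (Y 0)
      (exp (- l) * ((1 + l) / 2 + 1/2 * ((1 + l - exp l + l\<^sup>2 * exp (- l)) / D)))"
  proof -
    \<comment> \<open>When l times the second numerator is added to the first, the terms
      \<open>l * exp l\<close> cancel.\<close>
    have "exp (- l * real 1) * (1/2 + 1/2 * ((1 - exp l + l * exp l) / D))
      + l * real 1 * exp (- l * real 1) * (1/2 + 1/2 * ((1 - exp l + l * exp (- l)) / D)) =
      exp (- l) * ((1 + l) / 2 + 1/2 * ((1 + l - exp l + l\<^sup>2 * exp (- l)) / D))"
      using \<open>D > 0\<close> by (simp add: field_simps power2_eq_square)
    with corr[of 1] show ?thesis by simp
  qed
  with corr show ?thesis by (simp add: Y_def[abs_def] D_def)
qed

end
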